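(* Let $p,q$ be positive integers, let $X$ in $\mathbb R^p$ and $Y$ in $\mathbb R^q$ be random vectors, and for each $n$ let $\mathcal V_n^2=\mathcal V_n^2(\mathbf X,\mathbf Y)$ and $S_2$ be computed from a random sample $(\mathbf X,\mathbf Y)=\{(X_k,Y_k):k=1,\dots,n\}$ from the joint distribution of $(X,Y)$. If $E(|X|_p+|Y|_q)<\infty$, then: (i) If $X$ and $Y$ are independent, then $n\mathcal V_n^2/S_2$ converges in distribution, as $n\to\infty$, to $Q$, where $Q$ is a nonnegative quadratic form of centered Gaussian random variables, $$Q\stackrel{D}{=}\sum_{j=1}^\infty\lambda_jZ_j^2,$$ with $Z_j$ independent standard normal random variables and $\{\lambda_j\}$ nonnegative constants that depend on the distribution of $(X,Y)$, and $E[Q]=1$. (ii) If $X$ and $Y$ are dependent, then $n\mathcal V_n^2/S_2\to\infty$ in probability as $n\to\infty$.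
   Context: $|\cdot|_d$ is the Euclidean norm on $\mathbb R^d$, and $\stackrel{D}{=}$ denotes equality in distribution. Put $a_{kl}=|X_k-X_l|_p$, $\bar a_{k\cdot}=\frac1n\sum_{l=1}^n a_{kl}$, $\bar a_{\cdot l}=\frac1n\sum_{k=1}^n a_{kl}$, $\bar a_{\cdot\cdot}=\frac1{n^2}\sum_{k,l=1}^n a_{kl}$, $A_{kl}=a_{kl}-\bar a_{k\cdot}-\bar a_{\cdot l}+\bar a_{\cdot\cdot}$; similarly $b_{kl}=|Y_k-Y_l|_q$ and $B_{kl}=b_{kl}-\bar b_{k\cdot}-\bar b_{\cdot l}+\bar b_{\cdot\cdot}$, for $k,l=1,\dots,n$. Then $$\mathcal V_n^2(\mathbf X,\mathbf Y)=\frac1{n^2}\sum_{k,l=1}^n A_{kl}B_{kl},\qquad S_2=\frac1{n^2}\sum_{k,l=1}^n|X_k-X_l|_p\cdot\frac1{n^2}\sum_{k,l=1}^n|Y_k-Y_l|_q.$$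
   Formalization: Part (i) additionally assumes that neither X nor Y is almost surely constant; if one is, then S_2 = 0 almost surely, the ratio nV_n^2/S_2 is 0/0, and E[Q] = 1 cannot hold. *)

theory Defs
  imports "HOL-Probability.Probability"
begin

definition dist_entry :: "(nat \<Rightarrow> real ^ 'd) \<Rightarrow> nat \<Rightarrow> nat \<Rightarrow> real" where
  "dist_entry x k l = norm (x k - x l)"

definition row_mean :: "nat \<Rightarrow> (nat \<Rightarrow> nat \<Rightarrow> real) \<Rightarrow> nat \<Rightarrow> real" where
  "row_mean n a k = (1 / real n) * (\<Sum>l=1..n. a k l)"

definition col_mean :: "nat \<Rightarrow> (nat \<Rightarrow> nat \<Rightarrow> real) \<Rightarrow> nat \<Rightarrow> real" where
  "col_mean n a l = (1 / real n) * (\<Sum>k=1..n. a k l)"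

definition grand_mean :: "nat \<Rightarrow> (nat \<Rightarrow> nat \<Rightarrow> real) \<Rightarrow> real" where
  "grand_mean n a = (1 / (real n)\<^sup>2) * (\<Sum>k=1..n. \<Sum>l=1..n. a k l)"

definition centered :: "nat \<Rightarrow> (nat \<Rightarrow> nat \<Rightarrow> real) \<Rightarrow> nat \<Rightarrow> nat \<Rightarrow> real" where
  "centered n a k l = a k l - row_mean n a k - col_mean n a l + grand_mean n a"

text \<open>Here \<open>dcov_sq\<close> is the squared empirical distance covariance
  \<open>V\<^sub>n\<^sup>2\<close> (the whole symbol, including the square).\<close>

definition dcov_sq :: "nat \<Rightarrow> (nat \<Rightarrow> real ^ 'p) \<Rightarrow> (nat \<Rightarrow> real ^ 'q) \<Rightarrow> real" where
  "dcov_sq n x y = (1 / (real n)\<^sup>2) *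
     (\<Sum>k=1..n. \<Sum>l=1..n. centered n (dist_entry x) k l * centered n (dist_entry y) k l)"

definition S2 :: "nat \<Rightarrow> (nat \<Rightarrow> real ^ 'p) \<Rightarrow> (nat \<Rightarrow> real ^ 'q) \<Rightarrow> real" where
  "S2 n x y = ((1 / (real n)\<^sup>2) * (\<Sum>k=1..n. \<Sum>l=1..n. norm (x k - x l))) *
              ((1 / (real n)\<^sup>2) * (\<Sum>k=1..n. \<Sum>l=1..n. norm (y k - y l)))"

text \<open>For nondegenerate \<open>X\<close> and \<open>Y\<close> the event \<open>S2 = 0\<close>, where the quotient below is \<open>0\<close> by
  the convention \<open>x / 0 = 0\<close>, has a probability that tends to \<open>0\<close>.\<close>

definition test_stat :: "nat \<Rightarrow> (nat \<Rightarrow> real ^ 'p) \<Rightarrow> (nat \<Rightarrow> real ^ 'q) \<Rightarrow> real" where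
  "test_stat n x y = real n * dcov_sq n x y / S2 n x y"

text \<open>The sample of size \<open>n\<close> is carried by its own probability space \<open>N\<close>, and only the
  entries with index \<open>1, \<dots>, n\<close> are constrained. \<open>X\<close> and \<open>Y\<close> live on \<open>M\<close> and enter through their
  joint law.\<close>

definition random_sample ::
  "'a measure \<Rightarrow> ('a \<Rightarrow> real ^ 'p) \<Rightarrow> ('a \<Rightarrow> real ^ 'q) \<Rightarrow> nat \<Rightarrow>
   'b measure \<Rightarrow> (nat \<Rightarrow> 'b \<Rightarrow> real ^ 'p) \<Rightarrow> (nat \<Rightarrow> 'b \<Rightarrow> real ^ 'q) \<Rightarrow> bool" where
  "random_sample M X Y n N xs ys \<longleftrightarrow>
     prob_space N \<and>
     prob_space.indep_vars N (\<lambda>_. borel) (\<lambda>k \<omega>. (xs k \<omega>, ys k \<omega>)) {1..n} \<and>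
     (\<forall>k\<in>{1..n}. distr N borel (\<lambda>\<omega>. (xs k \<omega>, ys k \<omega>)) = distr M borel (\<lambda>\<omega>. (X \<omega>, Y \<omega>)))"

definition iid_std_normal :: "'c measure \<Rightarrow> (nat \<Rightarrow> 'c \<Rightarrow> real) \<Rightarrow> bool" where
  "iid_std_normal W Z \<longleftrightarrow>
     prob_space.indep_vars W (\<lambda>_. borel) Z UNIV \<and>
     (\<forall>j. distributed W lborel (Z j) std_normal_density)"

text \<open>The library's \<open>indep_var\<close> requires both variables to have the same value type.
  This is its characterization \<open>indep_var_eq\<close>, for measurable variables, at two types.\<close>

definition indep_vectors :: "'a measure \<Rightarrow> ('a \<Rightarrow> real ^ 'p) \<Rightarrow> ('a \<Rightarrow> real ^ 'q) \<Rightarrow> bool" where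
  "indep_vectors M X Y \<longleftrightarrow>
     prob_space.indep_set M
       (sigma_sets (space M) {X -` A \<inter> space M | A. A \<in> sets borel})
       (sigma_sets (space M) {Y -` B \<inter> space M | B. B \<in> sets borel})"

definition ae_constant :: "'a measure \<Rightarrow> ('a \<Rightarrow> 'd) \<Rightarrow> bool" where
  "ae_constant M X \<longleftrightarrow> (\<exists>c. AE \<omega> in M. X \<omega> = c)"

text \<open>As for convergence in distribution, the variables \<open>R n\<close> may live on different spaces.\<close>

definition to_infinity_in_prob :: "(nat \<Rightarrow> 'b measure) \<Rightarrow> (nat \<Rightarrow> 'b \<Rightarrow> real) \<Rightarrow> bool" where
  "to_infinity_in_prob N R \<longleftrightarrow>
     (\<forall>c. (\<lambda>n. measure (N n) {\<omega> \<in> space (N n). R n \<omega> > c}) \<longlonglongrightarrow> 1)"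

end

theory Submission
  imports Defs
begin

text \<open>
The proof rests on a map \<open>\<Phi>\<close> from Euclidean space to the Hilbert space \<open>l2\<close> with
\<open>\<bar>\<Phi> x - \<Phi> y\<bar>\<^sup>2 = \<bar>x - y\<bar>\<close> (\<open>ex_dist_embedding\<close>). Double centering turns the distance matrix
\<open>\<bar>X\<^sub>k - X\<^sub>l\<bar>\<close> into \<open>-2\<close> times the Gram matrix of the vectors \<open>\<Phi> X\<^sub>k\<close> minus their mean, so that
\<open>n V\<^sub>n\<^sup>2 = 4 \<bar>T\<^sub>n - D\<^sub>n\<bar>\<^sup>2\<close> with \<open>T\<^sub>n = n\<^sup>-\<^sup>1\<^sup>/\<^sup>2 \<Sum>\<^sub>k f(X\<^sub>k) \<otimes> g(Y\<^sub>k)\<close>, where \<open>f\<close> and \<open>g\<close> are the embeddings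
minus their expectations, and \<open>D\<^sub>n\<close> is \<open>n\<^sup>1\<^sup>/\<^sup>2\<close> times the tensor product of the two sample means
(\<open>dcov_sq_tensor\<close>).

If \<open>X\<close> and \<open>Y\<close> are independent, the summands of \<open>T\<^sub>n\<close> are centered and their second moment is
\<open>\<tau> = E \<bar>f(X)\<bar>\<^sup>2 E \<bar>g(Y)\<bar>\<^sup>2\<close>, which is finite because \<open>\<bar>\<Phi> x\<bar>\<^sup>2 = \<bar>x\<bar>\<close>: this is why first moments
suffice. Moreover \<open>D\<^sub>n\<close> is of order \<open>n\<^sup>-\<^sup>1\<^sup>/\<^sup>2\<close> and \<open>S\<^sub>2\<close> tends to \<open>4 \<tau>\<close>, so the statistic behaves like
\<open>\<bar>T\<^sub>n\<bar>\<^sup>2 / \<tau>\<close>. The covariance form of a summand has an orthonormal system \<open>v\<^sub>j\<close> of eigenvectors with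
eigenvalues \<open>\<lambda>\<^sub>j\<close> whose sum is exactly \<open>\<tau>\<close> (\<open>eigval_sums\<close>); this gives \<open>E Q = 1\<close>, and it shows that
finitely many of the uncorrelated coordinates \<open>\<langle>T\<^sub>n, v\<^sub>j\<rangle>\<close> carry almost all of \<open>\<bar>T\<^sub>n\<bar>\<^sup>2\<close>, uniformly in \<open>n\<close>.
For finitely many coordinates, \<open>exp (- s \<Sum>\<^sub>j \<langle>T\<^sub>n, v\<^sub>j\<rangle>\<^sup>2)\<close> is the average of
\<open>exp (i (2s)\<^sup>1\<^sup>/\<^sup>2 \<Sum>\<^sub>j w\<^sub>j \<langle>T\<^sub>n, v\<^sub>j\<rangle>)\<close> over independent standard normal \<open>w\<^sub>j\<close>. For each fixed \<open>w\<close> the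
one-dimensional central limit theorem applies, and the limit, averaged over \<open>w\<close>, already is the Laplace
transform of \<open>\<Sum>\<^sub>j \<lambda>\<^sub>j w\<^sub>j\<^sup>2\<close> (\<open>laplace_norm_scaled_sum\<close>). Convergence of Laplace transforms of
nonnegative variables implies weak convergence (\<open>weak_conv_of_laplace\<close>).

Both the existence of \<open>\<Phi>\<close> and part (ii) come from half-spaces. If \<open>g\<close> is a standard Gaussian vector
and \<open>t\<close> runs through the real line with Lebesgue measure, the half-spaces \<open>{z. t < g \<bullet> z}\<close> that
contain exactly one of \<open>x\<close> and \<open>y\<close> have measure \<open>E \<bar>g \<bullet> (x - y)\<bar>\<close>, a fixed multiple of \<open>\<bar>x - y\<bar>\<close>.
Hence the kernel \<open>(\<bar>x\<bar> + \<bar>y\<bar> - \<bar>x - y\<bar>) / 2\<close> is positive semidefinite, and a Cholesky factorization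
along a dense sequence of points yields the coordinates of \<open>\<Phi>\<close>. The same formula represents \<open>V\<^sub>n\<^sup>2\<close>
as a multiple of the integral of the squared empirical covariance of the indicators of
\<open>t < g \<bullet> X\<close> and \<open>s < h \<bullet> Y\<close> (\<open>dcov_sq_halfspace\<close>). These covariances are bounded, so after passing
to an equivalent finite measure the integral converges in mean without any moment condition. Its limit
is positive unless almost all population covariances vanish; half-space probabilities determine a
measure (\<open>halfspace_measure_eqI\<close>), so in that case \<open>X\<close> and \<open>Y\<close> are independent. Under dependence
\<open>V\<^sub>n\<^sup>2\<close> therefore stays above a positive constant with probability tending to \<open>1\<close>, while \<open>S\<^sub>2\<close> is
bounded in probability.

The law of the statistic depends only on the \<open>n\<close>-fold product of the law of \<open>(X, Y)\<close>, so all limits are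
computed on the coordinates of one infinite product space (\<open>distr_test_stat\<close>).
\<close>

section \<open>The Hilbert space of square-summable sequences\<close>

typedef l2 = "{u :: nat \<Rightarrow> real. summable (\<lambda>m. (u m)\<^sup>2)}"
  morphisms coord Abs_l2 by (rule exI[of _ "\<lambda>_. 0"]) simp

setup_lifting type_definition_l2

lemma summable_coord_sq [simp]: "summable (\<lambda>m. (coord u m)\<^sup>2)"
  using coord[of u] by simp

lemma coord_Abs: "summable (\<lambda>m. (u m)\<^sup>2) \<Longrightarrow> coord (Abs_l2 u) = u"
  by (simp add: Abs_l2_inverse)

lemma summable_mult_of_squares:
  fixes a b :: "nat \<Rightarrow> real"
  assumes "summable (\<lambda>m. (a m)\<^sup>2)" "summable (\<lambda>m. (b m)\<^sup>2)"
  shows "summable (\<lambda>m. a m * b m)"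
proof (rule summable_comparison_test'[OF summable_add[OF assms]])
  fix m
  have "0 \<le> (\<bar>a m\<bar> - \<bar>b m\<bar>)\<^sup>2" by simp
  then have "2 * (\<bar>a m\<bar> * \<bar>b m\<bar>) \<le> (a m)\<^sup>2 + (b m)\<^sup>2"
    by (simp add: power2_eq_square algebra_simps)
  then show "norm (a m * b m) \<le> (a m)\<^sup>2 + (b m)\<^sup>2"
    using mult_nonneg_nonneg[OF abs_ge_zero abs_ge_zero, of "a m" "b m"]
    unfolding real_norm_def abs_mult by linarith
qed

lemma summable_square_add:
  fixes a b :: "nat \<Rightarrow> real"
  assumes "summable (\<lambda>m. (a m)\<^sup>2)" "summable (\<lambda>m. (b m)\<^sup>2)"
  shows "summable (\<lambda>m. (a m + b m)\<^sup>2)"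
  using summable_add[OF summable_add[OF assms] summable_mult[OF summable_mult_of_squares[OF assms], of 2]]
  by (simp add: power2_sum mult.assoc)

instantiation l2 :: real_vector
begin

lift_definition zero_l2 :: l2 is "\<lambda>_. 0" by simp
lift_definition plus_l2 :: "l2 \<Rightarrow> l2 \<Rightarrow> l2" is "\<lambda>u v m. u m + v m"
  by (simp add: summable_square_add)
lift_definition uminus_l2 :: "l2 \<Rightarrow> l2" is "\<lambda>u m. - u m" by simp
lift_definition minus_l2 :: "l2 \<Rightarrow> l2 \<Rightarrow> l2" is "\<lambda>u v m. u m - v m"
  using summable_square_add[of _ "\<lambda>m. - (_ m)"] by simp
lift_definition scaleR_l2 :: "real \<Rightarrow> l2 \<Rightarrow> l2" is "\<lambda>c u m. c * u m"
  by (simp add: power_mult_distrib summable_mult)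

instance
  by standard (transfer; simp add: fun_eq_iff algebra_simps)+

end

lemma coord_simps [simp]:
  "coord 0 m = 0" "coord (u + v) m = coord u m + coord v m" "coord (- u) m = - coord u m"
  "coord (u - v) m = coord u m - coord v m" "coord (c *\<^sub>R u) m = c * coord u m"
  by (transfer; simp)+

lemma coord_sum [simp]: "coord (\<Sum>k\<in>A. u k) m = (\<Sum>k\<in>A. coord (u k) m)"
  by (induction A rule: infinite_finite_induct) auto

lemma l2_eqI: "(\<And>m. coord u m = coord v m) \<Longrightarrow> u = v"
  by (simp add: coord_inject[symmetric] fun_eq_iff)

instantiation l2 :: real_inner
begin

definition inner_l2 :: "l2 \<Rightarrow> l2 \<Rightarrow> real" where
  "inner_l2 u v = (\<Sum>m. coord u m * coord v m)"
definition norm_l2 :: "l2 \<Rightarrow> real" where "norm_l2 u = sqrt (inner u u)"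
definition dist_l2 :: "l2 \<Rightarrow> l2 \<Rightarrow> real" where "dist_l2 u v = norm (u - v)"
definition sgn_l2 :: "l2 \<Rightarrow> l2" where "sgn_l2 u = u /\<^sub>R norm u"
definition uniformity_l2 :: "(l2 \<times> l2) filter" where
  "uniformity_l2 = (INF e\<in>{0<..}. principal {(u, v). dist u v < e})"
definition open_l2 :: "l2 set \<Rightarrow> bool" where
  "open_l2 U \<longleftrightarrow> (\<forall>x\<in>U. \<forall>\<^sub>F (x', y) in uniformity. x' = x \<longrightarrow> y \<in> U)"

instance
proof
  fix u v w :: l2 and c :: real
  show "inner u v = inner v u" by (simp add: inner_l2_def mult.commute)
  show "inner (u + v) w = inner u w + inner v w"
    by (simp add: inner_l2_def distrib_right suminf_add summable_mult_of_squares)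
  show "inner (c *\<^sub>R u) v = c * inner u v"
    by (simp add: inner_l2_def suminf_mult[symmetric] summable_mult_of_squares mult.assoc)
  show "0 \<le> inner u u"
    by (simp add: inner_l2_def suminf_nonneg summable_mult_of_squares)
  show "inner u u = 0 \<longleftrightarrow> u = 0"
  proof
    assume "inner u u = 0"
    then have "coord u m * coord u m = 0" for m
      using suminf_eq_zero_iff[of "\<lambda>m. coord u m * coord u m"]
      by (simp add: inner_l2_def summable_mult_of_squares)
    then show "u = 0" by (intro l2_eqI) simp
  qed (simp add: inner_l2_def)
qed (simp_all add: dist_l2_def norm_l2_def sgn_l2_def uniformity_l2_def open_l2_def)

end

lemma inner_l2_sums: "(\<lambda>m. coord u m * coord v m) sums inner u v"
  by (simp add: inner_l2_def summable_sums summable_mult_of_squares)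

lemma norm_l2_sums: "(\<lambda>m. (coord u m)\<^sup>2) sums (norm u)\<^sup>2"
  using inner_l2_sums[of u u] by (simp add: power2_eq_square flip: power2_norm_eq_inner)

lemma sum_coord_sq_le: "(\<Sum>m<n. (coord u m)\<^sup>2) \<le> (norm u)\<^sup>2"
  using norm_l2_sums[of u] sum_le_suminf[of "\<lambda>m. (coord u m)\<^sup>2" "{..<n}"] by (simp add: sums_iff)

lemma coord_le_norm: "\<bar>coord u m\<bar> \<le> norm u"
proof -
  have "(coord u m)\<^sup>2 \<le> (\<Sum>k<Suc m. (coord u k)\<^sup>2)"
    by (simp add: sum_nonneg)
  also have "\<dots> \<le> (norm u)\<^sup>2" by (rule sum_coord_sq_le)
  finally show ?thesis
    by (metis abs_le_square_iff abs_norm_cancel)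
qed

lift_definition axis_l2 :: "nat \<Rightarrow> l2" is "\<lambda>j m. if m = j then 1 else 0"
  by (rule summable_finite[of "{_}"]) auto

lemma coord_axis: "coord (axis_l2 j) m = (if m = j then 1 else 0)"
  by (transfer) simp

lemma inner_axis_l2: "inner (axis_l2 j) u = coord u j" "inner u (axis_l2 j) = coord u j"
proof -
  have "(\<lambda>m. coord (axis_l2 j) m * coord u m) sums coord u j"
    using sums_single[of j "\<lambda>m. coord u m"] by (rule sums_cong[THEN iffD1, rotated]) (auto simp: coord_axis)
  then show "inner (axis_l2 j) u = coord u j" using inner_l2_sums sums_unique2 by blast
  then show "inner u (axis_l2 j) = coord u j" by (simp add: inner_commute)
qed

lemma norm_axis_l2 [simp]: "norm (axis_l2 j) = 1"
  by (simp add: norm_eq_sqrt_inner inner_axis_l2 coord_axis)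

text \<open>
The tensor product is realized inside the same space: its coordinates are the products
\<open>u\<^sub>i v\<^sub>j\<close>, enumerated by the pairing function of the natural numbers.
\<close>

definition tensor :: "l2 \<Rightarrow> l2 \<Rightarrow> l2" where
  "tensor u v = Abs_l2 (\<lambda>m. coord u (fst (prod_decode m)) * coord v (snd (prod_decode m)))"

lemma sums_prod_decode:
  fixes a b :: "nat \<Rightarrow> real"
  assumes "summable (\<lambda>i. \<bar>a i\<bar>)" "summable (\<lambda>j. \<bar>b j\<bar>)"
  shows "(\<lambda>m. a (fst (prod_decode m)) * b (snd (prod_decode m))) sums ((\<Sum>i. a i) * (\<Sum>j. b j))"
proof -
  have A: "(a has_sum (\<Sum>i. a i)) UNIV" "(b has_sum (\<Sum>i. b i)) UNIV"
    using norm_summable_imp_has_sum[of a "\<Sum>i. a i"] norm_summable_imp_has_sum[of b "\<Sum>j. b j"]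
      assms summable_sums[OF summable_rabs_cancel] by simp_all
  have B: "(\<lambda>i. \<bar>a i\<bar>) summable_on UNIV" "(\<lambda>i. \<bar>b i\<bar>) summable_on UNIV"
    using norm_summable_imp_summable_on[of "\<lambda>i. \<bar>a i\<bar>"] norm_summable_imp_summable_on[of "\<lambda>i. \<bar>b i\<bar>"] assms
    by simp_all
  have "(\<lambda>p. \<bar>a (fst p)\<bar> * \<bar>b (snd p)\<bar>) summable_on UNIV \<times> UNIV"
  proof (rule summable_on_SigmaI)
    show "((\<lambda>j. \<bar>a (fst (i, j))\<bar> * \<bar>b (snd (i, j))\<bar>) has_sum (\<bar>a i\<bar> * infsum (\<lambda>j. \<bar>b j\<bar>) UNIV)) UNIV" for i
      unfolding fst_conv snd_conv by (rule has_sum_cmult_right[OF has_sum_infsum[OF B(2)]])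
    show "(\<lambda>i. \<bar>a i\<bar> * infsum (\<lambda>j. \<bar>b j\<bar>) UNIV) summable_on UNIV"
      by (rule summable_on_cmult_left[OF B(1)])
  qed (metis abs_ge_zero mult_nonneg_nonneg)
  then have summ: "(\<lambda>p. a (fst p) * b (snd p)) summable_on UNIV \<times> UNIV"
    by (rule abs_summable_summable[OF summable_on_cong[THEN iffD1, rotated]]) (simp add: abs_mult)
  have "((\<lambda>p. a (fst p) * b (snd p)) has_sum ((\<Sum>i. a i) * (\<Sum>j. b j))) (UNIV \<times> UNIV)"
  proof (rule has_sum_SigmaI[OF _ _ summ])
    show "((\<lambda>j. a (fst (i, j)) * b (snd (i, j))) has_sum (a i * (\<Sum>j. b j))) UNIV" for i
      unfolding fst_conv snd_conv by (rule has_sum_cmult_right[OF A(2)])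
    show "((\<lambda>i. a i * (\<Sum>j. b j)) has_sum ((\<Sum>i. a i) * (\<Sum>j. b j))) UNIV"
      by (rule has_sum_cmult_left[OF A(1)])
  qed
  then have "((\<lambda>m. a (fst (prod_decode m)) * b (snd (prod_decode m))) has_sum ((\<Sum>i. a i) * (\<Sum>j. b j))) UNIV"
    using has_sum_reindex_bij_betw[OF bij_prod_decode, of "\<lambda>p. a (fst p) * b (snd p)"] by simp
  then show ?thesis by (rule has_sum_imp_sums)
qed

lemma coord_tensor: "coord (tensor u v) m = coord u (fst (prod_decode m)) * coord v (snd (prod_decode m))"
  unfolding tensor_def
  by (subst coord_Abs)
     (use sums_prod_decode[of "\<lambda>m. (coord u m)\<^sup>2" "\<lambda>m. (coord v m)\<^sup>2"] in
       \<open>auto simp: power_mult_distrib sums_iff\<close>)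

lemma summable_abs_mult_coord: "summable (\<lambda>m. \<bar>coord u m * coord v m\<bar>)"
  using summable_mult_of_squares[of "\<lambda>m. \<bar>coord u m\<bar>" "\<lambda>m. \<bar>coord v m\<bar>"] by (simp add: abs_mult)

lemma inner_tensor: "inner (tensor u v) (tensor u' v') = inner u u' * inner v v'"
proof -
  have "(\<lambda>m. coord (tensor u v) m * coord (tensor u' v') m) sums (inner u u' * inner v v')"
    using sums_prod_decode[OF summable_abs_mult_coord[of u u'] summable_abs_mult_coord[of v v']]
    by (simp add: coord_tensor inner_l2_def mult.commute mult.left_commute)
  then show ?thesis using inner_l2_sums sums_unique2 by blast
qed

lemma norm_tensor: "norm (tensor u v) = norm u * norm v"
  by (simp add: norm_eq_sqrt_inner inner_tensor real_sqrt_mult)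

lemma tensor_linear:
  "tensor (u + u') v = tensor u v + tensor u' v" "tensor (u - u') v = tensor u v - tensor u' v"
  "tensor u (v + v') = tensor u v + tensor u v'" "tensor u (v - v') = tensor u v - tensor u v'"
  "tensor (c *\<^sub>R u) v = c *\<^sub>R tensor u v" "tensor u (c *\<^sub>R v) = c *\<^sub>R tensor u v"
  by (rule l2_eqI; simp add: coord_tensor algebra_simps)+

lemma tensor_sum:
  "tensor (\<Sum>k\<in>A. u k) v = (\<Sum>k\<in>A. tensor (u k) v)"
  "tensor w (\<Sum>k\<in>A. u k) = (\<Sum>k\<in>A. tensor w (u k))"
  by (rule l2_eqI; simp add: coord_tensor sum_distrib_left sum_distrib_right)+

text \<open>
Measurability of the coordinates carries over to every inner product and norm, which are limits of
polynomials in finitely many coordinates.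
\<close>

definition l2_measurable :: "'a measure \<Rightarrow> ('a \<Rightarrow> l2) \<Rightarrow> bool" where
  "l2_measurable M H \<longleftrightarrow> (\<forall>m. (\<lambda>z. coord (H z) m) \<in> borel_measurable M)"

lemma l2_measurable_inner:
  assumes "l2_measurable M H" "l2_measurable M H'"
  shows "(\<lambda>z. inner (H z) (H' z)) \<in> borel_measurable M"
  using assms unfolding l2_measurable_def inner_l2_def by (intro borel_measurable_suminf borel_measurable_times) auto

lemma l2_measurable_const [simp]: "l2_measurable M (\<lambda>_. u)"
  by (simp add: l2_measurable_def)

lemma l2_measurable_norm:
  assumes "l2_measurable M H" shows "(\<lambda>z. norm (H z)) \<in> borel_measurable M"
  using l2_measurable_inner[OF assms assms] unfolding norm_eq_sqrt_inner by measurable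

lemma l2_measurable_arith:
  assumes "l2_measurable M H" "l2_measurable M H'"
  shows "l2_measurable M (\<lambda>z. H z + H' z)" "l2_measurable M (\<lambda>z. H z - H' z)"
    "l2_measurable M (\<lambda>z. tensor (H z) (H' z))"
  using assms by (auto simp: l2_measurable_def coord_tensor intro!: borel_measurable_times borel_measurable_add borel_measurable_diff)

lemma l2_measurable_scaleR: "l2_measurable M H \<Longrightarrow> l2_measurable M (\<lambda>z. c *\<^sub>R H z)"
  by (auto simp: l2_measurable_def intro!: borel_measurable_times)

lemma l2_measurable_compose:
  "l2_measurable N H \<Longrightarrow> f \<in> measurable M N \<Longrightarrow> l2_measurable M (\<lambda>z. H (f z))"
  by (auto simp: l2_measurable_def intro: measurable_compose)

text \<open>
On a bounded set, convergence of the coordinates is weak convergence: a truncation of \<open>w\<close> to finitely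
many coordinates changes the inner products uniformly little.
\<close>

lemma inner_l2_tendsto:
  assumes bd: "\<And>n. norm (u n) \<le> 1" and c: "\<And>m. (\<lambda>n. coord (u n) m) \<longlonglongrightarrow> coord v m"
  shows "(\<lambda>n. inner (u n) w) \<longlonglongrightarrow> inner v w"
proof -
  define tr :: "nat \<Rightarrow> l2" where "tr N = (\<Sum>m<N. coord w m *\<^sub>R axis_l2 m)" for N
  have trc: "coord (tr N) m = (if m < N then coord w m else 0)" for N m
    by (auto simp: tr_def coord_axis if_distrib[of "\<lambda>x. _ * x"] cong: if_cong)
  have nrm: "(norm (w - tr N))\<^sup>2 = (norm w)\<^sup>2 - (\<Sum>m<N. (coord w m)\<^sup>2)" for N
  proof -
    have "(\<lambda>m. (coord w m)\<^sup>2 - (if m \<in> {..<N} then (coord w m)\<^sup>2 else 0)) sums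
        ((norm w)\<^sup>2 - (\<Sum>m<N. (coord w m)\<^sup>2))"
      by (intro sums_diff norm_l2_sums sums_If_finite_set) simp
    moreover have "(\<lambda>m. (coord w m)\<^sup>2 - (if m \<in> {..<N} then (coord w m)\<^sup>2 else 0)) =
        (\<lambda>m. (coord (w - tr N) m)\<^sup>2)" by (auto simp: trc)
    ultimately show ?thesis using norm_l2_sums sums_unique2 by metis
  qed
  have "(\<lambda>N. (norm w)\<^sup>2 - (\<Sum>m<N. (coord w m)\<^sup>2)) \<longlonglongrightarrow> (norm w)\<^sup>2 - (norm w)\<^sup>2"
    using norm_l2_sums[of w] by (intro tendsto_diff tendsto_const) (simp add: sums_def)
  then have "(\<lambda>N. (norm (w - tr N))\<^sup>2) \<longlonglongrightarrow> 0" by (simp add: nrm)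
  then have tr0: "(\<lambda>N. norm (w - tr N)) \<longlonglongrightarrow> 0"
    using tendsto_real_sqrt by fastforce
  have fin: "(\<lambda>n. inner (u n) (tr N)) \<longlonglongrightarrow> inner v (tr N)" for N
    unfolding tr_def inner_sum_right inner_scaleR_right inner_axis_l2
    by (intro tendsto_intros c)
  show ?thesis
  proof (rule LIMSEQ_I)
    fix e :: real assume e: "0 < e"
    have "eventually (\<lambda>N. norm (w - tr N) < e / (3 * (1 + norm v))) sequentially"
      using tr0 e by (intro order_tendstoD) (auto simp: add_pos_nonneg)
    then obtain N where N: "norm (w - tr N) < e / (3 * (1 + norm v))"
      by (auto simp: eventually_sequentially)
    have p: "0 < 1 + norm v" by (simp add: add_pos_nonneg)
    have N': "norm (w - tr N) * (1 + norm v) < e / 3" using N p by (simp add: field_simps)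
    obtain n0 where n0: "\<And>n. n \<ge> n0 \<Longrightarrow> norm (inner (u n) (tr N) - inner v (tr N)) < e / 3"
      using LIMSEQ_D[OF fin[of N], of "e/3"] e by auto
    show "\<exists>no. \<forall>n\<ge>no. norm (inner (u n) w - inner v w) < e"
    proof (intro exI allI impI)
      fix n assume n: "n \<ge> n0"
      have "inner (u n) w - inner v w =
        inner (u n) (w - tr N) - inner v (w - tr N) + (inner (u n) (tr N) - inner v (tr N))"
        by (simp add: algebra_simps)
      moreover have "\<bar>inner (u n) (w - tr N)\<bar> \<le> norm (w - tr N) * (1 + norm v)"
        by (rule order.trans[OF Cauchy_Schwarz_ineq2])
           (use mult_mono[of "norm (u n)" "1 + norm v" "norm (w - tr N)" "norm (w - tr N)"] bd[of n] p
             in \<open>auto simp: mult.commute add_increasing2\<close>)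
      moreover have "\<bar>inner v (w - tr N)\<bar> \<le> norm (w - tr N) * (1 + norm v)"
        by (rule order.trans[OF Cauchy_Schwarz_ineq2]) (simp add: algebra_simps)
      ultimately show "norm (inner (u n) w - inner v w) < e"
        using n0[OF n] N' by (auto simp: abs_if split: if_splits)
    qed
  qed
qed

text \<open>
The cube \<open>[-1,1]\<^sup>\<nat>\<close> is compact and metrizable, and the norm bound passes to coordinatewise limits
because it bounds every finite partial sum.
\<close>

lemma weakly_compact_l2_ball:
  fixes u :: "nat \<Rightarrow> l2"
  assumes "\<And>n. norm (u n) \<le> 1"
  shows "\<exists>v r. strict_mono r \<and> norm v \<le> 1 \<and> (\<forall>m. (\<lambda>n. coord (u (r n)) m) \<longlonglongrightarrow> coord v m)"
proof -
  have "compact (PiE UNIV (\<lambda>_::nat. {-1..1::real}))"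
    using compactin_PiE[of "\<lambda>_::nat. euclidean :: real topology" UNIV "\<lambda>_. {-1..1::real}"]
    by (simp add: euclidean_product_topology)
  moreover have "coord (u n) \<in> PiE UNIV (\<lambda>_::nat. {-1..1::real})" for n
  proof -
    have "\<bar>coord (u n) m\<bar> \<le> 1" for m using coord_le_norm[of "u n" m] assms[of n] by linarith
    then show ?thesis by (auto simp: abs_le_iff minus_le_iff PiE_iff)
  qed
  ultimately obtain l r where lr: "strict_mono r" "((\<lambda>n. coord (u n)) \<circ> r) \<longlonglongrightarrow> l"
    using seq_compactE[OF compact_imp_seq_compact, of _ "\<lambda>n. coord (u n)"] by blast
  have c: "(\<lambda>n. coord (u (r n)) m) \<longlonglongrightarrow> l m" for m
    using continuous_on_tendsto_compose[OF continuous_on_product_coordinates[of m] lr(2)] by (simp add: o_def)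
  have part: "(\<Sum>m<N. (l m)\<^sup>2) \<le> 1" for N
  proof (rule LIMSEQ_le_const2)
    show "(\<lambda>n. \<Sum>m<N. (coord (u (r n)) m)\<^sup>2) \<longlonglongrightarrow> (\<Sum>m<N. (l m)\<^sup>2)"
      by (intro tendsto_intros c)
    show "\<exists>N0. \<forall>n\<ge>N0. (\<Sum>m<N. (coord (u (r n)) m)\<^sup>2) \<le> 1"
      using sum_coord_sq_le assms by (meson norm_ge_zero order_trans power_le_one)
  qed
  have s: "summable (\<lambda>m. (l m)\<^sup>2)"
    by (rule summableI_nonneg_bounded[of _ 1]) (auto simp: part)
  have "(norm (Abs_l2 l))\<^sup>2 = (\<Sum>m. (l m)\<^sup>2)"
    using norm_l2_sums[of "Abs_l2 l"] by (simp add: coord_Abs[OF s] sums_iff)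
  also have "\<dots> \<le> 1" by (rule suminf_le_const[OF s part])
  finally have "norm (Abs_l2 l) \<le> 1" by (simp add: abs_square_le_1)
  then show ?thesis using lr(1) c by (intro exI[of _ "Abs_l2 l"] exI[of _ r]) (simp add: coord_Abs[OF s])
qed

section \<open>Gaussian vectors and half-spaces\<close>

lemma
  fixes f :: "'i \<Rightarrow> 'a \<Rightarrow> 'b::{real_normed_field, banach, second_countable_topology}"
  assumes M: "\<And>i. prob_space (M i)" and J: "finite J" "J \<subseteq> I"
    and f: "\<And>j. j \<in> J \<Longrightarrow> integrable (M j) (f j)"
  shows integral_PiM_prod: "(\<integral>w. (\<Prod>j\<in>J. f j (w j)) \<partial>PiM I M) = (\<Prod>j\<in>J. \<integral>z. f j z \<partial>M j)"
    and integrable_PiM_prod: "integrable (PiM I M) (\<lambda>w. \<Prod>j\<in>J. f j (w j))"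
proof -
  interpret product_prob_space M I by (intro product_prob_spaceI M)
  have [measurable]: "f j \<in> borel_measurable (M j)" if "j \<in> J" for j
    using f[OF that] by (rule borel_measurable_integrable)
  have D: "distr (PiM I M) (PiM J M) (\<lambda>x. restrict x J) = PiM J M"
    by (rule distr_PiM_restrict_finite[OF J])
  have [measurable]: "(\<lambda>w. \<Prod>j\<in>J. f j (w j)) \<in> borel_measurable (PiM J M)"
    by (intro borel_measurable_prod measurable_compose[OF measurable_component_singleton]) auto
  have R [measurable]: "(\<lambda>x. restrict x J) \<in> measurable (PiM I M) (PiM J M)"
    by (rule measurable_restrict_subset[OF J(2)])
  have eq: "(\<lambda>w. \<Prod>j\<in>J. f j (w j)) \<circ> (\<lambda>x. restrict x J) = (\<lambda>w. \<Prod>j\<in>J. f j (w j))"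
    by (auto simp: fun_eq_iff intro!: prod.cong)
  have "integrable (PiM J M) (\<lambda>w. \<Prod>j\<in>J. f j (w j))"
    by (rule product_integrable_prod[OF J(1) f])
  then show "integrable (PiM I M) (\<lambda>w. \<Prod>j\<in>J. f j (w j))"
    using integrable_distr_eq[OF R, of "\<lambda>w. \<Prod>j\<in>J. f j (w j)"] D eq by (simp add: o_def)
  have "(\<integral>w. (\<Prod>j\<in>J. f j (w j)) \<partial>PiM I M) = (\<integral>w. (\<Prod>j\<in>J. f j (w j)) \<partial>PiM J M)"
    using integral_distr[OF R, of "\<lambda>w. \<Prod>j\<in>J. f j (w j)"] D eq by (simp add: o_def)
  also have "\<dots> = (\<Prod>j\<in>J. \<integral>z. f j z \<partial>M j)"
    by (rule product_integral_prod[OF J(1) f])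
  finally show "(\<integral>w. (\<Prod>j\<in>J. f j (w j)) \<partial>PiM I M) = (\<Prod>j\<in>J. \<integral>z. f j z \<partial>M j)" .
qed

abbreviation std_normals :: "'i set \<Rightarrow> ('i \<Rightarrow> real) measure" where
  "std_normals I \<equiv> PiM I (\<lambda>_. std_normal_distribution)"

lemma prob_space_std_normals: "prob_space (std_normals I)"
  by (intro prob_space_PiM prob_space_normal_density) simp

text \<open>
This identity is used in both directions: it gives the characteristic function of a Gaussian vector,
and it writes \<open>exp (- \<Sum> a\<^sub>j\<^sup>2 / 2)\<close> as an average of exponentials that are linear in \<open>a\<close>.
\<close>

lemma iexp_std_normals:
  assumes "finite J" "J \<subseteq> I"
  shows "(\<integral>w. iexp (\<Sum>j\<in>J. a j * w j) \<partial>std_normals I) = of_real (exp (- (\<Sum>j\<in>J. (a j)\<^sup>2) / 2))"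
proof -
  interpret N: prob_space std_normal_distribution by (rule prob_space_normal_density) simp
  have int: "integrable std_normal_distribution (\<lambda>z. iexp (a j * z))" for j
    by (rule N.integrable_const_bound[of _ 1]) auto
  have "(\<integral>w. iexp (\<Sum>j\<in>J. a j * w j) \<partial>std_normals I) = (\<integral>w. (\<Prod>j\<in>J. iexp (a j * w j)) \<partial>std_normals I)"
    by (simp add: sum_distrib_left exp_sum[OF assms(1)])
  also have "\<dots> = (\<Prod>j\<in>J. \<integral>z. iexp (a j * z) \<partial>std_normal_distribution)"
    using integral_PiM_prod[OF _ assms, of "\<lambda>_. std_normal_distribution" "\<lambda>j z. iexp (a j * z)"]
      int N.prob_space_axioms by simp
  also have "\<dots> = (\<Prod>j\<in>J. of_real (exp (- (a j)\<^sup>2 / 2)))"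
    using char_std_normal_distribution by (simp add: char_def fun_eq_iff)
  also have "\<dots> = of_real (exp (- (\<Sum>j\<in>J. (a j)\<^sup>2) / 2))"
    by (simp add: exp_sum[OF assms(1), symmetric] sum_negf sum_divide_distrib flip: of_real_prod)
  finally show ?thesis .
qed

definition std_gauss :: "'a::euclidean_space measure" where
  "std_gauss = distr (std_normals Basis) borel (\<lambda>f. \<Sum>b\<in>Basis. f b *\<^sub>R b)"

lemma measurable_sum_Basis [measurable]:
  "(\<lambda>f. \<Sum>b\<in>Basis. f b *\<^sub>R b) \<in> measurable (std_normals Basis) (borel :: 'a::euclidean_space measure)"
  by measurable

lemma sets_std_gauss [measurable_cong, simp]: "sets std_gauss = sets borel"
  by (simp add: std_gauss_def)

lemma space_std_gauss [simp]: "space std_gauss = UNIV"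
  by (simp add: std_gauss_def)

lemma prob_space_std_gauss: "prob_space (std_gauss :: 'a::euclidean_space measure)"
proof -
  interpret prob_space "std_normals (Basis :: 'a set)" by (rule prob_space_std_normals)
  show ?thesis unfolding std_gauss_def by (rule prob_space_distr) measurable
qed

lemma iexp_std_gauss:
  fixes x :: "'a::euclidean_space"
  shows "(\<integral>g. iexp (g \<bullet> x) \<partial>std_gauss) = of_real (exp (- (norm x)\<^sup>2 / 2))"
proof -
  have "(\<integral>g. iexp (g \<bullet> x) \<partial>std_gauss) = (\<integral>f. iexp (\<Sum>b\<in>Basis. (x \<bullet> b) * f b) \<partial>std_normals Basis)"
    unfolding std_gauss_def
    by (subst integral_distr) (simp_all add: inner_sum_left inner_sum_right inner_commute[of _ x] mult.commute)
  also have "\<dots> = of_real (exp (- (norm x)\<^sup>2 / 2))"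
    unfolding iexp_std_normals[OF finite_Basis order_refl]
    by (simp add: euclidean_inner[of x x] power2_norm_eq_inner flip: power2_eq_square)
  finally show ?thesis .
qed

text \<open>
Rotation invariance of the Gaussian law: the projection on \<open>x\<close> depends on \<open>x\<close> only through its norm,
because its characteristic function is \<open>exp (- s\<^sup>2 \<bar>x\<bar>\<^sup>2 / 2)\<close>.
\<close>

lemma distr_inner_std_gauss:
  fixes x :: "'a::euclidean_space"
  shows "distr std_gauss borel (\<lambda>g. g \<bullet> x) = distr std_normal_distribution borel (\<lambda>z. norm x * z)"
proof (rule Levy_uniqueness)
  interpret G: prob_space "std_gauss :: 'a measure" by (rule prob_space_std_gauss)
  interpret N: prob_space std_normal_distribution by (rule prob_space_normal_density) simp
  show "real_distribution (distr std_gauss borel (\<lambda>g. g \<bullet> x))"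
    by (rule G.real_distribution_distr) measurable
  show "real_distribution (distr std_normal_distribution borel (\<lambda>z. norm x * z))"
    by (rule N.real_distribution_distr) measurable
  show "char (distr std_gauss borel (\<lambda>g. g \<bullet> x)) = char (distr std_normal_distribution borel (\<lambda>z. norm x * z))"
  proof
    fix t
    have "char (distr std_gauss borel (\<lambda>g. g \<bullet> x)) t = (\<integral>g. iexp (g \<bullet> (t *\<^sub>R x)) \<partial>std_gauss)"
      unfolding char_def by (subst integral_distr) simp_all
    also have "\<dots> = of_real (exp (- (t * norm x)\<^sup>2 / 2))"
      unfolding iexp_std_gauss by (simp add: power_mult_distrib)
    also have "\<dots> = char std_normal_distribution (t * norm x)"
      by (simp add: char_std_normal_distribution)
    also have "\<dots> = char (distr std_normal_distribution borel (\<lambda>z. norm x * z)) t"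
      unfolding char_def by (subst integral_distr) (simp_all add: mult.assoc)
    finally show "char (distr std_gauss borel (\<lambda>g. g \<bullet> x)) t = char (distr std_normal_distribution borel (\<lambda>z. norm x * z)) t" .
  qed
qed

definition mean_abs_normal :: real where
  "mean_abs_normal = (\<integral>z. \<bar>z\<bar> \<partial>std_normal_distribution)"

lemma integrable_abs_normal: "integrable std_normal_distribution (\<lambda>z. \<bar>z\<bar>)"
  by (subst integrable_density) (use std_normal_moment_abs_odd[of 0] in \<open>auto simp: has_bochner_integral_iff mult.commute\<close>)

lemma mean_abs_normal_pos: "0 < mean_abs_normal"
proof -
  have "mean_abs_normal = sqrt (2 / pi)"
    unfolding mean_abs_normal_def
    by (subst integral_density) (use std_normal_moment_abs_odd[of 0] in \<open>auto simp: has_bochner_integral_iff mult.commute\<close>)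
  moreover have "0 < sqrt (2 / pi)" using pi_gt_zero by (intro real_sqrt_gt_zero divide_pos_pos) auto
  ultimately show ?thesis by linarith
qed

lemma nn_integral_abs_inner_std_gauss:
  fixes x :: "'a::euclidean_space"
  shows "(\<integral>\<^sup>+g. ennreal \<bar>g \<bullet> x\<bar> \<partial>std_gauss) = ennreal (mean_abs_normal * norm x)"
proof -
  have "(\<integral>\<^sup>+g. ennreal \<bar>g \<bullet> x\<bar> \<partial>std_gauss) = (\<integral>\<^sup>+z. ennreal \<bar>z\<bar> \<partial>distr std_gauss borel (\<lambda>g. g \<bullet> x))"
    by (subst nn_integral_distr) simp_all
  also have "\<dots> = (\<integral>\<^sup>+z. ennreal (norm x * \<bar>z\<bar>) \<partial>std_normal_distribution)"
    unfolding distr_inner_std_gauss by (subst nn_integral_distr) (simp_all add: abs_mult)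
  also have "\<dots> = ennreal (norm x * mean_abs_normal)"
    unfolding mean_abs_normal_def using integrable_abs_normal
    by (subst nn_integral_eq_integral) auto
  finally show ?thesis by (simp add: mult.commute)
qed

text \<open>
A pair \<open>(g, t)\<close> stands for the half-space of all \<open>x\<close> with \<open>t < g \<bullet> x\<close>, and \<open>hs x\<close> below is the
indicator, as a function of the half-space, of the event that it contains \<open>x\<close>.
\<close>

definition halfspaces :: "('a::euclidean_space \<times> real) measure" where
  "halfspaces = std_gauss \<Otimes>\<^sub>M lborel"

definition hs :: "'a::euclidean_space \<Rightarrow> 'a \<times> real \<Rightarrow> real" where
  "hs x u = of_bool (snd u < fst u \<bullet> x)"

lemma hs_bounds: "0 \<le> hs x u" "hs x u \<le> 1"
  by (simp_all add: hs_def)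

lemma sets_halfspaces [measurable_cong, simp]: "sets halfspaces = sets (borel \<Otimes>\<^sub>M borel)"
  unfolding halfspaces_def by (rule sets_pair_measure_cong) simp_all

lemma space_halfspaces [simp]: "space halfspaces = UNIV"
  by (simp add: halfspaces_def space_pair_measure)

lemma sigma_finite_halfspaces: "sigma_finite_measure (halfspaces :: ('a::euclidean_space \<times> real) measure)"
proof -
  interpret G: prob_space "std_gauss :: 'a measure" by (rule prob_space_std_gauss)
  interpret pair_sigma_finite "std_gauss :: 'a measure" lborel ..
  show ?thesis unfolding halfspaces_def ..
qed

lemma measurable_hs [measurable]:
  "(\<lambda>p. hs (fst p) (snd p)) \<in> borel_measurable (borel \<Otimes>\<^sub>M halfspaces)"
  unfolding hs_def by measurable

lemma measurable_hs1 [measurable]: "hs x \<in> borel_measurable halfspaces"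
  unfolding hs_def by measurable

text \<open>
For a fixed direction \<open>g\<close> the thresholds that separate \<open>x\<close> from \<open>y\<close> form an interval of length
\<open>\<bar>g \<bullet> (x - y)\<bar>\<close>; averaging over \<open>g\<close> leaves a multiple of the Euclidean distance.
\<close>

lemma nn_integral_hs_diff:
  "(\<integral>\<^sup>+u. ennreal ((hs x u - hs y u)\<^sup>2) \<partial>halfspaces) = ennreal (mean_abs_normal * norm (x - y))"
proof -
  have slice: "(\<integral>\<^sup>+t. ennreal ((hs x (g, t) - hs y (g, t))\<^sup>2) \<partial>lborel) = ennreal \<bar>g \<bullet> (x - y)\<bar>" for g
  proof -
    have "(\<integral>\<^sup>+t. ennreal ((hs x (g, t) - hs y (g, t))\<^sup>2) \<partial>lborel)
      = (\<integral>\<^sup>+t. indicator {min (g \<bullet> x) (g \<bullet> y)..<max (g \<bullet> x) (g \<bullet> y)} t \<partial>lborel)"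
      by (intro nn_integral_cong) (auto simp: hs_def split: split_indicator)
    also have "\<dots> = ennreal \<bar>g \<bullet> x - g \<bullet> y\<bar>"
      by (simp add: max_def min_def)
    finally show ?thesis by (simp add: inner_diff_right)
  qed
  have "(\<integral>\<^sup>+u. ennreal ((hs x u - hs y u)\<^sup>2) \<partial>halfspaces)
    = (\<integral>\<^sup>+g. (\<integral>\<^sup>+t. ennreal ((hs x (g, t) - hs y (g, t))\<^sup>2) \<partial>lborel) \<partial>std_gauss)"
    unfolding halfspaces_def by (subst lborel.nn_integral_fst[symmetric]) (simp_all add: halfspaces_def[symmetric])
  then show ?thesis by (simp add: slice nn_integral_abs_inner_std_gauss)
qed

lemma
  shows integrable_hs_diff: "integrable halfspaces (\<lambda>u. (hs x u - hs y u)\<^sup>2)"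
    and integral_hs_diff: "(\<integral>u. (hs x u - hs y u)\<^sup>2 \<partial>halfspaces) = mean_abs_normal * norm (x - y)"
proof -
  show I: "integrable halfspaces (\<lambda>u. (hs x u - hs y u)\<^sup>2)"
    by (intro integrableI_nonneg) (simp_all add: nn_integral_hs_diff)
  show "(\<integral>u. (hs x u - hs y u)\<^sup>2 \<partial>halfspaces) = mean_abs_normal * norm (x - y)"
    using mean_abs_normal_pos by (subst integral_eq_nn_integral) (simp_all add: nn_integral_hs_diff)
qed

text \<open>
The Gram kernel of the vectors \<open>\<Phi> x\<close> when \<open>\<bar>\<Phi> x - \<Phi> y\<bar>\<^sup>2 = \<bar>x - y\<bar>\<close> and \<open>\<Phi> 0 = 0\<close>.
\<close>

definition dist_kernel :: "'a::euclidean_space \<Rightarrow> 'a \<Rightarrow> real" where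
  "dist_kernel x y = (norm x + norm y - norm (x - y)) / 2"

lemma
  shows integrable_hs_prod: "integrable halfspaces (\<lambda>u. (hs x u - hs 0 u) * (hs y u - hs 0 u))"
    and integral_hs_prod: "(\<integral>u. (hs x u - hs 0 u) * (hs y u - hs 0 u) \<partial>halfspaces) = mean_abs_normal * dist_kernel x y"
proof -
  have eq: "(\<lambda>u. (hs x u - hs 0 u) * (hs y u - hs 0 u)) =
    (\<lambda>u. ((hs x u - hs 0 u)\<^sup>2 + (hs y u - hs 0 u)\<^sup>2 - (hs x u - hs y u)\<^sup>2) / 2)"
    by (simp add: fun_eq_iff power2_eq_square algebra_simps)
  show "integrable halfspaces (\<lambda>u. (hs x u - hs 0 u) * (hs y u - hs 0 u))"
    unfolding eq by (intro integrable_divide Bochner_Integration.integrable_diff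
      Bochner_Integration.integrable_add integrable_hs_diff)
  show "(\<integral>u. (hs x u - hs 0 u) * (hs y u - hs 0 u) \<partial>halfspaces) = mean_abs_normal * dist_kernel x y"
    unfolding eq by (simp add: integrable_hs_diff integral_hs_diff dist_kernel_def field_simps)
qed

text \<open>
Up to a positive factor the quadratic form is the integral of the square of a combination of the
functions \<open>hs x - hs 0\<close>.
\<close>

lemma dist_kernel_psd:
  fixes S :: "'a::euclidean_space set"
  shows "0 \<le> (\<Sum>x\<in>S. \<Sum>y\<in>S. c x * c y * dist_kernel x y)"
proof -
  have "0 \<le> (\<integral>u. (\<Sum>x\<in>S. c x * (hs x u - hs 0 u))\<^sup>2 \<partial>halfspaces)" by simp
  also have "(\<lambda>u. (\<Sum>x\<in>S. c x * (hs x u - hs 0 u))\<^sup>2) =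
    (\<lambda>u. \<Sum>x\<in>S. \<Sum>y\<in>S. c x * c y * ((hs x u - hs 0 u) * (hs y u - hs 0 u)))"
    by (simp add: power2_eq_square sum_product mult_ac)
  also have "(\<integral>u. (\<Sum>x\<in>S. \<Sum>y\<in>S. c x * c y * ((hs x u - hs 0 u) * (hs y u - hs 0 u))) \<partial>halfspaces)
     = mean_abs_normal * (\<Sum>x\<in>S. \<Sum>y\<in>S. c x * c y * dist_kernel x y)"
    by (simp add: integrable_hs_prod integral_hs_prod sum_distrib_left mult_ac)
  finally show ?thesis using mean_abs_normal_pos by (simp add: zero_le_mult_iff)
qed

section \<open>A Hilbert space embedding of the square root of the distance\<close>

definition psd_kernel :: "('a \<Rightarrow> 'a \<Rightarrow> real) \<Rightarrow> bool" where
  "psd_kernel K \<longleftrightarrow> (\<forall>x y. K x y = K y x) \<and>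
     (\<forall>S c. finite S \<longrightarrow> 0 \<le> (\<Sum>x\<in>S. \<Sum>y\<in>S. c x * c y * K x y))"

lemma psd_kernel_sym: "psd_kernel K \<Longrightarrow> K x y = K y x"
  by (auto simp: psd_kernel_def)

lemma psd_kernel_sum:
  "psd_kernel K \<Longrightarrow> finite S \<Longrightarrow> 0 \<le> (\<Sum>x\<in>S. \<Sum>y\<in>S. c x * c y * K x y)"
  by (simp add: psd_kernel_def)

lemma psd_kernel_diag:
  assumes "psd_kernel K" shows "0 \<le> K x x"
  using psd_kernel_sum[OF assms, of "{x}" "\<lambda>_. 1"] by simp

lemma psd_kernel_two:
  assumes "psd_kernel K"
  shows "0 \<le> a\<^sup>2 * K x x + 2 * a * b * K x y + b\<^sup>2 * K y y"
proof (cases "x = y")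
  case True
  have "0 \<le> (a + b)\<^sup>2 * K x x" using psd_kernel_diag[OF assms] by simp
  then show ?thesis using True by (simp add: power2_eq_square algebra_simps)
next
  case False
  have "0 \<le> (\<Sum>u\<in>{x, y}. \<Sum>v\<in>{x, y}. (if u = x then a else b) * (if v = x then a else b) * K u v)"
    by (rule psd_kernel_sum[OF assms]) simp
  then show ?thesis using False psd_kernel_sym[OF assms, of x y]
    by (simp add: power2_eq_square algebra_simps)
qed

lemma psd_kernel_zero_row:
  assumes "psd_kernel K" "K d d = 0" shows "K x d = 0"
proof (rule ccontr)
  assume nz: "K x d \<noteq> 0"
  define b where "b = - (K x x + 1) / (2 * K x d)"
  have "0 \<le> 1\<^sup>2 * K x x + 2 * 1 * b * K x d + b\<^sup>2 * K d d" by (rule psd_kernel_two[OF assms(1)])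
  also have "\<dots> = - 1" using nz assms(2) by (simp add: b_def field_simps)
  finally show False by simp
qed

text \<open>
The Schur complement of \<open>K\<close> at \<open>d\<close> is the Gram kernel of the projections on the orthogonal
complement of the vector that represents \<open>d\<close>. If \<open>K d d = 0\<close>, that vector is zero and the division
by zero correctly leaves \<open>K\<close> unchanged.
\<close>

definition schur :: "('a \<Rightarrow> 'a \<Rightarrow> real) \<Rightarrow> 'a \<Rightarrow> 'a \<Rightarrow> 'a \<Rightarrow> real" where
  "schur K d x y = K x y - K x d * K y d / K d d"

text \<open>
The quadratic form of the Schur complement is the form of \<open>K\<close> after the weight at \<open>d\<close> has been
shifted to the value that minimizes it.
\<close>

lemma psd_kernel_schur:
  assumes K: "psd_kernel K" shows "psd_kernel (schur K d)"
  unfolding psd_kernel_def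
proof (intro conjI allI impI)
  show "schur K d x y = schur K d y x" for x y
    using psd_kernel_sym[OF K, of x y] by (simp add: schur_def mult.commute)
  fix S :: "'a set" and c :: "'a \<Rightarrow> real" assume S: "finite S"
  define q where "q c = (\<Sum>x\<in>insert d S. \<Sum>y\<in>insert d S. c x * c y * K x y)" for c
  define c0 where "c0 x = (if x \<in> S then c x else 0)" for x
  define r where "r = (\<Sum>x\<in>S. c x * K x d)"
  define w where "w = - r / K d d"
  \<comment> \<open>the minimizing shift of the weight at \<open>d\<close> is \<open>w\<close>\<close>
  define c1 where "c1 x = c0 x + w * (if x = d then 1 else 0)" for x
  have sumS: "(\<Sum>x\<in>insert d S. c0 x * f x) = (\<Sum>x\<in>S. c x * f x)" for f
    by (rule sum.mono_neutral_cong_right) (use S in \<open>auto simp: c0_def\<close>)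
  have pt: "(\<Sum>x\<in>insert d S. (if x = d then 1 else 0) * f x) = f d" for f :: "'a \<Rightarrow> real"
    using S by (simp add: if_distrib[of "\<lambda>z. z * _"] cong: if_cong)
  have c1S: "(\<Sum>x\<in>insert d S. c1 x * f x) = (\<Sum>x\<in>S. c x * f x) + w * f d" for f
    unfolding c1_def distrib_right sum.distrib sumS mult.assoc sum_distrib_left[symmetric] pt ..
  have "0 \<le> q c1" unfolding q_def by (rule psd_kernel_sum[OF K]) (simp add: S)
  also have "q c1 = (\<Sum>x\<in>insert d S. c1 x * (\<Sum>y\<in>insert d S. c1 y * K x y))"
    by (simp add: q_def sum_distrib_left mult.assoc)
  also have "\<dots> = (\<Sum>x\<in>S. c x * ((\<Sum>y\<in>S. c y * K x y) + w * K x d)) + w * ((\<Sum>y\<in>S. c y * K d y) + w * K d d)"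
    by (simp only: c1S)
  also have "(\<Sum>y\<in>S. c y * K d y) = r"
    unfolding r_def by (intro sum.cong refl arg_cong2[of _ _ _ _ "(*)"] psd_kernel_sym[OF K])
  also have "(\<Sum>x\<in>S. c x * ((\<Sum>y\<in>S. c y * K x y) + w * K x d)) = (\<Sum>x\<in>S. \<Sum>y\<in>S. c x * c y * K x y) + w * r"
    by (simp add: distrib_left sum.distrib r_def sum_distrib_left mult_ac)
  finally have pos: "0 \<le> (\<Sum>x\<in>S. \<Sum>y\<in>S. c x * c y * K x y) + w * r + w * (r + w * K d d)" .
  have r0: "r = 0" if "K d d = 0"
    using psd_kernel_zero_row[OF K that] by (simp add: r_def)
  have "w * r + w * (r + w * K d d) = - (r * r / K d d)"
    using r0 by (cases "K d d = 0") (simp_all add: w_def field_simps)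
  moreover have "(\<Sum>x\<in>S. \<Sum>y\<in>S. c x * c y * schur K d x y) = (\<Sum>x\<in>S. \<Sum>y\<in>S. c x * c y * K x y) - r * r / K d d"
  proof -
    have "(\<Sum>x\<in>S. \<Sum>y\<in>S. c x * c y * (K x d * K y d / K d d)) = r * r / K d d"
      unfolding r_def sum_product by (simp add: sum_divide_distrib mult_ac)
    then show ?thesis by (simp add: schur_def right_diff_distrib sum_subtractf)
  qed
  ultimately show "0 \<le> (\<Sum>x\<in>S. \<Sum>y\<in>S. c x * c y * schur K d x y)" using pos by linarith
qed

context
  fixes K :: "'a \<Rightarrow> 'a \<Rightarrow> real" and d :: "nat \<Rightarrow> 'a"
  assumes K: "psd_kernel K"
begin

text \<open>
Cholesky factorization along the points \<open>d 0, d 1, \<dots>\<close>: \<open>chol i\<close> is the kernel that remains after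
the first \<open>i\<close> points have been eliminated, \<open>chol_col i\<close> the column split off at step \<open>i\<close>, and
\<open>chol_dist i\<close> the squared distance belonging to the remaining kernel.
\<close>

primrec chol :: "nat \<Rightarrow> 'a \<Rightarrow> 'a \<Rightarrow> real" where
  "chol 0 = K"
| "chol (Suc i) = schur (chol i) (d i)"

definition chol_col :: "nat \<Rightarrow> 'a \<Rightarrow> real" where
  "chol_col i x = chol i x (d i) / sqrt (chol i (d i) (d i))"

definition chol_dist :: "nat \<Rightarrow> 'a \<Rightarrow> 'a \<Rightarrow> real" where
  "chol_dist i x y = chol i x x - 2 * chol i x y + chol i y y"

lemma psd_chol: "psd_kernel (chol i)"
  by (induction i) (simp_all add: K psd_kernel_schur)

lemma chol_Suc: "chol (Suc i) x y = chol i x y - chol_col i x * chol_col i y"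
  using psd_kernel_diag[OF psd_chol, of i "d i"]
  by (simp add: schur_def chol_col_def)

lemma chol_dist_Suc: "chol_dist (Suc i) x y = chol_dist i x y - (chol_col i x - chol_col i y)\<^sup>2"
  unfolding chol_dist_def chol_Suc by (simp add: power2_eq_square algebra_simps)

lemma chol_dist_nonneg: "0 \<le> chol_dist i x y"
  using psd_kernel_two[OF psd_chol, of 1 i x "-1" y] by (simp add: chol_dist_def)

lemma chol_dist_le: "chol_dist i x y \<le> chol_dist 0 x y"
proof (induction i)
  case (Suc i)
  then show ?case
    using chol_dist_Suc[of i x y] zero_le_power2[of "chol_col i x - chol_col i y"] by linarith
qed simp

lemma chol_zero: "j < i \<Longrightarrow> chol i (d j) (d j) = 0"
proof (induction i)
  case (Suc i)
  show ?case
  proof (cases "j = i")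
    case False
    then have "chol i (d j) (d j) = 0" using Suc by simp
    then show ?thesis
      using psd_kernel_zero_row[OF psd_chol, of i "d j" "d i"] psd_kernel_sym[OF psd_chol, of i "d j" "d i"]
      by (simp add: schur_def)
  qed (simp add: schur_def)
qed simp

text \<open>
A point eliminated earlier is represented by zero, so the remaining squared norm of \<open>x\<close> is its
remaining squared distance to that point, and these distances only decrease.
\<close>

lemma chol_diag_le: assumes "j < i" shows "chol i x x \<le> chol_dist 0 x (d j)"
proof -
  have "chol i x x = chol_dist i x (d j)"
    using psd_kernel_zero_row[OF psd_chol chol_zero[OF assms], of x] chol_zero[OF assms]
    by (simp add: chol_dist_def)
  then show ?thesis using chol_dist_le by simp
qed

lemma chol_dist_upper: "chol_dist i x y \<le> 2 * (chol i x x + chol i y y)"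
  using psd_kernel_two[OF psd_chol, of 1 i x 1 y] by (simp add: chol_dist_def)

lemma chol_sums:
  assumes dense: "\<And>x e. 0 < e \<Longrightarrow> \<exists>j. chol_dist 0 x (d j) < e"
  shows "(\<lambda>i. (chol_col i x - chol_col i y)\<^sup>2) sums chol_dist 0 x y"
proof -
  have diag: "(\<lambda>i. chol i x x) \<longlonglongrightarrow> 0" for x
  proof (rule LIMSEQ_I)
    fix e :: real assume "0 < e"
    then obtain j where j: "chol_dist 0 x (d j) < e" using dense by blast
    have "norm (chol i x x - 0) < e" if "i \<ge> Suc j" for i
      using chol_diag_le[of j i x] that j psd_kernel_diag[OF psd_chol, of i x] by simp
    then show "\<exists>no. \<forall>i\<ge>no. norm (chol i x x - 0) < e" by blast
  qed
  have "(\<lambda>i. 2 * (chol i x x + chol i y y)) \<longlonglongrightarrow> 2 * (0 + 0)"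
    by (intro tendsto_intros diag)
  then have lim: "(\<lambda>i. 2 * (chol i x x + chol i y y)) \<longlonglongrightarrow> 0" by simp
  have "(\<lambda>i. chol_dist i x y) \<longlonglongrightarrow> 0"
    by (rule Lim_null_comparison[OF always_eventually lim]) (use chol_dist_nonneg chol_dist_upper in simp)
  then have "(\<lambda>i. chol_dist 0 x y - chol_dist i x y) \<longlonglongrightarrow> chol_dist 0 x y - 0"
    by (intro tendsto_intros)
  moreover have "(\<Sum>j<i. (chol_col j x - chol_col j y)\<^sup>2) = chol_dist 0 x y - chol_dist i x y" for i
    by (induction i) (simp_all add: chol_dist_Suc)
  ultimately show ?thesis by (simp add: sums_def)
qed

end

lemma psd_dist_kernel: "psd_kernel (dist_kernel :: 'a::euclidean_space \<Rightarrow> _)"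
  by (auto simp: psd_kernel_def dist_kernel_psd) (simp add: dist_kernel_def norm_minus_commute add.commute)

text \<open>
Along a dense sequence the remaining kernel of the factorization tends to zero at every point, so
the columns are the coordinates of an embedding. They are built from the kernel by arithmetic
operations and hence measurable.
\<close>

theorem ex_dist_embedding:
  "\<exists>\<Phi> :: 'a::euclidean_space \<Rightarrow> l2.
     (\<forall>x y. (norm (\<Phi> x - \<Phi> y))\<^sup>2 = norm (x - y)) \<and> \<Phi> 0 = 0 \<and> l2_measurable borel \<Phi>"
proof -
  obtain D :: "'a set" where D: "countable D" "\<And>X. open X \<Longrightarrow> X \<noteq> {} \<Longrightarrow> \<exists>d\<in>D. d \<in> X"
    using countable_dense_setE by metis
  have "D \<noteq> {}" using D(2)[of UNIV] by auto
  define d where "d = from_nat_into D"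
  have dense: "\<exists>j. norm (x - d j) < e" if "0 < e" for x e
    using D(2)[of "ball x e"] that \<open>D \<noteq> {}\<close> D(1) from_nat_into_surj[OF D(1)]
    by (auto simp: d_def dist_norm)
  let ?K = "dist_kernel :: 'a \<Rightarrow> 'a \<Rightarrow> real"
  have d0: "chol_dist ?K d 0 x y = norm (x - y)" for x y
    by (simp add: chol_dist_def[OF psd_dist_kernel] chol.simps[OF psd_dist_kernel] dist_kernel_def diff_divide_distrib add_divide_distrib)
  define F where "F i x = chol_col ?K d i x - chol_col ?K d i 0" for i x
  have sums: "(\<lambda>i. (F i x - F i y)\<^sup>2) sums norm (x - y)" for x y
    using chol_sums[OF psd_dist_kernel, of d x y] dense by (simp add: F_def d0)
  define \<Phi> where "\<Phi> x = Abs_l2 (\<lambda>i. F i x)" for x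
  have F0: "F i 0 = 0" for i by (simp add: F_def)
  have cF: "coord (\<Phi> x) = (\<lambda>i. F i x)" for x
    unfolding \<Phi>_def using sums[of x 0] by (intro coord_Abs) (simp add: sums_iff F0)
  have meas: "(\<lambda>x. chol ?K d i x y) \<in> borel_measurable borel" for i y
  proof (induction i arbitrary: y)
    case 0
    have "(\<lambda>x. dist_kernel x y) \<in> borel_measurable borel" unfolding dist_kernel_def by measurable
    then show ?case by (simp add: chol.simps[OF psd_dist_kernel])
  next
    case (Suc i)
    then show ?case
      by (simp add: chol.simps[OF psd_dist_kernel] schur_def borel_measurable_diff borel_measurable_times borel_measurable_divide)
  qed
  have "(norm (\<Phi> x - \<Phi> y))\<^sup>2 = norm (x - y)" for x y
    using norm_l2_sums[of "\<Phi> x - \<Phi> y"] sums[of x y] sums_unique2 by (fastforce simp: cF)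
  moreover have "\<Phi> 0 = 0" by (rule l2_eqI) (simp add: cF F0)
  moreover have "l2_measurable borel \<Phi>"
    unfolding l2_measurable_def cF F_def chol_col_def[OF psd_dist_kernel]
    by (intro allI borel_measurable_diff borel_measurable_divide meas) auto
  ultimately show ?thesis by blast
qed

definition dist_embed :: "'a::euclidean_space \<Rightarrow> l2" where
  "dist_embed = (SOME \<Phi>. (\<forall>x y. (norm (\<Phi> x - \<Phi> y))\<^sup>2 = norm (x - y)) \<and> \<Phi> 0 = 0 \<and> l2_measurable borel \<Phi>)"

lemma norm_dist_embed_diff: "(norm (dist_embed x - dist_embed y))\<^sup>2 = norm (x - y)"
  and dist_embed_zero: "dist_embed 0 = 0"
  and l2_measurable_dist_embed: "l2_measurable borel dist_embed"
  using someI_ex[OF ex_dist_embedding] unfolding dist_embed_def by auto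

lemma norm_dist_embed: "(norm (dist_embed x))\<^sup>2 = norm x"
  using norm_dist_embed_diff[of x 0] by (simp add: dist_embed_zero)

section \<open>Independent samples\<close>

lemma indep_vars_PiM_coordinates:
  assumes M: "\<And>i. prob_space (M i)"
  shows "prob_space.indep_vars (PiM (UNIV :: 'i set) M) M (\<lambda>i w. w i) UNIV"
proof -
  interpret prob_space "PiM (UNIV :: 'i set) M" by (rule prob_space_PiM[OF M])
  have id: "distr (PiM UNIV M) (PiM UNIV M) (\<lambda>x. \<lambda>i\<in>UNIV. x i) = PiM UNIV M"
    using distr_id[of "PiM UNIV M"] by (simp add: restrict_def id_def)
  have comp: "distr (PiM UNIV M) (M i) (\<lambda>w. w i) = M i" for i
    by (rule distr_PiM_component[OF M]) simp
  show ?thesis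
    by (subst indep_vars_iff_distr_eq_PiM) (auto simp: id comp)
qed

locale iid_sequence = prob_space P for P :: "'s measure"
begin

text \<open>
The canonical sample space: the coordinates \<open>\<omega> 0, \<omega> 1, \<dots>\<close> are independent with law \<open>P\<close>.
\<close>

definition Om :: "(nat \<Rightarrow> 's) measure" where "Om = PiM UNIV (\<lambda>_. P)"

sublocale Om: prob_space Om
  unfolding Om_def by (rule prob_space_PiM) (rule prob_space_axioms)

lemma measurable_coord [measurable]: "(\<lambda>\<omega>. \<omega> k) \<in> measurable Om P"
  unfolding Om_def by measurable

lemma distr_coord: "distr Om P (\<lambda>\<omega>. \<omega> k) = P"
  unfolding Om_def by (rule distr_PiM_component) (auto intro: prob_space_axioms)

lemma integrable_coord:
  fixes f :: "'s \<Rightarrow> 'b::{banach, second_countable_topology}"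
  assumes "integrable P f"
  shows "integrable Om (\<lambda>\<omega>. f (\<omega> k))"
proof (rule integrable_distr[OF measurable_coord])
  show "integrable (distr Om P (\<lambda>\<omega>. \<omega> k)) f" by (simp add: distr_coord assms)
qed

lemma integral_coord:
  fixes f :: "'s \<Rightarrow> 'b::{banach, second_countable_topology}"
  assumes "f \<in> borel_measurable P"
  shows "(\<integral>\<omega>. f (\<omega> k) \<partial>Om) = (\<integral>z. f z \<partial>P)"
  using integral_distr[OF measurable_coord assms, of k] by (simp add: distr_coord)

lemma
  fixes f g :: "'s \<Rightarrow> real"
  assumes "integrable P f" "integrable P g" "k \<noteq> l"
  shows integrable_coord_mult: "integrable Om (\<lambda>\<omega>. f (\<omega> k) * g (\<omega> l))"
    and integral_coord_mult: "(\<integral>\<omega>. f (\<omega> k) * g (\<omega> l) \<partial>Om) = (\<integral>z. f z \<partial>P) * (\<integral>z. g z \<partial>P)"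
  using integrable_PiM_prod[of "\<lambda>_. P" "{k, l}" UNIV "\<lambda>j. if j = k then f else g"]
    integral_PiM_prod[of "\<lambda>_. P" "{k, l}" UNIV "\<lambda>j. if j = k then f else g"] assms prob_space_axioms
  by (auto simp: Om_def)

lemma
  fixes f :: "'s \<Rightarrow> real"
  assumes [measurable]: "f \<in> borel_measurable P" and f2: "integrable P (\<lambda>z. (f z)\<^sup>2)" and f0: "(\<integral>z. f z \<partial>P) = 0"
    and A: "finite A"
  shows integrable_sum_square: "integrable Om (\<lambda>\<omega>. (\<Sum>k\<in>A. f (\<omega> k))\<^sup>2)"
    and integral_sum_square: "(\<integral>\<omega>. (\<Sum>k\<in>A. f (\<omega> k))\<^sup>2 \<partial>Om) = card A * (\<integral>z. (f z)\<^sup>2 \<partial>P)"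
proof -
  have f1: "integrable P f" using f2 by (rule square_integrable_imp_integrable[rotated]) simp
  have eq: "(\<lambda>\<omega>. (\<Sum>k\<in>A. f (\<omega> k))\<^sup>2) = (\<lambda>\<omega>. \<Sum>k\<in>A. \<Sum>l\<in>A. f (\<omega> k) * f (\<omega> l))"
    by (simp add: power2_eq_square sum_product)
  have int: "integrable Om (\<lambda>\<omega>. f (\<omega> k) * f (\<omega> l))" for k l
    using integrable_coord[OF f2, of k] integrable_coord_mult[OF f1 f1, of k l]
    by (cases "k = l") (auto simp: power2_eq_square)
  show "integrable Om (\<lambda>\<omega>. (\<Sum>k\<in>A. f (\<omega> k))\<^sup>2)"
    unfolding eq by (intro Bochner_Integration.integrable_sum int)
  have val: "(\<integral>\<omega>. f (\<omega> k) * f (\<omega> l) \<partial>Om) = (if k = l then \<integral>z. (f z)\<^sup>2 \<partial>P else 0)" for k l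
    using integral_coord[of "\<lambda>z. (f z)\<^sup>2" k] integral_coord_mult[OF f1 f1, of k l] f0
    by (auto simp: power2_eq_square)
  show "(\<integral>\<omega>. (\<Sum>k\<in>A. f (\<omega> k))\<^sup>2 \<partial>Om) = card A * (\<integral>z. (f z)\<^sup>2 \<partial>P)"
    unfolding eq using A by (simp add: Bochner_Integration.integral_sum int val)
qed

lemma integral_abs_le_sqrt:
  fixes f :: "(nat \<Rightarrow> 's) \<Rightarrow> real"
  assumes [measurable]: "f \<in> borel_measurable Om" and f2: "integrable Om (\<lambda>\<omega>. (f \<omega>)\<^sup>2)"
  shows "integrable Om f" "(\<integral>\<omega>. \<bar>f \<omega>\<bar> \<partial>Om) \<le> sqrt (\<integral>\<omega>. (f \<omega>)\<^sup>2 \<partial>Om)"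
proof -
  show I: "integrable Om f" using f2 by (rule Om.square_integrable_imp_integrable[rotated]) simp
  have "0 \<le> Om.variance (\<lambda>\<omega>. \<bar>f \<omega>\<bar>)" by simp
  also have "\<dots> = (\<integral>\<omega>. (f \<omega>)\<^sup>2 \<partial>Om) - (\<integral>\<omega>. \<bar>f \<omega>\<bar> \<partial>Om)\<^sup>2"
    using I f2 by (subst Om.variance_eq) auto
  finally show "(\<integral>\<omega>. \<bar>f \<omega>\<bar> \<partial>Om) \<le> sqrt (\<integral>\<omega>. (f \<omega>)\<^sup>2 \<partial>Om)"
    by (intro real_le_rsqrt) simp
qed

lemma mean_deviation_bounded:
  fixes f :: "'s \<Rightarrow> real"
  assumes [measurable]: "f \<in> borel_measurable P" and bd: "\<And>z. \<bar>f z\<bar> \<le> B" and n: "0 < n"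
  shows "(\<integral>\<omega>. \<bar>(\<Sum>k=1..n. f (\<omega> k)) / real n - (\<integral>z. f z \<partial>P)\<bar> \<partial>Om) \<le> 2 * B / sqrt n"
proof -
  have B: "0 \<le> B" using bd order_trans[OF abs_ge_zero] by blast
  have f1: "integrable P f" by (rule integrable_const_bound[of _ B]) (use bd in auto)
  define m where "m = (\<integral>z. f z \<partial>P)"
  define g where "g z = f z - m" for z
  have [measurable]: "g \<in> borel_measurable P" unfolding g_def by measurable
  have "\<bar>m\<bar> \<le> B"
    unfolding m_def
    using order_trans[OF integral_abs_bound[of P f] integral_mono[OF integrable_abs[OF f1] integrable_const[of B]]] bd
    by (simp add: prob_space)
  then have gb: "\<bar>g z\<bar> \<le> 2 * B" for z using bd[of z] by (simp add: g_def)
  have gsq: "(g z)\<^sup>2 \<le> (2 * B)\<^sup>2" for z using power_mono[OF gb[of z] abs_ge_zero, of 2] by simp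
  have g2: "integrable P (\<lambda>z. (g z)\<^sup>2)"
    by (rule integrable_const_bound[of _ "(2 * B)\<^sup>2"]) (use gsq in auto)
  have g0: "(\<integral>z. g z \<partial>P) = 0" unfolding g_def using f1 by (simp add: m_def prob_space)
  have g2le: "(\<integral>z. (g z)\<^sup>2 \<partial>P) \<le> (2 * B)\<^sup>2"
    using integral_mono[OF g2 integrable_const, of "(2 * B)\<^sup>2"] gsq by (simp add: prob_space)
  have rew: "(\<Sum>k=1..n. f (\<omega> k)) / real n - m = (\<Sum>k=1..n. g (\<omega> k)) / real n" for \<omega>
    using n by (simp add: g_def sum_subtractf diff_divide_distrib)
  have "(\<integral>\<omega>. \<bar>(\<Sum>k=1..n. g (\<omega> k)) / real n\<bar> \<partial>Om) \<le> sqrt (\<integral>\<omega>. ((\<Sum>k=1..n. g (\<omega> k)) / real n)\<^sup>2 \<partial>Om)"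
  proof (rule integral_abs_le_sqrt(2))
    show "(\<lambda>\<omega>. (\<Sum>k=1..n. g (\<omega> k)) / real n) \<in> borel_measurable Om" by measurable
    show "integrable Om (\<lambda>\<omega>. ((\<Sum>k=1..n. g (\<omega> k)) / real n)\<^sup>2)"
      unfolding power_divide by (intro integrable_divide integrable_sum_square g2 g0) auto
  qed
  also have "\<dots> = sqrt ((\<integral>z. (g z)\<^sup>2 \<partial>P) / n)"
    using integral_sum_square[OF _ g2 g0, of "{1..n}"] n by (simp add: power_divide power2_eq_square)
  also have "\<dots> \<le> sqrt ((2 * B)\<^sup>2 / n)" by (intro real_sqrt_le_mono divide_right_mono g2le) simp
  also have "\<dots> = 2 * B / sqrt n" using B by (simp add: real_sqrt_divide real_sqrt_mult)
  finally show ?thesis unfolding rew[symmetric] m_def .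
qed

text \<open>
Truncation: the bounded part of \<open>f\<close> obeys the variance bound above, and the remainder is small in
mean uniformly in \<open>n\<close>.
\<close>

lemma weak_law_L1:
  fixes f :: "'s \<Rightarrow> real"
  assumes f: "integrable P f"
  shows "(\<lambda>n. \<integral>\<omega>. \<bar>(\<Sum>k=1..n. f (\<omega> k)) / real n - (\<integral>z. f z \<partial>P)\<bar> \<partial>Om) \<longlonglongrightarrow> 0"
proof (rule LIMSEQ_I)
  have [measurable]: "f \<in> borel_measurable P" using f by simp
  fix e :: real assume e: "0 < e"
  define h where "h (B::nat) z = (if \<bar>f z\<bar> \<le> real B then f z else 0)" for B z
  have hm [measurable]: "h B \<in> borel_measurable P" for B unfolding h_def by measurable
  have hle: "\<bar>h B z\<bar> \<le> \<bar>f z\<bar>" "\<bar>h B z\<bar> \<le> real B" for B z by (auto simp: h_def)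
  have "(\<lambda>B. \<integral>z. \<bar>f z - h B z\<bar> \<partial>P) \<longlonglongrightarrow> (\<integral>z. 0 \<partial>P)"
  proof (rule integral_dominated_convergence[where w = "\<lambda>z. \<bar>f z\<bar>"])
    show "AE z in P. (\<lambda>B. \<bar>f z - h B z\<bar>) \<longlonglongrightarrow> 0"
    proof (rule AE_I2)
      fix z
      obtain B0 :: nat where "\<bar>f z\<bar> \<le> real B0" using real_arch_simple by blast
      then have "\<forall>\<^sub>F B in sequentially. \<bar>f z - h B z\<bar> = 0"
        by (intro eventually_sequentiallyI[of B0]) (auto simp: h_def)
      then show "(\<lambda>B. \<bar>f z - h B z\<bar>) \<longlonglongrightarrow> 0" by (rule tendsto_eventually)
    qed
  qed (use f in \<open>auto simp: h_def\<close>)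
  then have "eventually (\<lambda>B. (\<integral>z. \<bar>f z - h B z\<bar> \<partial>P) < e / 4) sequentially"
    using e by (intro order_tendstoD) auto
  then obtain B where B: "(\<integral>z. \<bar>f z - h B z\<bar> \<partial>P) < e / 4" by (auto simp: eventually_sequentially)
  define g where "g = h B"
  have gm [measurable]: "g \<in> borel_measurable P" unfolding g_def by (rule hm)
  have gi: "integrable P g" unfolding g_def by (rule Bochner_Integration.integrable_bound[OF f]) (use hle in auto)
  have "(\<lambda>n. 2 * real B / sqrt (real n)) \<longlonglongrightarrow> 0"
    by (intro tendsto_divide_0[OF tendsto_const] filterlim_at_top_imp_at_infinity
        filterlim_compose[OF sqrt_at_top filterlim_real_sequentially])
  then have "eventually (\<lambda>n. 2 * real B / sqrt (real n) < e / 4) sequentially"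
    using e by (intro order_tendstoD) auto
  then obtain n0 where n0: "\<And>n. n \<ge> n0 \<Longrightarrow> 2 * real B / sqrt (real n) < e / 4"
    by (auto simp: eventually_sequentially)
  show "\<exists>no. \<forall>n\<ge>no. norm ((\<integral>\<omega>. \<bar>(\<Sum>k=1..n. f (\<omega> k)) / real n - (\<integral>z. f z \<partial>P)\<bar> \<partial>Om) - 0) < e"
  proof (intro exI[of _ "Suc n0"] allI impI)
    fix n assume n: "Suc n0 \<le> n"
    have fi: "integrable P (\<lambda>z. \<bar>f z - g z\<bar>)" using f gi by auto
    have If: "integrable Om (\<lambda>\<omega>. f (\<omega> k))" "integrable Om (\<lambda>\<omega>. g (\<omega> k))" for k
      by (intro integrable_coord f gi)+
    let ?a = "\<lambda>\<omega>. \<bar>(\<Sum>k=1..n. f (\<omega> k)) / real n - (\<integral>z. f z \<partial>P)\<bar>"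
    let ?b = "\<lambda>\<omega>. \<bar>(\<Sum>k=1..n. g (\<omega> k)) / real n - (\<integral>z. g z \<partial>P)\<bar>"
    let ?c = "\<lambda>\<omega>. (\<Sum>k=1..n. \<bar>f (\<omega> k) - g (\<omega> k)\<bar>) / real n"
    have "?a \<omega> \<le> ?b \<omega> + ?c \<omega> + (\<integral>z. \<bar>f z - g z\<bar> \<partial>P)" for \<omega>
    proof -
      have 1: "\<bar>(\<Sum>k=1..n. f (\<omega> k)) / real n - (\<Sum>k=1..n. g (\<omega> k)) / real n\<bar> \<le> ?c \<omega>"
        unfolding diff_divide_distrib[symmetric] sum_subtractf[symmetric] abs_divide
        by (simp add: divide_right_mono)
      have "(\<integral>z. f z \<partial>P) - (\<integral>z. g z \<partial>P) = (\<integral>z. f z - g z \<partial>P)" using f gi by simp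
      then have 2: "\<bar>(\<integral>z. f z \<partial>P) - (\<integral>z. g z \<partial>P)\<bar> \<le> (\<integral>z. \<bar>f z - g z\<bar> \<partial>P)"
        using integral_abs_bound[of P "\<lambda>z. f z - g z"] by simp
      show ?thesis using 1 2 by linarith
    qed
    note bound = this
    have I: "integrable Om ?a" "integrable Om ?b" "integrable Om ?c"
      by (intro integrable_abs Bochner_Integration.integrable_diff integrable_divide
          Bochner_Integration.integrable_sum If Om.integrable_const)+
    have "(\<integral>\<omega>. ?a \<omega> \<partial>Om) \<le> (\<integral>\<omega>. ?b \<omega> + ?c \<omega> + (\<integral>z. \<bar>f z - g z\<bar> \<partial>P) \<partial>Om)"
      by (rule integral_mono[OF I(1) Bochner_Integration.integrable_add[OF
            Bochner_Integration.integrable_add[OF I(2,3)] Om.integrable_const]]) (rule bound)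
    also have "\<dots> = (\<integral>\<omega>. ?b \<omega> \<partial>Om) + (\<integral>\<omega>. ?c \<omega> \<partial>Om) + (\<integral>z. \<bar>f z - g z\<bar> \<partial>P)"
      using I by (simp add: Om.prob_space)
    also have "(\<integral>\<omega>. ?c \<omega> \<partial>Om) = (\<integral>z. \<bar>f z - g z\<bar> \<partial>P)"
    proof -
      have "(\<integral>\<omega>. \<bar>f (\<omega> k) - g (\<omega> k)\<bar> \<partial>Om) = (\<integral>z. \<bar>f z - g z\<bar> \<partial>P)" for k
        by (rule integral_coord) measurable
      then show ?thesis using n integrable_coord[OF fi] by simp
    qed
    also have "(\<integral>\<omega>. ?b \<omega> \<partial>Om) \<le> 2 * real B / sqrt (real n)"
      by (rule mean_deviation_bounded) (use n hle in \<open>auto simp: g_def\<close>)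
    finally have "(\<integral>\<omega>. ?a \<omega> \<partial>Om) < e"
      using B n0[of n] n e unfolding g_def by linarith
    moreover have "0 \<le> (\<integral>\<omega>. ?a \<omega> \<partial>Om)" by simp
    ultimately show "norm ((\<integral>\<omega>. ?a \<omega> \<partial>Om) - 0) < e" by simp
  qed
qed

lemma iexp_sum_coord:
  assumes [measurable]: "f \<in> borel_measurable P"
  shows "(\<integral>\<omega>. iexp (c * (\<Sum>k\<in>{1..n::nat}. f (\<omega> k))) \<partial>Om) = (\<integral>z. iexp (c * f z) \<partial>P) ^ n"
    "(\<integral>\<omega>. iexp (c * (\<Sum>k<n. f (\<omega> k))) \<partial>Om) = (\<integral>z. iexp (c * f z) \<partial>P) ^ n"
proof -
  have int: "integrable P (\<lambda>z. iexp (c * f z))"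
    by (rule integrable_const_bound[of _ 1]) auto
  have *: "(\<integral>\<omega>. iexp (c * (\<Sum>k\<in>A. f (\<omega> k))) \<partial>Om) = (\<integral>z. iexp (c * f z) \<partial>P) ^ card A"
    if "finite A" for A
  proof -
    have "(\<integral>\<omega>. iexp (c * (\<Sum>k\<in>A. f (\<omega> k))) \<partial>Om) = (\<integral>\<omega>. (\<Prod>k\<in>A. iexp (c * f (\<omega> k))) \<partial>Om)"
      by (simp add: sum_distrib_left exp_sum[OF that])
    then show ?thesis
      using integral_PiM_prod[of "\<lambda>_. P" A UNIV "\<lambda>_ z. iexp (c * f z)"] int that prob_space_axioms
      by (simp add: Om_def)
  qed
  show "(\<integral>\<omega>. iexp (c * (\<Sum>k\<in>{1..n}. f (\<omega> k))) \<partial>Om) = (\<integral>z. iexp (c * f z) \<partial>P) ^ n"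
    "(\<integral>\<omega>. iexp (c * (\<Sum>k<n. f (\<omega> k))) \<partial>Om) = (\<integral>z. iexp (c * f z) \<partial>P) ^ n"
    using *[of "{1..n}"] *[of "{..<n}"] by simp_all
qed

text \<open>
The characteristic function form of the central limit theorem, stated for every variance including
zero because it is applied to arbitrary linear combinations of coordinates.
\<close>

lemma clt_iexp:
  fixes f :: "'s \<Rightarrow> real"
  assumes fm [measurable]: "f \<in> borel_measurable P" and f2: "integrable P (\<lambda>z. (f z)\<^sup>2)" and f0: "(\<integral>z. f z \<partial>P) = 0"
  shows "(\<lambda>n. \<integral>\<omega>. iexp ((\<Sum>k=1..n. f (\<omega> k)) / sqrt n) \<partial>Om) \<longlonglongrightarrow> of_real (exp (- (\<integral>z. (f z)\<^sup>2 \<partial>P) / 2))"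
proof -
  define v where "v = (\<integral>z. (f z)\<^sup>2 \<partial>P)"
  define s where "s = sqrt v"
  have v: "0 \<le> v" by (simp add: v_def)
  have f1: "integrable P f" using f2 by (rule square_integrable_imp_integrable[rotated]) simp
  show ?thesis
  proof (cases "v = 0")
    case True
    then have "AE z in P. (f z)\<^sup>2 = 0"
      using integral_nonneg_eq_0_iff_AE[OF f2] by (simp add: v_def)
    then have "(\<integral>z. iexp (c * f z) \<partial>P) = (\<integral>z. 1 \<partial>P)" for c
      by (intro integral_cong_AE) auto
    from this[of "1 / sqrt n" for n] have "(\<integral>\<omega>. iexp ((\<Sum>k=1..n. f (\<omega> k)) / sqrt n) \<partial>Om) = 1" for n
      using iexp_sum_coord(1)[OF fm, of "1 / sqrt n" n] by (simp add: prob_space)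
    then show ?thesis using True by (simp add: v_def[symmetric])
  next
    case False
    then have s: "0 < s" "s\<^sup>2 = v" using v by (simp_all add: s_def)
    have ind: "Om.indep_vars (\<lambda>_. borel) (\<lambda>i \<omega>. f (\<omega> i)) UNIV"
      using prob_space.indep_vars_compose2[OF _ indep_vars_PiM_coordinates[of "\<lambda>_. P"], of "\<lambda>_. f" "\<lambda>_. borel"]
        prob_space_axioms Om.prob_space_axioms by (simp add: Om_def)
    let ?S = "\<lambda>n \<omega>. (\<Sum>i<n. f (\<omega> i)) / sqrt (real n * s\<^sup>2)"
    have "weak_conv_m (\<lambda>n. distr Om borel (?S n)) std_normal_distribution"
    proof (rule Om.central_limit_theorem_zero_mean[OF ind])
      show "Om.expectation (\<lambda>\<omega>. f (\<omega> n)) = 0" for n using integral_coord[OF fm, of n] f0 by simp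
      then show "Om.variance (\<lambda>\<omega>. f (\<omega> n)) = s\<^sup>2" for n
        using integral_coord[of "\<lambda>z. (f z)\<^sup>2" n] s by (simp add: v_def)
      show "integrable Om (\<lambda>\<omega>. (f (\<omega> n))\<^sup>2)" for n by (rule integrable_coord[OF f2])
      show "distr Om borel (\<lambda>\<omega>. f (\<omega> n)) = distr P borel f" for n
        using distr_distr[OF fm measurable_coord, of n] by (simp add: distr_coord o_def)
    qed (rule s)
    then have "(\<lambda>n. char (distr Om borel (?S n)) s) \<longlonglongrightarrow> char std_normal_distribution s"
      by (intro levy_continuity1) (auto intro!: Om.real_distribution_distr real_dist_normal_dist)
    moreover have "char (distr Om borel (?S n)) s = (\<integral>\<omega>. iexp ((\<Sum>k=1..n. f (\<omega> k)) / sqrt n) \<partial>Om)" for n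
    proof -
      have "char (distr Om borel (?S n)) s = (\<integral>\<omega>. iexp (s * ?S n \<omega>) \<partial>Om)"
        unfolding char_def by (subst integral_distr) simp_all
      also have "(\<lambda>\<omega>. s * ?S n \<omega>) = (\<lambda>\<omega>. 1 / sqrt n * (\<Sum>i<n. f (\<omega> i)))"
        using s(1) by (simp add: real_sqrt_mult fun_eq_iff)
      also have "(\<integral>\<omega>. iexp (1 / sqrt n * (\<Sum>i<n. f (\<omega> i))) \<partial>Om) = (\<integral>\<omega>. iexp (1 / sqrt n * (\<Sum>k=1..n. f (\<omega> k))) \<partial>Om)"
        by (simp only: iexp_sum_coord[OF fm])
      finally show ?thesis by simp
    qed
    ultimately show ?thesis using s by (simp add: char_std_normal_distribution v_def)
  qed
qed

end

section \<open>Spectral decomposition of a weakly continuous form\<close>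

text \<open>
The constraint set is weakly closed in a weakly compact ball, so a maximizing sequence has a weak
limit point at which the weakly continuous functional attains its supremum.
\<close>

lemma ex_weak_maximiser:
  fixes q :: "l2 \<Rightarrow> real"
  assumes cont: "\<And>u v. (\<And>n. norm (u n) \<le> 1) \<Longrightarrow> (\<And>m. (\<lambda>n. coord (u n) m) \<longlonglongrightarrow> coord v m) \<Longrightarrow>
      (\<lambda>n. q (u n)) \<longlonglongrightarrow> q v"
  shows "\<exists>u. norm u \<le> 1 \<and> (\<forall>a\<in>A. u \<bullet> a = 0) \<and>
    (\<forall>w. norm w \<le> 1 \<longrightarrow> (\<forall>a\<in>A. w \<bullet> a = 0) \<longrightarrow> q w \<le> q u)"
proof -
  define C where "C = {u. norm u \<le> 1 \<and> (\<forall>a\<in>A. u \<bullet> a = 0)}"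
  have closed: "v \<in> C" if "\<And>n. u n \<in> C" "norm v \<le> 1" "\<And>m. (\<lambda>n. coord (u n) m) \<longlonglongrightarrow> coord v m" for u v
  proof -
    have "v \<bullet> a = 0" if a: "a \<in> A" for a
    proof -
      have "(\<lambda>n. u n \<bullet> a) \<longlonglongrightarrow> v \<bullet> a"
        using \<open>\<And>n. u n \<in> C\<close> that(1) by (intro inner_l2_tendsto) (auto simp: C_def \<open>\<And>m. (\<lambda>n. coord (u n) m) \<longlonglongrightarrow> coord v m\<close>)
      moreover have "(\<lambda>n. u n \<bullet> a) = (\<lambda>n. 0)" using \<open>\<And>n. u n \<in> C\<close> a by (auto simp: C_def)
      ultimately show ?thesis by (simp add: LIMSEQ_const_iff)
    qed
    then show ?thesis using that(2) by (simp add: C_def)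
  qed
  have C0: "0 \<in> C" by (simp add: C_def)
  have sub: "\<exists>v r. strict_mono r \<and> v \<in> C \<and> (\<lambda>n. q (u (r n))) \<longlonglongrightarrow> q v" if u: "\<And>n. u n \<in> C" for u :: "nat \<Rightarrow> l2"
  proof -
    have "\<And>n. norm (u n) \<le> 1" using u by (simp add: C_def)
    then obtain v r where vr: "strict_mono r" "norm v \<le> 1" "\<And>m. (\<lambda>n. coord (u (r n)) m) \<longlonglongrightarrow> coord v m"
      using weakly_compact_l2_ball[of u] by blast
    then have "v \<in> C" using closed[of "\<lambda>n. u (r n)" v] u by simp
    moreover have "(\<lambda>n. q (u (r n))) \<longlonglongrightarrow> q v"
      using cont[of "\<lambda>n. u (r n)" v] vr u by (simp add: C_def)
    ultimately show ?thesis using vr(1) by blast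
  qed
  have bdd: "bdd_above (q ` C)"
  proof (rule ccontr)
    assume "\<not> bdd_above (q ` C)"
    then have "\<exists>u\<in>C. real n < q u" for n
      by (meson bdd_aboveI2 linorder_not_le)
    then obtain u where u: "\<And>n. u n \<in> C" "\<And>n. real n < q (u n)" by metis
    obtain v r where vr: "strict_mono r" "(\<lambda>n. q (u (r n))) \<longlonglongrightarrow> q v" using sub[of u, OF u(1)] by blast
    have "filterlim (\<lambda>n. q (u (r n))) at_top sequentially"
    proof (rule filterlim_at_top_mono[OF filterlim_real_sequentially always_eventually], rule allI)
      fix n
      have "real n \<le> real (r n)" using seq_suble[OF vr(1), of n] by simp
      then show "real n \<le> q (u (r n))" using u(2)[of "r n"] by linarith
    qed
    then show False using vr(2) not_tendsto_and_filterlim_at_infinity[OF _ vr(2)]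
      by (simp add: filterlim_at_top_imp_at_infinity)
  qed
  have "\<exists>u\<in>C. Sup (q ` C) - 1 / real (Suc n) < q u" for n
    using less_cSupD[of "q ` C" "Sup (q ` C) - 1 / real (Suc n)"] C0 by auto
  then obtain u where u: "\<And>n. u n \<in> C" "\<And>n. Sup (q ` C) - 1 / real (Suc n) < q (u n)" by metis
  obtain v r where vr: "strict_mono r" "v \<in> C" "(\<lambda>n. q (u (r n))) \<longlonglongrightarrow> q v" using sub[of u, OF u(1)] by blast
  have "(\<lambda>n. Sup (q ` C) - 1 / real (Suc (r n))) \<longlonglongrightarrow> Sup (q ` C) - 0"
    using LIMSEQ_subseq_LIMSEQ[OF LIMSEQ_inverse_real_of_nat vr(1)]
    by (intro tendsto_diff tendsto_const) (simp add: o_def inverse_eq_divide)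
  then have "Sup (q ` C) \<le> q v"
    using u(2) by (intro LIMSEQ_le[OF _ vr(3)]) (auto intro: less_imp_le)
  then have "q w \<le> q v" if "w \<in> C" for w
    using cSup_upper[OF imageI[OF that, of q] bdd] by linarith
  then show ?thesis using vr(2) unfolding C_def by blast
qed

text \<open>
A symmetric positive form on \<open>l2\<close> whose quadratic form is weakly sequentially continuous on the unit
ball plays the role of a compact positive operator. Its eigenvectors are found by maximizing it
successively on the orthogonal complement of the vectors already found.
\<close>

locale weakly_continuous_form =
  fixes S :: "l2 \<Rightarrow> l2 \<Rightarrow> real"
  assumes bil: "bilinear S"
    and sym: "S u v = S v u"
    and nonneg: "0 \<le> S u u"
    and weak_cont: "(\<And>n. norm (w n) \<le> 1) \<Longrightarrow> (\<And>m. (\<lambda>n. coord (w n) m) \<longlonglongrightarrow> coord v m) \<Longrightarrow>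
      (\<lambda>n. S (w n) (w n)) \<longlonglongrightarrow> S v v"
begin

lemma S_simps:
  "S (u + v) w = S u w + S v w" "S w (u + v) = S w u + S w v"
  "S (c *\<^sub>R u) w = c * S u w" "S w (c *\<^sub>R u) = c * S w u"
  "S (u - v) w = S u w - S v w" "S w (u - v) = S w u - S w v"
  "S 0 w = 0" "S w 0 = 0"
  using bilinear_ladd[OF bil] bilinear_radd[OF bil] bilinear_lmul[OF bil] bilinear_rmul[OF bil]
    bilinear_lsub[OF bil] bilinear_rsub[OF bil] bilinear_lzero[OF bil] bilinear_rzero[OF bil] by auto

text \<open>
The zero vector is admitted so that a vector can be chosen also when the form vanishes on the
orthogonal complement.
\<close>

definition next_vec :: "l2 set \<Rightarrow> l2 \<Rightarrow> bool" where
  "next_vec A u \<longleftrightarrow> (norm u = 1 \<or> u = 0) \<and> (\<forall>a\<in>A. u \<bullet> a = 0) \<and>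
     (\<forall>w. (\<forall>a\<in>A. w \<bullet> a = 0) \<longrightarrow> S w w \<le> S u u * (norm w)\<^sup>2)"

lemma ex_next_vec: "\<exists>u. next_vec A u"
proof -
  obtain u where u: "norm u \<le> 1" "\<forall>a\<in>A. u \<bullet> a = 0"
    "\<And>w. norm w \<le> 1 \<Longrightarrow> \<forall>a\<in>A. w \<bullet> a = 0 \<Longrightarrow> S w w \<le> S u u"
    using ex_weak_maximiser[of "\<lambda>u. S u u" A] weak_cont by blast
  have hom: "S w w \<le> S u u * (norm w)\<^sup>2" if "\<forall>a\<in>A. w \<bullet> a = 0" for w
  proof (cases "w = 0")
    case False
    have "S (w /\<^sub>R norm w) (w /\<^sub>R norm w) \<le> S u u"
      using that False by (intro u(3)) auto
    then show ?thesis using False by (simp add: S_simps field_simps power2_eq_square)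
  qed (simp add: S_simps)
  show ?thesis
  proof (cases "S u u = 0")
    case True
    then show ?thesis using hom u(2) by (intro exI[of _ 0]) (auto simp: next_vec_def S_simps)
  next
    case False
    then have "0 < S u u" using nonneg[of u] by simp
    moreover have "S u u \<le> S u u * (norm u)\<^sup>2" using hom u(2) by blast
    ultimately have "1 \<le> (norm u)\<^sup>2" by simp
    then have "norm u = 1" using u(1) power_le_one[OF norm_ge_zero u(1), of 2]
      by (metis norm_ge_zero order_antisym one_power2 power2_eq_iff_nonneg zero_le_one)
    then show ?thesis using hom u(2) by (auto simp: next_vec_def)
  qed
qed

primrec eig_set :: "nat \<Rightarrow> l2 set" where
  "eig_set 0 = {}"
| "eig_set (Suc j) = insert (SOME u. next_vec (eig_set j) u) (eig_set j)"

definition eigvec :: "nat \<Rightarrow> l2" where "eigvec j = (SOME u. next_vec (eig_set j) u)"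

definition eigval :: "nat \<Rightarrow> real" where "eigval j = S (eigvec j) (eigvec j)"

lemma next_eigvec: "next_vec (eig_set j) (eigvec j)"
  unfolding eigvec_def by (rule someI_ex[OF ex_next_vec])

lemma eig_set_eq: "eig_set j = eigvec ` {..<j}"
  by (induction j) (auto simp: eigvec_def lessThan_Suc)

lemma eigval_nonneg: "0 \<le> eigval j"
  by (simp add: eigval_def nonneg)

lemma norm_eigvec: "norm (eigvec j) = 1 \<or> eigvec j = 0"
  using next_eigvec by (simp add: next_vec_def)

lemma eigvec_orthogonal: "i \<noteq> j \<Longrightarrow> eigvec i \<bullet> eigvec j = 0"
proof (induction i j rule: linorder_wlog)
  case (le i j)
  then show ?case using next_eigvec[of j] by (auto simp: next_vec_def eig_set_eq inner_commute)
next
  case (sym i j)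
  then show ?case by (simp add: inner_commute)
qed

lemma eigval_max:
  assumes "\<And>i. i < j \<Longrightarrow> w \<bullet> eigvec i = 0" shows "S w w \<le> eigval j * (norm w)\<^sup>2"
  using next_eigvec[of j] assms by (auto simp: next_vec_def eig_set_eq eigval_def)

text \<open>
The first-order condition at the maximizer: a nonzero value of \<open>S (eigvec j) w\<close> would let a small
multiple of \<open>w\<close> increase the Rayleigh quotient.
\<close>

lemma S_eigvec_zero:
  assumes w: "\<And>i. i \<le> j \<Longrightarrow> w \<bullet> eigvec i = 0" shows "S (eigvec j) w = 0"
proof (cases "eigvec j = 0")
  case False
  then have n1: "norm (eigvec j) = 1" using norm_eigvec by blast
  let ?v = "eigvec j"
  define a where "a = eigval j * (norm w)\<^sup>2 - S w w"
  have a: "0 \<le> a" using eigval_max[of j w] w by (simp add: a_def)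
  have key: "2 * t * S ?v w \<le> t\<^sup>2 * a" for t
  proof -
    have "S (?v + t *\<^sub>R w) (?v + t *\<^sub>R w) \<le> eigval j * (norm (?v + t *\<^sub>R w))\<^sup>2"
      using w eigvec_orthogonal[of j] by (intro eigval_max) (auto simp: inner_add_left)
    moreover have "(norm (?v + t *\<^sub>R w))\<^sup>2 = 1 + t\<^sup>2 * (norm w)\<^sup>2"
      using w[of j] n1 unfolding power2_norm_eq_inner norm_eq_1
      by (simp add: inner_add_left inner_add_right inner_commute power2_eq_square)
    ultimately show ?thesis using sym[of w ?v]
      by (simp add: S_simps a_def eigval_def algebra_simps power2_eq_square)
  qed
  show ?thesis
  proof (rule ccontr)
    assume nz: "S ?v w \<noteq> 0"
    \<comment> \<open>the denominator is positive also when \<open>a = 0\<close>, and \<open>a + 1\<close> still dominates \<open>a\<close> in \<open>key\<close>\<close>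
    define t where "t = S ?v w / (a + 1)"
    have "2 * t * S ?v w \<le> t\<^sup>2 * (a + 1)" using key[of t] zero_le_power2[of t] unfolding distrib_left by linarith
    moreover have "t * (a + 1) = S ?v w" using a by (simp add: t_def)
    then have "t\<^sup>2 * (a + 1) = t * S ?v w" by (simp add: power2_eq_square mult.assoc)
    moreover have "0 < t * S ?v w" using a nz
      by (auto simp: t_def zero_less_mult_iff linorder_neq_iff intro!: divide_pos_pos)
    ultimately show False by linarith
  qed
qed (simp add: S_simps)

lemma S_eigvec: "i \<noteq> j \<Longrightarrow> S (eigvec i) (eigvec j) = 0"
proof (induction i j rule: linorder_wlog)
  case (le i j)
  then show ?case by (intro S_eigvec_zero eigvec_orthogonal) auto
next
  case (sym i j)
  then show ?case using weakly_continuous_form.sym[OF weakly_continuous_form_axioms] by simp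
qed

definition eig_rest :: "nat \<Rightarrow> l2 \<Rightarrow> l2" where
  "eig_rest J u = u - (\<Sum>j<J. (u \<bullet> eigvec j) *\<^sub>R eigvec j)"

lemma eig_rest_orthogonal: "j < J \<Longrightarrow> eig_rest J u \<bullet> eigvec j = 0"
proof -
  assume j: "j < J"
  have "(\<Sum>i<J. (u \<bullet> eigvec i) * (eigvec i \<bullet> eigvec j)) = (\<Sum>i<J. if i = j then (u \<bullet> eigvec j) * (eigvec j \<bullet> eigvec j) else 0)"
    by (intro sum.cong refl) (auto simp: eigvec_orthogonal)
  also have "\<dots> = u \<bullet> eigvec j"
    using j norm_eigvec[of j] by (auto simp: norm_eq_1)
  finally show ?thesis by (simp add: eig_rest_def inner_diff_left inner_sum_left)
qed

lemma bessel: "(norm u)\<^sup>2 = (norm (eig_rest J u))\<^sup>2 + (\<Sum>j<J. (u \<bullet> eigvec j)\<^sup>2)"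
proof (induction J)
  case (Suc J)
  let ?r = "eig_rest J u" and ?v = "eigvec J"
  have e: "eig_rest (Suc J) u = ?r - (u \<bullet> ?v) *\<^sub>R ?v" by (simp add: eig_rest_def)
  have "?r \<bullet> ?v = u \<bullet> ?v"
    by (simp add: eig_rest_def inner_diff_left inner_sum_left eigvec_orthogonal)
  then have "(norm (eig_rest (Suc J) u))\<^sup>2 = (norm ?r)\<^sup>2 - (u \<bullet> ?v)\<^sup>2"
    using norm_eigvec[of J] unfolding e power2_norm_eq_inner norm_eq_1
    by (auto simp: inner_diff_left inner_diff_right inner_commute power2_eq_square)
  then show ?case using Suc by simp
qed (simp add: eig_rest_def)

lemma S_decomp: "S u u = S (eig_rest J u) (eig_rest J u) + (\<Sum>j<J. eigval j * (u \<bullet> eigvec j)\<^sup>2)"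
proof (induction J)
  case (Suc J)
  let ?r = "eig_rest J u" and ?v = "eigvec J" and ?q = "eig_rest (Suc J) u"
  have e: "?r = ?q + (u \<bullet> ?v) *\<^sub>R ?v" by (simp add: eig_rest_def)
  have "S ?v ?q = 0" by (rule S_eigvec_zero) (simp add: eig_rest_orthogonal)
  then have "S ?r ?r = S ?q ?q + eigval J * (u \<bullet> ?v)\<^sup>2"
    unfolding e using sym[of ?q ?v] by (simp add: S_simps eigval_def power2_eq_square)
  then show ?case using Suc by simp
qed (simp add: eig_rest_def)

context
  assumes trace: "summable (\<lambda>m. S (axis_l2 m) (axis_l2 m))"
begin

lemma sum_eigval_le: "(\<Sum>j<J. eigval j) \<le> (\<Sum>m. S (axis_l2 m) (axis_l2 m))"
proof -
  have sq: "eigval j * (norm (eigvec j))\<^sup>2 = eigval j" for j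
    using norm_eigvec[of j] by (auto simp: eigval_def S_simps)
  have "(\<lambda>m. \<Sum>j<J. eigval j * (coord (eigvec j) m)\<^sup>2) sums (\<Sum>j<J. eigval j * (norm (eigvec j))\<^sup>2)"
    by (intro sums_sum sums_mult norm_l2_sums)
  then have s: "(\<lambda>m. \<Sum>j<J. eigval j * (coord (eigvec j) m)\<^sup>2) sums (\<Sum>j<J. eigval j)" by (simp add: sq)
  show ?thesis
    using S_decomp[of "axis_l2 m" J for m] nonneg
    by (intro sums_le[OF _ s summable_sums[OF trace]]) (simp add: inner_axis_l2)
qed

lemma eigval_summable: "summable eigval"
  by (rule summableI_nonneg_bounded[OF eigval_nonneg sum_eigval_le])

text \<open>
What is left of the form after \<open>J\<close> steps is at most \<open>eigval J\<close> on unit vectors, and the eigenvalues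
tend to zero because their sum is bounded by the trace.
\<close>

lemma diag_sums: "(\<lambda>j. eigval j * (coord (eigvec j) m)\<^sup>2) sums S (axis_l2 m) (axis_l2 m)"
proof -
  let ?r = "\<lambda>J. S (eig_rest J (axis_l2 m)) (eig_rest J (axis_l2 m))"
  have up: "?r J \<le> eigval J" for J
  proof -
    have "?r J \<le> eigval J * (norm (eig_rest J (axis_l2 m)))\<^sup>2"
      by (rule eigval_max) (rule eig_rest_orthogonal)
    also have "\<dots> \<le> eigval J * 1"
      using bessel[of "axis_l2 m" J] sum_nonneg[of "{..<J}" "\<lambda>j. (axis_l2 m \<bullet> eigvec j)\<^sup>2"]
      by (intro mult_left_mono eigval_nonneg) simp
    finally show ?thesis by simp
  qed
  have "?r \<longlonglongrightarrow> 0"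
    by (rule Lim_null_comparison[OF always_eventually summable_LIMSEQ_zero[OF eigval_summable]]) (use up nonneg in simp)
  then have "(\<lambda>J. S (axis_l2 m) (axis_l2 m) - ?r J) \<longlonglongrightarrow> S (axis_l2 m) (axis_l2 m) - 0"
    by (intro tendsto_intros)
  moreover have "(\<Sum>j<J. eigval j * (coord (eigvec j) m)\<^sup>2) = S (axis_l2 m) (axis_l2 m) - ?r J" for J
    using S_decomp[of "axis_l2 m" J] by (simp add: inner_axis_l2)
  ultimately show ?thesis by (simp add: sums_def)
qed

text \<open>
Summing the expansion of the diagonal entries over \<open>m\<close> and interchanging the two nonnegative sums
gives each eigenvalue the factor \<open>\<bar>eigvec j\<bar>\<^sup>2\<close>, which is \<open>1\<close> unless the eigenvalue is zero.
\<close>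

lemma eigval_sums_trace: "eigval sums (\<Sum>m. S (axis_l2 m) (axis_l2 m))"
proof -
  have sq: "eigval j * (norm (eigvec j))\<^sup>2 = eigval j" for j
    using norm_eigvec[of j] by (auto simp: eigval_def S_simps)
  have "(\<Sum>m. S (axis_l2 m) (axis_l2 m)) \<le> (\<Sum>j. eigval j)"
  proof (rule suminf_le_const[OF trace])
    fix N
    have fin: "(\<lambda>j. \<Sum>m<N. eigval j * (coord (eigvec j) m)\<^sup>2) sums (\<Sum>m<N. S (axis_l2 m) (axis_l2 m))"
      by (intro sums_sum diag_sums)
    show "(\<Sum>m<N. S (axis_l2 m) (axis_l2 m)) \<le> (\<Sum>j. eigval j)"
    proof (rule sums_le[OF _ fin summable_sums[OF eigval_summable]])
      fix j
      have "(\<Sum>m<N. eigval j * (coord (eigvec j) m)\<^sup>2) \<le> eigval j * (norm (eigvec j))\<^sup>2"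
        unfolding sum_distrib_left[symmetric] by (intro mult_left_mono sum_coord_sq_le eigval_nonneg)
      then show "(\<Sum>m<N. eigval j * (coord (eigvec j) m)\<^sup>2) \<le> eigval j" by (simp add: sq)
    qed
  qed
  moreover have "(\<Sum>j. eigval j) \<le> (\<Sum>m. S (axis_l2 m) (axis_l2 m))"
    by (rule suminf_le_const[OF eigval_summable sum_eigval_le])
  ultimately have "(\<Sum>j. eigval j) = (\<Sum>m. S (axis_l2 m) (axis_l2 m))" by (rule order_antisym[rotated])
  then show ?thesis using summable_sums[OF eigval_summable] by simp
qed

end

end

section \<open>Weak convergence from Laplace transforms\<close>

text \<open>
The Laplace transforms at natural numbers are the moments of \<open>exp (- R)\<close>, a variable with values in
\<open>[0,1]\<close>. A step function with a linear ramp is a continuous function of \<open>exp (- R)\<close>, extended by \<open>0\<close> at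
the point \<open>0\<close>, and the Weierstrass theorem approximates it uniformly by polynomials. Such step
functions characterize weak convergence.
\<close>

lemma weak_conv_of_laplace:
  assumes M: "\<And>n. prob_space (M n)" and N: "prob_space N"
    and Rm: "\<And>n. R n \<in> borel_measurable (M n)" and Qm: "Q \<in> borel_measurable N"
    and R0: "\<And>n. AE x in M n. 0 \<le> R n x" and Q0: "AE x in N. 0 \<le> Q x"
    and lap: "\<And>s::nat. (\<lambda>n. \<integral>x. exp (- (real s * R n x)) \<partial>M n) \<longlonglongrightarrow> (\<integral>x. exp (- (real s * Q x)) \<partial>N)"
  shows "weak_conv_m (\<lambda>n. distr (M n) borel (R n)) (distr N borel Q)"
proof (rule integral_cts_step_conv_imp_weak_conv)
  show "real_distribution (distr (M n) borel (R n))" for n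
    using prob_space.real_distribution_distr[OF M Rm] .
  show "real_distribution (distr N borel Q)"
    using prob_space.real_distribution_distr[OF N Qm] .
  fix a b :: real assume ab: "a < b"
  have cm [measurable]: "cts_step a b \<in> borel_measurable borel"
    using uniformly_continuous_imp_continuous[OF cts_step_uniformly_continuous[OF ab]]
    by (rule borel_measurable_continuous_onI)
  define g where "g u = (if u \<le> 0 then 0 else cts_step a b (- ln u))" for u :: real
  have g_exp: "g (exp (- r)) = cts_step a b r" for r by (simp add: g_def)
  have "continuous_on {0..1} g"
    unfolding continuous_on_eq_continuous_within
  proof
    fix u :: real assume "u \<in> {0..1}"
    show "continuous (at u within {0..1}) g"
    proof (cases "u = 0")
      case False
      then have u: "0 < u" using \<open>u \<in> {0..1}\<close> by simp
      have "continuous_on UNIV (cts_step a b)"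
        by (rule uniformly_continuous_imp_continuous[OF cts_step_uniformly_continuous[OF ab]])
      then have cc: "isCont (cts_step a b) x" for x by (simp add: continuous_on_eq_continuous_at)
      have "isCont (\<lambda>u. cts_step a b (- ln u)) u"
        by (rule isCont_o2[OF _ cc]) (use u in \<open>auto intro!: continuous_intros\<close>)
      moreover have "\<forall>\<^sub>F x in nhds u. g x = cts_step a b (- ln x)"
        using eventually_nhds_in_open[of "{0<..}" u] u by (auto simp: g_def elim!: eventually_mono)
      ultimately have "isCont g u" by (simp add: isCont_cong)
      then show ?thesis by (rule continuous_at_imp_continuous_at_within)
    next
      case True
      have "g x = 0" if "x < exp (- b)" for x
        using that ab by (auto simp: g_def cts_step_def) (smt (verit) exp_less_mono exp_ln)+
      then have "\<forall>\<^sub>F x in nhds 0. g x = 0"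
        using eventually_nhds_in_open[of "{..<exp (- b)}" 0] by (auto elim!: eventually_mono)
      then have "isCont g 0" by (simp add: isCont_cong[where g = "\<lambda>_. 0"])
      then show ?thesis using True continuous_at_imp_continuous_at_within by blast
    qed
  qed
  note cont = this
  show "(\<lambda>n. integral\<^sup>L (distr (M n) borel (R n)) (cts_step a b)) \<longlonglongrightarrow> integral\<^sup>L (distr N borel Q) (cts_step a b)"
  proof (rule LIMSEQ_I)
    fix e :: real assume e: "0 < e"
    obtain p :: "real \<Rightarrow> real" where p: "real_polynomial_function p" "\<And>u. u \<in> {0..1} \<Longrightarrow> \<bar>g u - p u\<bar> < e / 3"
      using Stone_Weierstrass_real_polynomial_function[OF compact_Icc cont, of "e / 3"] e by auto
    obtain c d where pc: "p = (\<lambda>x. \<Sum>i\<le>(d::nat). c i * x ^ i)"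
      using p(1) unfolding real_polynomial_function_iff_sum by blast
    have approx: "\<bar>(\<integral>x. cts_step a b (T x) \<partial>L) - (\<Sum>i\<le>d. c i * (\<integral>x. exp (- (real i * T x)) \<partial>L))\<bar> \<le> e / 3"
      if L: "prob_space L" and [measurable]: "T \<in> borel_measurable L" and T0: "AE x in L. 0 \<le> T x" for L :: "'z measure" and T
    proof -
      interpret L: prob_space L by (rule L)
      have I1: "integrable L (\<lambda>x. cts_step a b (T x))"
        by (rule L.integrable_const_bound[of _ 1]) (auto simp: cts_step_def)
      have I2: "integrable L (\<lambda>x. exp (- (real i * T x)))" for i
        by (rule L.integrable_const_bound[of _ 1]) (use T0 in \<open>auto elim!: eventually_mono\<close>)
      have I3: "integrable L (\<lambda>x. \<Sum>i\<le>d. c i * exp (- (real i * T x)))"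
        by (intro Bochner_Integration.integrable_sum integrable_mult_right I2)
      have "(\<Sum>i\<le>d. c i * (\<integral>x. exp (- (real i * T x)) \<partial>L)) = (\<integral>x. (\<Sum>i\<le>d. c i * exp (- (real i * T x))) \<partial>L)"
        using I2 by (simp add: Bochner_Integration.integral_sum)
      then have "\<bar>(\<integral>x. cts_step a b (T x) \<partial>L) - (\<Sum>i\<le>d. c i * (\<integral>x. exp (- (real i * T x)) \<partial>L))\<bar>
        = \<bar>\<integral>x. cts_step a b (T x) - (\<Sum>i\<le>d. c i * exp (- (real i * T x))) \<partial>L\<bar>"
        using I1 I3 by simp
      also have "\<dots> \<le> (\<integral>x. \<bar>cts_step a b (T x) - (\<Sum>i\<le>d. c i * exp (- (real i * T x)))\<bar> \<partial>L)"
        by (rule integral_abs_bound)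
      also have "\<dots> \<le> (\<integral>x. e / 3 \<partial>L)"
      proof (rule integral_mono_AE)
        show "AE x in L. \<bar>cts_step a b (T x) - (\<Sum>i\<le>d. c i * exp (- (real i * T x)))\<bar> \<le> e / 3"
          using T0
        proof eventually_elim
          case (elim x)
          have "(\<Sum>i\<le>d. c i * exp (- (real i * T x))) = p (exp (- T x))"
            by (simp add: pc exp_of_nat_mult[symmetric])
          then show ?case using p(2)[of "exp (- T x)"] elim by (simp add: g_exp)
        qed
      qed (use I1 I3 in auto)
      finally show ?thesis by (simp add: L.prob_space)
    qed
    have "(\<lambda>n. \<Sum>i\<le>d. c i * (\<integral>x. exp (- (real i * R n x)) \<partial>M n)) \<longlonglongrightarrow> (\<Sum>i\<le>d. c i * (\<integral>x. exp (- (real i * Q x)) \<partial>N))"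
      by (intro tendsto_intros lap)
    from LIMSEQ_D[OF this, of "e / 3"] obtain n0 where n0: "\<And>n. n \<ge> n0 \<Longrightarrow>
      \<bar>(\<Sum>i\<le>d. c i * (\<integral>x. exp (- (real i * R n x)) \<partial>M n)) - (\<Sum>i\<le>d. c i * (\<integral>x. exp (- (real i * Q x)) \<partial>N))\<bar> < e / 3"
      using e by auto
    have "norm (integral\<^sup>L (distr (M n) borel (R n)) (cts_step a b) - integral\<^sup>L (distr N borel Q) (cts_step a b)) < e"
      if "n \<ge> n0" for n
      unfolding integral_distr[OF Rm cm] integral_distr[OF Qm cm] real_norm_def
      using approx[OF M Rm R0, of n] approx[OF N Qm Q0] n0[OF that] by linarith
    then show "\<exists>no. \<forall>n\<ge>no. norm (integral\<^sup>L (distr (M n) borel (R n)) (cts_step a b) - integral\<^sup>L (distr N borel Q) (cts_step a b)) < e"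
      by blast
  qed
qed

section \<open>The central limit theorem for squared norms\<close>

lemma exp_neg_lipschitz:
  fixes x y :: real
  assumes "0 \<le> x" "0 \<le> y" shows "\<bar>exp (- x) - exp (- y)\<bar> \<le> \<bar>x - y\<bar>"
proof -
  have *: "exp (- a) - exp (- b) \<le> b - a" if "0 \<le> a" "a \<le> b" for a b :: real
  proof -
    have "exp (- a) - exp (- b) = exp (- a) * (1 - exp (a - b))"
      by (simp add: right_diff_distrib flip: exp_add)
    also have "\<dots> \<le> 1 * (1 - exp (a - b))"
      using that by (intro mult_right_mono) auto
    also have "\<dots> \<le> b - a" using exp_ge_add_one_self[of "a - b"] unfolding mult_1 by linarith
    finally show ?thesis .
  qed
  show ?thesis using *[of x y] *[of y x] assms by (cases "x \<le> y") auto
qed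

lemma norm_sq_sums_integral:
  assumes T: "l2_measurable M T" and I: "integrable M (\<lambda>z. (norm (T z))\<^sup>2)"
  shows "(\<lambda>m. \<integral>z. (coord (T z) m)\<^sup>2 \<partial>M) sums (\<integral>z. (norm (T z))\<^sup>2 \<partial>M)"
    and "integrable M (\<lambda>z. (coord (T z) m)\<^sup>2)"
proof -
  have m [measurable]: "(\<lambda>z. coord (T z) m) \<in> borel_measurable M" for m
    using T by (simp add: l2_measurable_def)
  show Im: "integrable M (\<lambda>z. (coord (T z) m)\<^sup>2)" for m
    by (rule Bochner_Integration.integrable_bound[OF I])
       (auto simp: power2_le_iff_abs_le coord_le_norm)
  have "(\<lambda>N. \<integral>z. (\<Sum>m<N. (coord (T z) m)\<^sup>2) \<partial>M) \<longlonglongrightarrow> (\<integral>z. (norm (T z))\<^sup>2 \<partial>M)"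
  proof (rule integral_dominated_convergence[where w = "\<lambda>z. (norm (T z))\<^sup>2"])
    show "AE z in M. (\<lambda>N. \<Sum>m<N. (coord (T z) m)\<^sup>2) \<longlonglongrightarrow> (norm (T z))\<^sup>2"
      using norm_l2_sums by (auto simp: sums_def)
    show "AE z in M. norm (\<Sum>m<N. (coord (T z) m)\<^sup>2) \<le> (norm (T z))\<^sup>2" for N
      using sum_coord_sq_le by (auto simp: sum_nonneg)
    show "(\<lambda>z. (norm (T z))\<^sup>2) \<in> borel_measurable M" using I by simp
  qed (use I in auto)
  then show "(\<lambda>m. \<integral>z. (coord (T z) m)\<^sup>2 \<partial>M) sums (\<integral>z. (norm (T z))\<^sup>2 \<partial>M)"
    by (simp add: sums_def Bochner_Integration.integral_sum Im)
qed

lemma std_normal_second_moment: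
  "integrable std_normal_distribution (\<lambda>z. z\<^sup>2)" "(\<integral>z. z\<^sup>2 \<partial>std_normal_distribution) = 1"
  by (subst integrable_density integral_density;
      use std_normal_moment_even[of 1] in \<open>auto simp: has_bochner_integral_iff mult.commute\<close>)+

lemma std_normals_coord_sq:
  "integrable (std_normals UNIV) (\<lambda>w. (w j)\<^sup>2)" "(\<integral>w. (w j)\<^sup>2 \<partial>std_normals UNIV) = 1"
proof -
  have N: "prob_space std_normal_distribution" by (rule prob_space_normal_density) simp
  show "integrable (std_normals UNIV) (\<lambda>w. (w j)\<^sup>2)" "(\<integral>w. (w j)\<^sup>2 \<partial>std_normals UNIV) = 1"
    using integrable_PiM_prod[of "\<lambda>_. std_normal_distribution" "{j}" UNIV "\<lambda>_ z. z\<^sup>2"]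
      integral_PiM_prod[of "\<lambda>_. std_normal_distribution" "{j}" UNIV "\<lambda>_ z. z\<^sup>2"] N std_normal_second_moment
    by simp_all
qed

lemma measurable_std_normals_coord [measurable]:
  "(\<lambda>w. w j) \<in> borel_measurable (std_normals UNIV)"
  by measurable

text \<open>
The expectations of the nonnegative terms have a finite sum, which forces convergence of the series
almost surely and allows integration term by term.
\<close>

lemma chi_square_mixture:
  fixes lam :: "nat \<Rightarrow> real"
  assumes nonneg: "\<And>j. 0 \<le> lam j" and lam: "summable lam"
  shows "AE w in std_normals UNIV. summable (\<lambda>j. lam j * (w j)\<^sup>2)"
    and "integrable (std_normals UNIV) (\<lambda>w. \<Sum>j. lam j * (w j)\<^sup>2)"
    and "(\<integral>w. (\<Sum>j. lam j * (w j)\<^sup>2) \<partial>std_normals UNIV) = (\<Sum>j. lam j)"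
proof -
  let ?W = "std_normals (UNIV :: nat set)"
  have int: "integrable ?W (\<lambda>w. lam j * (w j)\<^sup>2)" for j
    by (intro integrable_mult_right std_normals_coord_sq)
  have "(\<integral>\<^sup>+w. ennreal (lam j * (w j)\<^sup>2) \<partial>?W) = ennreal (lam j)" for j
    using nonneg[of j] by (subst nn_integral_eq_integral[OF int]) (auto simp: std_normals_coord_sq)
  then have "(\<integral>\<^sup>+w. (\<Sum>j. ennreal (lam j * (w j)\<^sup>2)) \<partial>?W) = (\<Sum>j. ennreal (lam j))"
    by (subst nn_integral_suminf) auto
  also have "\<dots> = ennreal (suminf lam)" using nonneg lam by (intro suminf_ennreal_eq summable_sums)
  finally have "(\<integral>\<^sup>+w. (\<Sum>j. ennreal (lam j * (w j)\<^sup>2)) \<partial>?W) \<noteq> \<infinity>" by simp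
  then have "AE w in ?W. (\<Sum>j. ennreal (lam j * (w j)\<^sup>2)) \<noteq> \<infinity>"
    by (intro nn_integral_PInf_AE) auto
  then show ae: "AE w in ?W. summable (\<lambda>j. lam j * (w j)\<^sup>2)"
    by eventually_elim (use nonneg in \<open>auto intro!: summable_suminf_not_top\<close>)
  have val: "(\<integral>w. norm (lam j * (w j)\<^sup>2) \<partial>?W) = lam j" for j
    using nonneg by (simp add: std_normals_coord_sq)
  have ae': "AE w in ?W. summable (\<lambda>j. norm (lam j * (w j)\<^sup>2))"
    using ae by eventually_elim (use nonneg in simp)
  have s: "summable (\<lambda>j. \<integral>w. norm (lam j * (w j)\<^sup>2) \<partial>?W)" unfolding val by (rule lam)
  show "integrable ?W (\<lambda>w. \<Sum>j. lam j * (w j)\<^sup>2)" by (rule integrable_suminf[OF int ae' s])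
  show "(\<integral>w. (\<Sum>j. lam j * (w j)\<^sup>2) \<partial>?W) = (\<Sum>j. lam j)"
    using integral_suminf[OF int ae' s] by (simp add: std_normals_coord_sq)
qed

lemma (in prob_space) integrable_laplace:
  fixes s :: real
  assumes [measurable]: "R \<in> borel_measurable M" and "AE x in M. 0 \<le> R x" "0 \<le> s"
  shows "integrable M (\<lambda>x. exp (- (s * R x)))"
  by (rule integrable_const_bound[of _ 1]) (use assms(2,3) in \<open>auto elim!: eventually_mono\<close>)

lemma (in prob_space) abs_diff_laplace_le:
  fixes R R' :: "'a \<Rightarrow> real" and s :: real
  assumes [measurable]: "R \<in> borel_measurable M" "R' \<in> borel_measurable M"
    and R: "AE x in M. 0 \<le> R' x \<and> R' x \<le> R x" and int: "integrable M R" "integrable M R'" and s: "0 \<le> s"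
  shows "\<bar>(\<integral>x. exp (- (s * R x)) \<partial>M) - (\<integral>x. exp (- (s * R' x)) \<partial>M)\<bar> \<le> s * ((\<integral>x. R x \<partial>M) - (\<integral>x. R' x \<partial>M))"
proof -
  have ae: "AE x in M. 0 \<le> R x" by (rule eventually_mono[OF R]) auto
  have ae': "AE x in M. 0 \<le> R' x" by (rule eventually_mono[OF R]) simp
  have I: "integrable M (\<lambda>x. exp (- (s * R x)))" "integrable M (\<lambda>x. exp (- (s * R' x)))"
    by (intro integrable_laplace ae ae' s assms(1,2))+
  have "\<bar>(\<integral>x. exp (- (s * R x)) \<partial>M) - (\<integral>x. exp (- (s * R' x)) \<partial>M)\<bar> =
    \<bar>\<integral>x. exp (- (s * R x)) - exp (- (s * R' x)) \<partial>M\<bar>" using I by simp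
  also have "\<dots> \<le> (\<integral>x. \<bar>exp (- (s * R x)) - exp (- (s * R' x))\<bar> \<partial>M)" by (rule integral_abs_bound)
  also have "\<dots> \<le> (\<integral>x. s * (R x - R' x) \<partial>M)"
  proof (rule integral_mono_AE)
    show "AE x in M. \<bar>exp (- (s * R x)) - exp (- (s * R' x))\<bar> \<le> s * (R x - R' x)"
      using R
    proof eventually_elim
      case (elim x)
      have "\<bar>exp (- (s * R x)) - exp (- (s * R' x))\<bar> \<le> \<bar>s * R x - s * R' x\<bar>"
        using elim s by (intro exp_neg_lipschitz) auto
      also have "\<dots> = s * (R x - R' x)" using elim s by (simp add: right_diff_distrib[symmetric] abs_mult)
      finally show ?case .
    qed
  qed (use I int in auto)
  also have "\<dots> = s * ((\<integral>x. R x \<partial>M) - (\<integral>x. R' x \<partial>M))" using int by simp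
  finally show ?thesis .
qed

text \<open>
A centered random element \<open>H\<close> of \<open>l2\<close> with finite second moment, where centering is expressed by
coordinates.
\<close>

locale centered_l2 = iid_sequence P for P :: "'s measure" +
  fixes H :: "'s \<Rightarrow> l2"
  assumes meas_H: "l2_measurable P H"
    and int_H: "integrable P (\<lambda>z. (norm (H z))\<^sup>2)"
    and mean_H: "(\<integral>z. coord (H z) m \<partial>P) = 0"
begin

lemma meas_inner [measurable]: "(\<lambda>z. u \<bullet> H z) \<in> borel_measurable P"
  by (intro l2_measurable_inner meas_H l2_measurable_const)

lemma int_inner_mult: "integrable P (\<lambda>z. (u \<bullet> H z) * (w \<bullet> H z))"
proof (rule Bochner_Integration.integrable_bound)
  show "integrable P (\<lambda>z. norm u * norm w * (norm (H z))\<^sup>2)" by (intro integrable_mult_right int_H)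
  show "AE z in P. norm ((u \<bullet> H z) * (w \<bullet> H z)) \<le> norm (norm u * norm w * (norm (H z))\<^sup>2)"
  proof (rule AE_I2)
    fix z
    have "\<bar>u \<bullet> H z\<bar> * \<bar>w \<bullet> H z\<bar> \<le> (norm u * norm (H z)) * (norm w * norm (H z))"
      by (intro mult_mono Cauchy_Schwarz_ineq2) auto
    then show "norm ((u \<bullet> H z) * (w \<bullet> H z)) \<le> norm (norm u * norm w * (norm (H z))\<^sup>2)"
      by (simp add: abs_mult power2_eq_square mult_ac)
  qed
qed measurable

lemma int_inner_sq: "integrable P (\<lambda>z. (u \<bullet> H z)\<^sup>2)"
  using int_inner_mult[of u u] by (simp add: power2_eq_square)

lemma int_norm_H: "integrable P (\<lambda>z. norm (H z))"
  by (rule square_integrable_imp_integrable[OF l2_measurable_norm[OF meas_H] int_H])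

lemma mean_inner: "(\<integral>z. u \<bullet> H z \<partial>P) = 0"
proof -
  have m [measurable]: "(\<lambda>z. coord (H z) m) \<in> borel_measurable P" for m
    using meas_H by (simp add: l2_measurable_def)
  have im: "integrable P (\<lambda>z. coord (H z) m)" for m
    by (rule Bochner_Integration.integrable_bound[OF int_norm_H]) (auto simp: coord_le_norm)
  have "(\<lambda>N. \<integral>z. (\<Sum>m<N. coord u m * coord (H z) m) \<partial>P) \<longlonglongrightarrow> (\<integral>z. u \<bullet> H z \<partial>P)"
  proof (rule integral_dominated_convergence[where w = "\<lambda>z. norm u * norm (H z)"])
    show "AE z in P. (\<lambda>N. \<Sum>m<N. coord u m * coord (H z) m) \<longlonglongrightarrow> u \<bullet> H z"
      using inner_l2_sums by (auto simp: sums_def)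
    show "AE z in P. norm (\<Sum>m<N. coord u m * coord (H z) m) \<le> norm u * norm (H z)" for N
    proof (rule AE_I2)
      fix z
      have "(\<Sum>m<N. coord u m * coord (H z) m)\<^sup>2 \<le> (\<Sum>m<N. (coord u m)\<^sup>2) * (\<Sum>m<N. (coord (H z) m)\<^sup>2)"
        by (rule Cauchy_Schwarz_ineq_sum)
      also have "\<dots> \<le> (norm u)\<^sup>2 * (norm (H z))\<^sup>2"
        by (intro mult_mono sum_coord_sq_le sum_nonneg) auto
      finally have "(\<Sum>m<N. coord u m * coord (H z) m)\<^sup>2 \<le> (norm u * norm (H z))\<^sup>2" by (simp add: power_mult_distrib)
      then show "norm (\<Sum>m<N. coord u m * coord (H z) m) \<le> norm u * norm (H z)"
        by (simp add: power2_le_iff_abs_le)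
    qed
  qed (use int_norm_H in auto)
  moreover have "(\<integral>z. (\<Sum>m<N. coord u m * coord (H z) m) \<partial>P) = 0" for N
    by (simp add: Bochner_Integration.integral_sum im mean_H)
  ultimately show ?thesis by (simp add: LIMSEQ_const_iff)
qed

definition cov :: "l2 \<Rightarrow> l2 \<Rightarrow> real" where "cov u w = (\<integral>z. (u \<bullet> H z) * (w \<bullet> H z) \<partial>P)"

text \<open>
Weak continuity of the covariance form is dominated convergence with the integrable bound
\<open>\<bar>H\<bar>\<^sup>2\<close>.
\<close>

sublocale weakly_continuous_form cov
proof
  show "bilinear cov"
    unfolding bilinear_def cov_def
    by (auto intro!: linearI simp: inner_add_left distrib_left distrib_right int_inner_mult mult.assoc mult.left_commute)
  show "cov u v = cov v u" for u v by (simp add: cov_def mult.commute)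
  show "0 \<le> cov u u" for u by (simp add: cov_def)
  show "(\<lambda>n. cov (w n) (w n)) \<longlonglongrightarrow> cov v v"
    if bd: "\<And>n. norm (w n) \<le> 1" and c: "\<And>m. (\<lambda>n. coord (w n) m) \<longlonglongrightarrow> coord v m" for w v
    unfolding cov_def
  proof (rule integral_dominated_convergence[where w = "\<lambda>z. (norm (H z))\<^sup>2"])
    show "AE z in P. (\<lambda>n. (w n \<bullet> H z) * (w n \<bullet> H z)) \<longlonglongrightarrow> (v \<bullet> H z) * (v \<bullet> H z)"
      by (intro AE_I2 tendsto_mult inner_l2_tendsto bd c)
    show "AE z in P. norm ((w n \<bullet> H z) * (w n \<bullet> H z)) \<le> (norm (H z))\<^sup>2" for n
    proof (rule AE_I2)
      fix z
      have "\<bar>w n \<bullet> H z\<bar> \<le> norm (w n) * norm (H z)" by (rule Cauchy_Schwarz_ineq2)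
      also have "\<dots> \<le> norm (H z)" using bd[of n] by (simp add: mult_left_le_one_le)
      finally have "\<bar>w n \<bullet> H z\<bar> * \<bar>w n \<bullet> H z\<bar> \<le> norm (H z) * norm (H z)" by (intro mult_mono) auto
      then show "norm ((w n \<bullet> H z) * (w n \<bullet> H z)) \<le> (norm (H z))\<^sup>2"
        by (simp add: abs_mult power2_eq_square)
    qed
  qed (use int_H in auto)
qed

lemma trace_sums: "(\<lambda>m. cov (axis_l2 m) (axis_l2 m)) sums (\<integral>z. (norm (H z))\<^sup>2 \<partial>P)"
  using norm_sq_sums_integral(1)[OF meas_H int_H] by (simp add: cov_def inner_axis_l2 power2_eq_square)

lemma eigval_sums: "eigval sums (\<integral>z. (norm (H z))\<^sup>2 \<partial>P)"
  using eigval_sums_trace trace_sums by (simp add: sums_iff)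

definition scaled_sum :: "nat \<Rightarrow> (nat \<Rightarrow> 's) \<Rightarrow> l2" where
  "scaled_sum n \<omega> = (1 / sqrt n) *\<^sub>R (\<Sum>k=1..n. H (\<omega> k))"

lemma meas_scaled_sum: "l2_measurable Om (scaled_sum n)"
  unfolding scaled_sum_def using l2_measurable_compose[OF meas_H measurable_coord]
  by (auto simp: l2_measurable_def intro!: borel_measurable_sum borel_measurable_divide)

lemma inner_scaled_sum: "u \<bullet> scaled_sum n \<omega> = (\<Sum>k=1..n. u \<bullet> H (\<omega> k)) / sqrt n"
  by (simp add: scaled_sum_def inner_sum_right)

lemma meas_inner_scaled_sum [measurable]: "(\<lambda>\<omega>. u \<bullet> scaled_sum n \<omega>) \<in> borel_measurable Om"
  by (intro l2_measurable_inner meas_scaled_sum l2_measurable_const)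

lemma
  assumes n: "0 < n"
  shows int_inner_scaled_sum: "integrable Om (\<lambda>\<omega>. (u \<bullet> scaled_sum n \<omega>)\<^sup>2)"
    and cov_scaled_sum: "(\<integral>\<omega>. (u \<bullet> scaled_sum n \<omega>)\<^sup>2 \<partial>Om) = cov u u"
  using n integrable_sum_square[OF meas_inner int_inner_sq mean_inner, of "{1..n}" u]
    integral_sum_square[OF meas_inner int_inner_sq mean_inner, of "{1..n}" u]
  by (simp_all add: inner_scaled_sum power_divide cov_def power2_eq_square)

lemma
  assumes n: "0 < n"
  shows int_norm_scaled_sum: "integrable Om (\<lambda>\<omega>. (norm (scaled_sum n \<omega>))\<^sup>2)"
    and norm_scaled_sum: "(\<integral>\<omega>. (norm (scaled_sum n \<omega>))\<^sup>2 \<partial>Om) = (\<integral>z. (norm (H z))\<^sup>2 \<partial>P)"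
proof -
  show I: "integrable Om (\<lambda>\<omega>. (norm (scaled_sum n \<omega>))\<^sup>2)"
  proof (rule Bochner_Integration.integrable_bound)
    show "integrable Om (\<lambda>\<omega>. \<Sum>k=1..n. (norm (H (\<omega> k)))\<^sup>2)"
      by (intro Bochner_Integration.integrable_sum integrable_coord int_H)
    show "(\<lambda>\<omega>. (norm (scaled_sum n \<omega>))\<^sup>2) \<in> borel_measurable Om"
      using l2_measurable_norm[OF meas_scaled_sum] by measurable
    show "AE \<omega> in Om. norm ((norm (scaled_sum n \<omega>))\<^sup>2) \<le> norm (\<Sum>k=1..n. (norm (H (\<omega> k)))\<^sup>2)"
    proof (rule AE_I2)
      fix \<omega>
      have "(norm (\<Sum>k=1..n. H (\<omega> k)))\<^sup>2 \<le> (\<Sum>k=1..n. norm (H (\<omega> k)))\<^sup>2"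
        by (intro power_mono norm_sum) simp
      also have "\<dots> \<le> (\<Sum>k=1..n. 1\<^sup>2) * (\<Sum>k=1..n. (norm (H (\<omega> k)))\<^sup>2)"
        using Cauchy_Schwarz_ineq_sum[of "\<lambda>_. 1" "\<lambda>k. norm (H (\<omega> k))" "{1..n}"] by simp
      finally show "norm ((norm (scaled_sum n \<omega>))\<^sup>2) \<le> norm (\<Sum>k=1..n. (norm (H (\<omega> k)))\<^sup>2)"
        using n by (simp add: scaled_sum_def power_divide sum_nonneg field_simps)
    qed
  qed
  have "(\<lambda>m. \<integral>\<omega>. (coord (scaled_sum n \<omega>) m)\<^sup>2 \<partial>Om) sums (\<integral>\<omega>. (norm (scaled_sum n \<omega>))\<^sup>2 \<partial>Om)"
    by (rule norm_sq_sums_integral[OF meas_scaled_sum I])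
  moreover have "(\<integral>\<omega>. (coord (scaled_sum n \<omega>) m)\<^sup>2 \<partial>Om) = cov (axis_l2 m) (axis_l2 m)" for m
    using cov_scaled_sum[OF n, of "axis_l2 m"] by (simp add: inner_axis_l2)
  ultimately show "(\<integral>\<omega>. (norm (scaled_sum n \<omega>))\<^sup>2 \<partial>Om) = (\<integral>z. (norm (H z))\<^sup>2 \<partial>P)"
    using trace_sums sums_unique2 by simp
qed

text \<open>
Gaussian linearization: with \<open>u w = (2s)\<^sup>1\<^sup>/\<^sup>2 \<Sum>\<^sub>j w\<^sub>j v\<^sub>j\<close> the Laplace transform on the left is the average
over \<open>w\<close> of the characteristic functions of \<open>\<langle>u w, T\<^sub>n\<rangle>\<close>. These converge by the one-dimensional
central limit theorem, with limit variance \<open>2s \<Sum>\<^sub>j \<lambda>\<^sub>j w\<^sub>j\<^sup>2\<close> since the coordinates along the eigenvectors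
are uncorrelated.
\<close>

lemma laplace_finite:
  assumes s: "0 \<le> s"
  shows "(\<lambda>n. \<integral>\<omega>. exp (- (s * (\<Sum>j<J. (scaled_sum n \<omega> \<bullet> eigvec j)\<^sup>2))) \<partial>Om) \<longlonglongrightarrow>
    (\<integral>w. exp (- (s * (\<Sum>j<J. eigval j * (w j)\<^sup>2))) \<partial>std_normals UNIV)"
proof -
  let ?W = "std_normals (UNIV :: nat set)"
  interpret W: prob_space ?W by (rule prob_space_std_normals)
  interpret WO: pair_prob_space ?W Om ..
  define r where "r = sqrt (2 * s)"
  have r: "r\<^sup>2 = 2 * s" using s by (simp add: r_def)
  define u where "u w = r *\<^sub>R (\<Sum>j<J. w j *\<^sub>R eigvec j)" for w :: "nat \<Rightarrow> real"
  have uT: "u w \<bullet> scaled_sum n \<omega> = (\<Sum>j<J. r * (scaled_sum n \<omega> \<bullet> eigvec j) * w j)" for w n \<omega>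
    by (simp add: u_def inner_sum_left sum_distrib_left inner_commute[of "eigvec _" "scaled_sum n \<omega>"] mult_ac)
  have covu: "cov (u w) (u w) = 2 * s * (\<Sum>j<J. eigval j * (w j)\<^sup>2)" for w
  proof -
    have "cov (\<Sum>j\<in>A. w j *\<^sub>R eigvec j) (\<Sum>j\<in>A. w j *\<^sub>R eigvec j) = (\<Sum>j\<in>A. eigval j * (w j)\<^sup>2)" if "finite A" for A
      using that
    proof (induction A)
      case (insert i A)
      have z: "cov (eigvec i) (\<Sum>j\<in>A. w j *\<^sub>R eigvec j) = 0"
        using insert(2) linear_sum[of "cov (eigvec i)" "\<lambda>j. w j *\<^sub>R eigvec j" A] bil
        by (auto simp: bilinear_def S_simps intro!: sum.neutral S_eigvec)
      then have "cov (\<Sum>j\<in>A. w j *\<^sub>R eigvec j) (eigvec i) = 0" using sym by metis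
      then show ?case using insert z by (simp add: S_simps eigval_def power2_eq_square)
    qed (simp add: S_simps)
    then show ?thesis by (simp add: u_def S_simps r[symmetric] power2_eq_square mult.assoc)
  qed
  have meas_pair: "(\<lambda>(w, \<omega>). iexp (u w \<bullet> scaled_sum n \<omega>)) \<in> borel_measurable (?W \<Otimes>\<^sub>M Om)" for n
  proof -
    have "(\<lambda>\<omega>. scaled_sum n \<omega> \<bullet> eigvec j) \<in> borel_measurable Om" for j
      using meas_inner_scaled_sum[of "eigvec j" n] by (simp add: inner_commute)
    from measurable_compose[OF measurable_snd this]
    have m1: "(\<lambda>p. scaled_sum n (snd p) \<bullet> eigvec j) \<in> borel_measurable (?W \<Otimes>\<^sub>M Om)" for j .
    have m2: "(\<lambda>p. fst p j) \<in> borel_measurable (?W \<Otimes>\<^sub>M Om)" for j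
      by (rule measurable_compose[OF measurable_fst measurable_std_normals_coord])
    have "(\<lambda>p. \<Sum>j<J. r * (scaled_sum n (snd p) \<bullet> eigvec j) * fst p j) \<in> borel_measurable (?W \<Otimes>\<^sub>M Om)"
    proof (rule borel_measurable_sum)
      fix j assume "j \<in> {..<J}"
      show "(\<lambda>p. r * (scaled_sum n (snd p) \<bullet> eigvec j) * fst p j) \<in> borel_measurable (?W \<Otimes>\<^sub>M Om)"
        by (rule borel_measurable_times[OF borel_measurable_times[OF borel_measurable_const m1] m2])
    qed
    then have "(\<lambda>p. iexp (\<Sum>j<J. r * (scaled_sum n (snd p) \<bullet> eigvec j) * fst p j)) \<in> borel_measurable (?W \<Otimes>\<^sub>M Om)"
      by measurable
    then show "(\<lambda>(w, \<omega>). iexp (u w \<bullet> scaled_sum n \<omega>)) \<in> borel_measurable (?W \<Otimes>\<^sub>M Om)"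
      unfolding uT case_prod_unfold .
  qed
  have lin: "complex_of_real (\<integral>\<omega>. exp (- (s * (\<Sum>j<J. (scaled_sum n \<omega> \<bullet> eigvec j)\<^sup>2))) \<partial>Om) =
      (\<integral>w. (\<integral>\<omega>. iexp (u w \<bullet> scaled_sum n \<omega>) \<partial>Om) \<partial>?W)" for n
  proof -
    have "complex_of_real (\<integral>\<omega>. exp (- (s * (\<Sum>j<J. (scaled_sum n \<omega> \<bullet> eigvec j)\<^sup>2))) \<partial>Om) =
      (\<integral>\<omega>. of_real (exp (- (s * (\<Sum>j<J. (scaled_sum n \<omega> \<bullet> eigvec j)\<^sup>2)))) \<partial>Om)" by simp
    also have "\<dots> = (\<integral>\<omega>. (\<integral>w. iexp (u w \<bullet> scaled_sum n \<omega>) \<partial>?W) \<partial>Om)"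
    proof (rule Bochner_Integration.integral_cong[OF refl])
      fix \<omega>
      have "(\<integral>w. iexp (u w \<bullet> scaled_sum n \<omega>) \<partial>?W) = of_real (exp (- (\<Sum>j<J. (r * (scaled_sum n \<omega> \<bullet> eigvec j))\<^sup>2) / 2))"
        unfolding uT by (rule iexp_std_normals) auto
      then show "complex_of_real (exp (- (s * (\<Sum>j<J. (scaled_sum n \<omega> \<bullet> eigvec j)\<^sup>2)))) = (\<integral>w. iexp (u w \<bullet> scaled_sum n \<omega>) \<partial>?W)"
        by (simp add: power_mult_distrib r sum_distrib_left[symmetric] mult.assoc)
    qed
    also have "\<dots> = (\<integral>w. (\<integral>\<omega>. iexp (u w \<bullet> scaled_sum n \<omega>) \<partial>Om) \<partial>?W)"
    proof (rule WO.Fubini_integral)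
      show "integrable (?W \<Otimes>\<^sub>M Om) (\<lambda>(w, \<omega>). iexp (u w \<bullet> scaled_sum n \<omega>))"
      proof (rule WO.P.integrable_const_bound[of _ 1])
        show "(\<lambda>(w, \<omega>). iexp (u w \<bullet> scaled_sum n \<omega>)) \<in> borel_measurable (?W \<Otimes>\<^sub>M Om)" by (rule meas_pair)
      qed auto
    qed
    finally show ?thesis .
  qed
  have "(\<lambda>n. \<integral>w. (\<integral>\<omega>. iexp (u w \<bullet> scaled_sum n \<omega>) \<partial>Om) \<partial>?W) \<longlonglongrightarrow>
      (\<integral>w. complex_of_real (exp (- (s * (\<Sum>j<J. eigval j * (w j)\<^sup>2)))) \<partial>?W)"
  proof (rule integral_dominated_convergence[where w = "\<lambda>_. 1"])
    show "AE w in ?W. (\<lambda>n. \<integral>\<omega>. iexp (u w \<bullet> scaled_sum n \<omega>) \<partial>Om) \<longlonglongrightarrow>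
        complex_of_real (exp (- (s * (\<Sum>j<J. eigval j * (w j)\<^sup>2))))"
    proof (rule AE_I2)
      fix w :: "nat \<Rightarrow> real"
      show "(\<lambda>n. \<integral>\<omega>. iexp (u w \<bullet> scaled_sum n \<omega>) \<partial>Om) \<longlonglongrightarrow> complex_of_real (exp (- (s * (\<Sum>j<J. eigval j * (w j)\<^sup>2))))"
        using clt_iexp[OF meas_inner int_inner_sq mean_inner, of "u w"] covu[of w]
        by (simp add: inner_scaled_sum cov_def power2_eq_square)
    qed
    have nb: "norm (\<integral>\<omega>. iexp (u w \<bullet> scaled_sum n \<omega>) \<partial>Om) \<le> 1" for w n
      using order_trans[OF integral_norm_bound[of Om "\<lambda>\<omega>. iexp (u w \<bullet> scaled_sum n \<omega>)"]] by (simp add: Om.prob_space)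
    then show "AE w in ?W. norm (\<integral>\<omega>. iexp (u w \<bullet> scaled_sum n \<omega>) \<partial>Om) \<le> 1" for n by simp
    show "(\<lambda>w. \<integral>\<omega>. iexp (u w \<bullet> scaled_sum n \<omega>) \<partial>Om) \<in> borel_measurable ?W" for n
      by (rule Om.borel_measurable_lebesgue_integral[OF meas_pair])
  qed auto
  then have "(\<lambda>n. complex_of_real (\<integral>\<omega>. exp (- (s * (\<Sum>j<J. (scaled_sum n \<omega> \<bullet> eigvec j)\<^sup>2))) \<partial>Om)) \<longlonglongrightarrow>
      complex_of_real (\<integral>w. exp (- (s * (\<Sum>j<J. eigval j * (w j)\<^sup>2))) \<partial>?W)"
    by (simp only: lin integral_complex_of_real)
  then show ?thesis by (simp add: tendsto_of_real_iff)
qed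

text \<open>
By Bessel's inequality the coordinates beyond \<open>J\<close> contribute a nonnegative amount to
\<open>\<bar>T\<^sub>n\<bar>\<^sup>2\<close>, whose expectation is the tail of the series of eigenvalues for every \<open>n \<ge> 1\<close>; the same
tail bounds the truncation of the limit.
\<close>

theorem laplace_norm_scaled_sum:
  assumes s: "0 \<le> s"
  shows "(\<lambda>n. \<integral>\<omega>. exp (- (s * (norm (scaled_sum n \<omega>))\<^sup>2)) \<partial>Om) \<longlonglongrightarrow>
    (\<integral>w. exp (- (s * (\<Sum>j. eigval j * (w j)\<^sup>2))) \<partial>std_normals UNIV)"
proof (rule LIMSEQ_I)
  let ?W = "std_normals (UNIV :: nat set)"
  interpret W: prob_space ?W by (rule prob_space_std_normals)
  define \<tau> where "\<tau> = (\<integral>z. (norm (H z))\<^sup>2 \<partial>P)"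
  have ev: "eigval sums \<tau>" unfolding \<tau>_def by (rule eigval_sums)
  have smb: "summable eigval" "suminf eigval = \<tau>" using ev by (simp_all add: sums_iff)
  fix e :: real assume e: "0 < e"
  have "(\<lambda>J. s * (\<tau> - (\<Sum>j<J. eigval j))) \<longlonglongrightarrow> s * (\<tau> - \<tau>)"
    using ev by (intro tendsto_intros) (simp add: sums_def)
  then have "eventually (\<lambda>J. s * (\<tau> - (\<Sum>j<J. eigval j)) < e / 3) sequentially"
    using e by (intro order_tendstoD) auto
  then obtain J where J: "s * (\<tau> - (\<Sum>j<J. eigval j)) < e / 3" by (auto simp: eventually_sequentially)
  obtain n0 where n0: "\<And>n. n \<ge> n0 \<Longrightarrow> \<bar>(\<integral>\<omega>. exp (- (s * (\<Sum>j<J. (scaled_sum n \<omega> \<bullet> eigvec j)\<^sup>2))) \<partial>Om) -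
    (\<integral>w. exp (- (s * (\<Sum>j<J. eigval j * (w j)\<^sup>2))) \<partial>?W)\<bar> < e / 3"
    using LIMSEQ_D[OF laplace_finite[OF s, of J], of "e / 3"] e by auto
  have one: "\<bar>(\<integral>\<omega>. exp (- (s * (norm (scaled_sum n \<omega>))\<^sup>2)) \<partial>Om) - (\<integral>\<omega>. exp (- (s * (\<Sum>j<J. (scaled_sum n \<omega> \<bullet> eigvec j)\<^sup>2))) \<partial>Om)\<bar>
      \<le> s * (\<tau> - (\<Sum>j<J. eigval j))" if n: "0 < n" for n
  proof -
    have I: "integrable Om (\<lambda>\<omega>. (scaled_sum n \<omega> \<bullet> eigvec j)\<^sup>2)" "(\<integral>\<omega>. (scaled_sum n \<omega> \<bullet> eigvec j)\<^sup>2 \<partial>Om) = eigval j" for j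
      using int_inner_scaled_sum[OF n, of "eigvec j"] cov_scaled_sum[OF n, of "eigvec j"] by (simp_all add: inner_commute eigval_def)
    have I2: "integrable Om (\<lambda>\<omega>. \<Sum>j<J. (scaled_sum n \<omega> \<bullet> eigvec j)\<^sup>2)" by (intro Bochner_Integration.integrable_sum I)
    have "(\<integral>\<omega>. (\<Sum>j<J. (scaled_sum n \<omega> \<bullet> eigvec j)\<^sup>2) \<partial>Om) = (\<Sum>j<J. eigval j)"
      by (simp add: Bochner_Integration.integral_sum I)
    then show ?thesis
      using Om.abs_diff_laplace_le[OF _ _ _ int_norm_scaled_sum[OF n] I2 s] bessel[of "scaled_sum n _" J] norm_scaled_sum[OF n]
        borel_measurable_integrable[OF int_norm_scaled_sum[OF n]] borel_measurable_integrable[OF I2]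
      by (simp add: \<tau>_def sum_nonneg)
  qed
  have two: "\<bar>(\<integral>w. exp (- (s * (\<Sum>j. eigval j * (w j)\<^sup>2))) \<partial>?W) - (\<integral>w. exp (- (s * (\<Sum>j<J. eigval j * (w j)\<^sup>2))) \<partial>?W)\<bar>
      \<le> s * (\<tau> - (\<Sum>j<J. eigval j))"
  proof -
    note cs = chi_square_mixture[OF eigval_nonneg smb(1)]
    have I2: "integrable ?W (\<lambda>w. \<Sum>j<J. eigval j * (w j)\<^sup>2)"
      by (intro Bochner_Integration.integrable_sum integrable_mult_right std_normals_coord_sq)
    have v: "(\<integral>w. (\<Sum>j<J. eigval j * (w j)\<^sup>2) \<partial>?W) = (\<Sum>j<J. eigval j)"
      by (simp add: Bochner_Integration.integral_sum std_normals_coord_sq)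
    have "AE w in ?W. 0 \<le> (\<Sum>j<J. eigval j * (w j)\<^sup>2) \<and> (\<Sum>j<J. eigval j * (w j)\<^sup>2) \<le> (\<Sum>j. eigval j * (w j)\<^sup>2)"
      using cs(1) by eventually_elim (auto intro!: sum_nonneg sum_le_suminf simp: eigval_nonneg)
    from W.abs_diff_laplace_le[OF borel_measurable_integrable[OF cs(2)] borel_measurable_integrable[OF I2] this cs(2) I2 s]
    show ?thesis unfolding cs(3) smb(2) v .
  qed
  show "\<exists>no. \<forall>n\<ge>no. norm ((\<integral>\<omega>. exp (- (s * (norm (scaled_sum n \<omega>))\<^sup>2)) \<partial>Om) -
      (\<integral>w. exp (- (s * (\<Sum>j. eigval j * (w j)\<^sup>2))) \<partial>?W)) < e"
  proof (intro exI[of _ "Suc n0"] allI impI)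
    fix n assume "Suc n0 \<le> n"
    then show "norm ((\<integral>\<omega>. exp (- (s * (norm (scaled_sum n \<omega>))\<^sup>2)) \<partial>Om) -
      (\<integral>w. exp (- (s * (\<Sum>j. eigval j * (w j)\<^sup>2))) \<partial>?W)) < e"
      using one[of n] two n0[of n] J unfolding real_norm_def by linarith
  qed
qed

end

section \<open>Distance covariance in Hilbert space and its limit under independence\<close>

text \<open>
Double centering removes every contribution that depends on one index only, so of
\<open>\<bar>a\<^sub>k - a\<^sub>l\<bar>\<^sup>2\<close> only the cross term survives. The lemma is used for vectors of \<open>l2\<close> and
for real numbers.
\<close>

lemma centered_sq_dist:
  fixes a :: "nat \<Rightarrow> 'v::real_inner" and d :: "nat \<Rightarrow> nat \<Rightarrow> real"
  assumes n: "0 < n" and d: "\<And>k l. d k l = (norm (a k - a l))\<^sup>2"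
  defines "m \<equiv> (1 / real n) *\<^sub>R (\<Sum>k=1..n. a k)"
  shows "centered n d k l = - 2 * ((a k - m) \<bullet> (a l - m))"
proof -
  define s where "s = (1 / real n) * (\<Sum>k=1..n. a k \<bullet> a k)"
  have exp: "d k l = a k \<bullet> a k - 2 * (a k \<bullet> a l) + a l \<bullet> a l" for k l
    unfolding d power2_norm_eq_inner by (simp add: inner_diff_left inner_diff_right inner_commute)
  have mi: "(1 / real n) * (\<Sum>l=1..n. v \<bullet> a l) = v \<bullet> m" for v
    by (simp add: m_def inner_sum_right)
  have row: "row_mean n d k = a k \<bullet> a k - 2 * (a k \<bullet> m) + s" for k
  proof -
    have "(\<Sum>l=1..n. d k l) = n * (a k \<bullet> a k) - 2 * (\<Sum>l=1..n. a k \<bullet> a l) + (\<Sum>l=1..n. a l \<bullet> a l)"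
      by (simp add: exp sum.distrib sum_subtractf sum_distrib_left)
    then show ?thesis
      using n by (simp add: row_mean_def s_def mi[symmetric] field_simps)
  qed
  have col: "col_mean n d l = row_mean n d l" for l
    by (simp add: col_mean_def row_mean_def d norm_minus_commute)
  have "grand_mean n d = (1 / real n) * (\<Sum>k=1..n. row_mean n d k)"
    by (simp add: grand_mean_def row_mean_def sum_distrib_left power2_eq_square)
  also have "(\<Sum>k=1..n. row_mean n d k) = (\<Sum>k=1..n. a k \<bullet> a k) - 2 * (\<Sum>k=1..n. m \<bullet> a k) + n * s"
    by (simp add: row sum.distrib sum_subtractf sum_distrib_left inner_commute)
  also have "(1 / real n) * \<dots> = s - 2 * ((1 / real n) * (\<Sum>k=1..n. m \<bullet> a k)) + s"
    using n by (simp add: s_def field_simps)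
  also have "\<dots> = 2 * s - 2 * (m \<bullet> m)" by (simp only: mi)
  finally show ?thesis
    unfolding centered_def col row exp by (simp add: inner_diff_left inner_diff_right inner_commute)
qed

lemma centered_tensor_sum:
  fixes a b :: "nat \<Rightarrow> l2"
  assumes n: "0 < n"
  defines "ma \<equiv> (1 / real n) *\<^sub>R (\<Sum>k=1..n. a k)" and "mb \<equiv> (1 / real n) *\<^sub>R (\<Sum>k=1..n. b k)"
  shows "(\<Sum>k=1..n. tensor (a k - ma) (b k - mb)) = (\<Sum>k=1..n. tensor (a k) (b k)) - real n *\<^sub>R tensor ma mb"
proof -
  have s: "(\<Sum>k=1..n. a k) = real n *\<^sub>R ma" "(\<Sum>k=1..n. b k) = real n *\<^sub>R mb"
    using n by (simp_all add: ma_def mb_def)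
  have "(\<Sum>k=1..n. tensor (a k - ma) (b k - mb)) = (\<Sum>k=1..n. tensor (a k) (b k)) - tensor (\<Sum>k=1..n. a k) mb
      - tensor ma (\<Sum>k=1..n. b k) + real n *\<^sub>R tensor ma mb"
    by (simp add: tensor_linear sum_subtractf tensor_sum sum_constant_scaleR)
  then show ?thesis unfolding s by (simp add: tensor_linear)
qed

text \<open>
The products of the two centered matrices are inner products of tensors, so their double sum is the
squared norm of one vector; expanding the sample means separates the main term from the correction.
\<close>

lemma dcov_sq_tensor:
  fixes x :: "nat \<Rightarrow> real ^ 'p" and y :: "nat \<Rightarrow> real ^ 'q" and a b :: "nat \<Rightarrow> l2"
  assumes n: "0 < n" and a: "\<And>k l. norm (x k - x l) = (norm (a k - a l))\<^sup>2"
    and b: "\<And>k l. norm (y k - y l) = (norm (b k - b l))\<^sup>2"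
  shows "real n * dcov_sq n x y = 4 * (norm ((1 / sqrt n) *\<^sub>R (\<Sum>k=1..n. tensor (a k) (b k)) -
     sqrt n *\<^sub>R tensor ((1 / real n) *\<^sub>R (\<Sum>k=1..n. a k)) ((1 / real n) *\<^sub>R (\<Sum>k=1..n. b k))))\<^sup>2"
proof -
  define ma mb where "ma = (1 / real n) *\<^sub>R (\<Sum>k=1..n. a k)" and "mb = (1 / real n) *\<^sub>R (\<Sum>k=1..n. b k)"
  let ?t = "\<Sum>k=1..n. tensor (a k - ma) (b k - mb)"
  have "(\<Sum>k=1..n. \<Sum>l=1..n. centered n (dist_entry x) k l * centered n (dist_entry y) k l)
     = 4 * (\<Sum>k=1..n. \<Sum>l=1..n. tensor (a k - ma) (b k - mb) \<bullet> tensor (a l - ma) (b l - mb))"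
    using centered_sq_dist[OF n, of "dist_entry x" a] centered_sq_dist[OF n, of "dist_entry y" b] a b
    by (simp add: dist_entry_def ma_def mb_def inner_tensor sum_distrib_left mult_ac)
  also have "\<dots> = 4 * (norm ?t)\<^sup>2"
    by (simp add: power2_norm_eq_inner inner_sum_left inner_sum_right) (rule sum.swap)
  finally have "real n * dcov_sq n x y = 4 * ((1 / sqrt n)\<^sup>2 * (norm ?t)\<^sup>2)"
    using n by (simp add: dcov_sq_def power_divide power2_eq_square)
  also have "\<dots> = 4 * (norm ((1 / sqrt n) *\<^sub>R ?t))\<^sup>2"
    by (simp add: power_divide)
  also have "(1 / sqrt n) *\<^sub>R ?t = (1 / sqrt n) *\<^sub>R (\<Sum>k=1..n. tensor (a k) (b k)) - sqrt n *\<^sub>R tensor ma mb"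
    using n unfolding ma_def mb_def centered_tensor_sum[OF n] by (simp add: scaleR_diff_right real_div_sqrt)
  finally show ?thesis unfolding ma_def mb_def .
qed

text \<open>
The coordinatewise expectations are square summable by Jensen's inequality.
\<close>

lemma (in prob_space) ex_l2_mean:
  assumes H: "l2_measurable M H" and I: "integrable M (\<lambda>z. (norm (H z))\<^sup>2)"
  shows "\<exists>m. \<forall>i. coord m i = (\<integral>z. coord (H z) i \<partial>M)"
proof -
  have c [measurable]: "(\<lambda>z. coord (H z) i) \<in> borel_measurable M" for i
    using H by (simp add: l2_measurable_def)
  note s = norm_sq_sums_integral[OF H I]
  have "(\<integral>z. coord (H z) i \<partial>M)\<^sup>2 \<le> (\<integral>z. (coord (H z) i)\<^sup>2 \<partial>M)" for i
  proof -
    have "0 \<le> variance (\<lambda>z. coord (H z) i)" by simp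
    also have "\<dots> = (\<integral>z. (coord (H z) i)\<^sup>2 \<partial>M) - (\<integral>z. coord (H z) i \<partial>M)\<^sup>2"
      by (rule variance_eq[OF square_integrable_imp_integrable[OF c s(2)] s(2)])
    finally show ?thesis by simp
  qed
  then have "norm ((\<integral>z. coord (H z) i \<partial>M)\<^sup>2) \<le> (\<integral>z. (coord (H z) i)\<^sup>2 \<partial>M)" for i by simp
  from summable_comparison_test'[OF sums_summable[OF s(1)] this]
  have "summable (\<lambda>i. (\<integral>z. coord (H z) i \<partial>M)\<^sup>2)" .
  then show ?thesis by (intro exI[of _ "Abs_l2 (\<lambda>i. \<integral>z. coord (H z) i \<partial>M)"]) (simp add: coord_Abs)
qed

lemma (in prob_space) ex_centered_dist_embed:
  fixes X :: "'a \<Rightarrow> 'b::euclidean_space"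
  assumes [measurable]: "X \<in> borel_measurable M" and X1: "integrable M (\<lambda>z. norm (X z))"
  shows "\<exists>m. centered_l2 M (\<lambda>z. dist_embed (X z) - m)"
proof -
  have H: "l2_measurable M (\<lambda>z. dist_embed (X z))"
    by (rule l2_measurable_compose[OF l2_measurable_dist_embed]) measurable
  have I: "integrable M (\<lambda>z. (norm (dist_embed (X z)))\<^sup>2)" using X1 by (simp add: norm_dist_embed)
  obtain m where m: "\<And>i. coord m i = (\<integral>z. coord (dist_embed (X z)) i \<partial>M)" using ex_l2_mean[OF H I] by blast
  have Hm: "l2_measurable M (\<lambda>z. dist_embed (X z) - m)" by (intro l2_measurable_arith H l2_measurable_const)
  have c: "integrable M (\<lambda>z. coord (dist_embed (X z)) i)" for i
    using H by (intro square_integrable_imp_integrable[OF _ norm_sq_sums_integral(2)[OF H I]]) (simp add: l2_measurable_def)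
  have "centered_l2 M (\<lambda>z. dist_embed (X z) - m)"
  proof
    show "l2_measurable M (\<lambda>z. dist_embed (X z) - m)" by (rule Hm)
    show "integrable M (\<lambda>z. (norm (dist_embed (X z) - m))\<^sup>2)"
    proof (rule Bochner_Integration.integrable_bound)
      show "integrable M (\<lambda>z. 2 * (norm (dist_embed (X z)))\<^sup>2 + 2 * (norm m)\<^sup>2)" using I by simp
      show "(\<lambda>z. (norm (dist_embed (X z) - m))\<^sup>2) \<in> borel_measurable M"
        using l2_measurable_norm[OF Hm] by measurable
      show "AE z in M. norm ((norm (dist_embed (X z) - m))\<^sup>2) \<le> norm (2 * (norm (dist_embed (X z)))\<^sup>2 + 2 * (norm m)\<^sup>2)"
      proof (rule AE_I2)
        fix z
        have "(norm (dist_embed (X z) - m))\<^sup>2 \<le> (norm (dist_embed (X z)) + norm m)\<^sup>2"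
          by (intro power_mono norm_triangle_ineq4) simp
        also have "\<dots> \<le> 2 * (norm (dist_embed (X z)))\<^sup>2 + 2 * (norm m)\<^sup>2"
          using zero_le_power2[of "norm (dist_embed (X z)) - norm m"] by (simp add: power2_sum power2_diff)
        finally show "norm ((norm (dist_embed (X z) - m))\<^sup>2) \<le> norm (2 * (norm (dist_embed (X z)))\<^sup>2 + 2 * (norm m)\<^sup>2)"
          by simp
      qed
    qed
    show "(\<integral>z. coord (dist_embed (X z) - m) i \<partial>M) = 0" for i
      using c[of i] by (simp add: m[of i, symmetric] prob_space)
  qed
  then show ?thesis by blast
qed

lemma centered_l2_compose:
  assumes P: "prob_space P" and f: "f \<in> measurable P M" and D: "distr P M f = M" and H: "centered_l2 M H"
  shows "centered_l2 P (\<lambda>z. H (f z))"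
    and "(\<integral>z. (norm (H (f z)))\<^sup>2 \<partial>P) = (\<integral>z. (norm (H z))\<^sup>2 \<partial>M)"
proof -
  interpret M: centered_l2 M H by (rule H)
  have c [measurable]: "(\<lambda>z. coord (H z) i) \<in> borel_measurable M" for i
    using M.meas_H by (simp add: l2_measurable_def)
  have nm [measurable]: "(\<lambda>z. (norm (H z))\<^sup>2) \<in> borel_measurable M"
    using l2_measurable_norm[OF M.meas_H] by measurable
  show "centered_l2 P (\<lambda>z. H (f z))"
    unfolding centered_l2_def iid_sequence_def centered_l2_axioms_def
  proof (intro conjI P allI)
    show "l2_measurable P (\<lambda>z. H (f z))" by (rule l2_measurable_compose[OF M.meas_H f])
    show "integrable P (\<lambda>z. (norm (H (f z)))\<^sup>2)"
      using integrable_distr_eq[OF f nm] by (simp add: D M.int_H)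
    show "(\<integral>z. coord (H (f z)) i \<partial>P) = 0" for i
      using integral_distr[OF f c, of i] by (simp add: D M.mean_H)
  qed
  show "(\<integral>z. (norm (H (f z)))\<^sup>2 \<partial>P) = (\<integral>z. (norm (H z))\<^sup>2 \<partial>M)"
    using integral_distr[OF f nm] by (simp add: D)
qed

lemma (in pair_sigma_finite)
  fixes u :: "'a \<Rightarrow> real" and v :: "'b \<Rightarrow> real"
  assumes u: "integrable M1 u" and v: "integrable M2 v"
  shows integrable_fst_times_snd: "integrable (M1 \<Otimes>\<^sub>M M2) (\<lambda>z. u (fst z) * v (snd z))"
    and integral_fst_times_snd: "(\<integral>z. u (fst z) * v (snd z) \<partial>(M1 \<Otimes>\<^sub>M M2)) = (\<integral>x. u x \<partial>M1) * (\<integral>y. v y \<partial>M2)"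
proof -
  show I: "integrable (M1 \<Otimes>\<^sub>M M2) (\<lambda>z. u (fst z) * v (snd z))"
  proof (rule Fubini_integrable)
    show "(\<lambda>z. u (fst z) * v (snd z)) \<in> borel_measurable (M1 \<Otimes>\<^sub>M M2)"
      using borel_measurable_integrable[OF u] borel_measurable_integrable[OF v] by measurable
    show "integrable M1 (\<lambda>x. \<integral>y. norm (u (fst (x, y)) * v (snd (x, y))) \<partial>M2)"
      using u v by (simp add: abs_mult)
    show "AE x in M1. integrable M2 (\<lambda>y. u (fst (x, y)) * v (snd (x, y)))" using v by simp
  qed
  show "(\<integral>z. u (fst z) * v (snd z) \<partial>(M1 \<Otimes>\<^sub>M M2)) = (\<integral>x. u x \<partial>M1) * (\<integral>y. v y \<partial>M2)"
    using integral_fst'[OF I] by simp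
qed

text \<open>
Independence enters here: under a product law the expectation of a tensor coordinate and the second
moment factor.
\<close>

lemma centered_l2_tensor:
  assumes f: "centered_l2 P1 f" and g: "centered_l2 P2 g"
  shows "centered_l2 (P1 \<Otimes>\<^sub>M P2) (\<lambda>z. tensor (f (fst z)) (g (snd z)))"
    and "(\<integral>z. (norm (tensor (f (fst z)) (g (snd z))))\<^sup>2 \<partial>(P1 \<Otimes>\<^sub>M P2)) =
      (\<integral>z. (norm (f z))\<^sup>2 \<partial>P1) * (\<integral>z. (norm (g z))\<^sup>2 \<partial>P2)"
proof -
  interpret f: centered_l2 P1 f by (rule f)
  interpret g: centered_l2 P2 g by (rule g)
  interpret fg: pair_prob_space P1 P2 ..
  have c: "integrable P1 (\<lambda>z. coord (f z) i)" "integrable P2 (\<lambda>z. coord (g z) i)" for i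
    using f.meas_H g.meas_H f.square_integrable_imp_integrable[OF _ norm_sq_sums_integral(2)[OF f.meas_H f.int_H], of i]
      g.square_integrable_imp_integrable[OF _ norm_sq_sums_integral(2)[OF g.meas_H g.int_H], of i]
    by (simp_all add: l2_measurable_def)
  note prod = fg.integrable_fst_times_snd fg.integral_fst_times_snd
  show "centered_l2 (P1 \<Otimes>\<^sub>M P2) (\<lambda>z. tensor (f (fst z)) (g (snd z)))"
  proof
    show "l2_measurable (P1 \<Otimes>\<^sub>M P2) (\<lambda>z. tensor (f (fst z)) (g (snd z)))"
      by (intro l2_measurable_arith l2_measurable_compose[OF f.meas_H] l2_measurable_compose[OF g.meas_H]) measurable
    show "integrable (P1 \<Otimes>\<^sub>M P2) (\<lambda>z. (norm (tensor (f (fst z)) (g (snd z))))\<^sup>2)"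
      unfolding norm_tensor power_mult_distrib by (rule prod(1)[OF f.int_H g.int_H])
    show "(\<integral>z. coord (tensor (f (fst z)) (g (snd z))) i \<partial>(P1 \<Otimes>\<^sub>M P2)) = 0" for i
      unfolding coord_tensor by (simp add: prod(2)[OF c] f.mean_H)
  qed
  show "(\<integral>z. (norm (tensor (f (fst z)) (g (snd z))))\<^sup>2 \<partial>(P1 \<Otimes>\<^sub>M P2)) =
      (\<integral>z. (norm (f z))\<^sup>2 \<partial>P1) * (\<integral>z. (norm (g z))\<^sup>2 \<partial>P2)"
    unfolding norm_tensor power_mult_distrib by (rule prod(2)[OF f.int_H g.int_H])
qed


context centered_l2
begin

definition mean_sq_dist :: "nat \<Rightarrow> (nat \<Rightarrow> 's) \<Rightarrow> real" where
  "mean_sq_dist n \<omega> = (1 / (real n)\<^sup>2) * (\<Sum>k=1..n. \<Sum>l=1..n. (norm (H (\<omega> k) - H (\<omega> l)))\<^sup>2)"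

lemma mean_sq_dist_eq:
  assumes n: "0 < n"
  shows "mean_sq_dist n \<omega> = 2 * ((\<Sum>k=1..n. (norm (H (\<omega> k)))\<^sup>2) / real n) - 2 * (norm (scaled_sum n \<omega>))\<^sup>2 / real n"
proof -
  have "(\<Sum>k=1..n. \<Sum>l=1..n. (norm (H (\<omega> k) - H (\<omega> l)))\<^sup>2) =
     (\<Sum>k=1..n. \<Sum>l=1..n. (norm (H (\<omega> k)))\<^sup>2 + (norm (H (\<omega> l)))\<^sup>2 - 2 * (H (\<omega> k) \<bullet> H (\<omega> l)))"
    by (intro sum.cong refl) (simp add: power2_norm_eq_inner inner_diff_left inner_diff_right inner_commute)
  also have "\<dots> = 2 * (real n * (\<Sum>k=1..n. (norm (H (\<omega> k)))\<^sup>2)) - 2 * (norm (\<Sum>k=1..n. H (\<omega> k)))\<^sup>2"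
    unfolding power2_norm_eq_inner
    by (simp add: sum.distrib sum_subtractf inner_sum_left inner_sum_right sum_distrib_left) (rule sum.swap)
  also have "(norm (\<Sum>k=1..n. H (\<omega> k)))\<^sup>2 = real n * (norm (scaled_sum n \<omega>))\<^sup>2"
    using n by (simp add: scaled_sum_def power_divide)
  finally show ?thesis using n by (simp add: mean_sq_dist_def field_simps power2_eq_square)
qed

text \<open>
The mean squared distance is \<open>2/n \<Sum> \<bar>H\<^sub>k\<bar>\<^sup>2\<close> minus twice the squared norm of the sample mean; the
first part obeys the law of large numbers and the second has expectation of order \<open>1/n\<close>.
\<close>

lemma mean_sq_dist_L1:
  shows "0 < n \<Longrightarrow> integrable Om (\<lambda>\<omega>. mean_sq_dist n \<omega> - 2 * (\<integral>z. (norm (H z))\<^sup>2 \<partial>P))"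
    and "(\<lambda>n. \<integral>\<omega>. \<bar>mean_sq_dist n \<omega> - 2 * (\<integral>z. (norm (H z))\<^sup>2 \<partial>P)\<bar> \<partial>Om) \<longlonglongrightarrow> 0"
proof -
  define A where "A = (\<integral>z. (norm (H z))\<^sup>2 \<partial>P)"
  let ?m = "\<lambda>n \<omega>. (\<Sum>k=1..n. (norm (H (\<omega> k)))\<^sup>2) / real n"
  have Im: "integrable Om (?m n)" for n
    by (intro integrable_divide Bochner_Integration.integrable_sum integrable_coord int_H)
  show I: "integrable Om (\<lambda>\<omega>. mean_sq_dist n \<omega> - 2 * (\<integral>z. (norm (H z))\<^sup>2 \<partial>P))" if "0 < n" for n
    unfolding mean_sq_dist_eq[OF that]
    by (intro Bochner_Integration.integrable_diff integrable_mult_right integrable_divide Im int_norm_scaled_sum that Om.integrable_const)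
  have bound: "(\<integral>\<omega>. \<bar>mean_sq_dist n \<omega> - 2 * A\<bar> \<partial>Om) \<le> 2 * (\<integral>\<omega>. \<bar>?m n \<omega> - A\<bar> \<partial>Om) + 2 * A / real n" if n: "0 < n" for n
  proof -
    have J: "integrable Om (\<lambda>\<omega>. \<bar>?m n \<omega> - A\<bar>)"
      by (intro integrable_abs Bochner_Integration.integrable_diff Im Om.integrable_const)
    have K: "integrable Om (\<lambda>\<omega>. 2 * (norm (scaled_sum n \<omega>))\<^sup>2 / real n)"
      by (intro integrable_divide integrable_mult_right int_norm_scaled_sum n)
    have "(\<integral>\<omega>. \<bar>mean_sq_dist n \<omega> - 2 * A\<bar> \<partial>Om) \<le> (\<integral>\<omega>. 2 * \<bar>?m n \<omega> - A\<bar> + 2 * (norm (scaled_sum n \<omega>))\<^sup>2 / real n \<partial>Om)"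
    proof (rule integral_mono)
      show "integrable Om (\<lambda>\<omega>. \<bar>mean_sq_dist n \<omega> - 2 * A\<bar>)" unfolding A_def by (intro integrable_abs I n)
      show "integrable Om (\<lambda>\<omega>. 2 * \<bar>?m n \<omega> - A\<bar> + 2 * (norm (scaled_sum n \<omega>))\<^sup>2 / real n)"
        by (intro Bochner_Integration.integrable_add integrable_mult_right J K)
      show "\<bar>mean_sq_dist n \<omega> - 2 * A\<bar> \<le> 2 * \<bar>?m n \<omega> - A\<bar> + 2 * (norm (scaled_sum n \<omega>))\<^sup>2 / real n" for \<omega>
      proof -
        have tri: "\<bar>2 * m - t - 2 * A\<bar> \<le> 2 * \<bar>m - A\<bar> + t" if "0 \<le> t" for m t
          using that by (auto simp: abs_if)
        show ?thesis unfolding mean_sq_dist_eq[OF n] by (rule tri) simp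
      qed
    qed
    also have "\<dots> = 2 * (\<integral>\<omega>. \<bar>?m n \<omega> - A\<bar> \<partial>Om) + 2 * A / real n"
      using J K norm_scaled_sum[OF n] by (simp add: A_def)
    finally show ?thesis .
  qed
  have "(\<lambda>n. 2 * (\<integral>\<omega>. \<bar>?m n \<omega> - A\<bar> \<partial>Om) + 2 * A / real n) \<longlonglongrightarrow> 2 * 0 + 0"
    unfolding A_def by (intro tendsto_add tendsto_mult tendsto_const weak_law_L1 int_H lim_const_over_n)
  then have "(\<lambda>n. 2 * (\<integral>\<omega>. \<bar>?m n \<omega> - A\<bar> \<partial>Om) + 2 * A / real n) \<longlonglongrightarrow> 0" by simp
  then have "(\<lambda>n. \<integral>\<omega>. \<bar>mean_sq_dist n \<omega> - 2 * A\<bar> \<partial>Om) \<longlonglongrightarrow> 0"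
    by (rule Lim_null_comparison[OF eventually_sequentiallyI[of 1], rotated]) (use bound in auto)
  then show "(\<lambda>n. \<integral>\<omega>. \<bar>mean_sq_dist n \<omega> - 2 * (\<integral>z. (norm (H z))\<^sup>2 \<partial>P)\<bar> \<partial>Om) \<longlonglongrightarrow> 0"
    unfolding A_def .
qed

end

lemma (in prob_space) markov_abs:
  fixes Y :: "'a \<Rightarrow> real"
  assumes Y: "integrable M Y" and d: "0 < d"
  shows "prob {x \<in> space M. d < \<bar>Y x\<bar>} \<le> (\<integral>x. \<bar>Y x\<bar> \<partial>M) / d"
proof -
  have [measurable]: "Y \<in> borel_measurable M" using Y by simp
  have ev: "{x \<in> space M. d < \<bar>Y x\<bar>} \<in> events" by measurable
  have "prob {x \<in> space M. d < \<bar>Y x\<bar>} = (\<integral>x. indicator {x \<in> space M. d < \<bar>Y x\<bar>} x \<partial>M)"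
    using ev by simp
  also have "\<dots> \<le> (\<integral>x. \<bar>Y x\<bar> / d \<partial>M)"
  proof (rule integral_mono)
    show "integrable M (indicat_real {x \<in> space M. d < \<bar>Y x\<bar>})"
      using ev by (intro integrable_real_indicator) (auto simp: less_top[symmetric])
    show "indicat_real {x \<in> space M. d < \<bar>Y x\<bar>} x \<le> \<bar>Y x\<bar> / d" for x
      using d by (auto simp: indicator_def)
  qed (use Y in simp)
  finally show ?thesis by simp
qed

text \<open>
Outside the bad event \<open>B\<close> the exponentials differ by at most \<open>s e\<close>, and on \<open>B\<close> by at most \<open>1\<close>.
\<close>

lemma (in prob_space) laplace_close:
  fixes R R' :: "'a \<Rightarrow> real" and s :: real
  assumes m: "R \<in> borel_measurable M" "R' \<in> borel_measurable M"
    and R: "\<And>x. 0 \<le> R x" "\<And>x. 0 \<le> R' x" and s: "0 \<le> s" and B: "B \<in> events" and e: "0 \<le> e"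
    and close: "\<And>x. x \<in> space M \<Longrightarrow> x \<notin> B \<Longrightarrow> \<bar>R x - R' x\<bar> \<le> e"
  shows "\<bar>(\<integral>x. exp (- (s * R x)) \<partial>M) - (\<integral>x. exp (- (s * R' x)) \<partial>M)\<bar> \<le> s * e + prob B"
proof -
  have I: "integrable M (\<lambda>x. exp (- (s * R x)))" "integrable M (\<lambda>x. exp (- (s * R' x)))"
    by (intro integrable_laplace m s AE_I2 R)+
  have J: "integrable M (indicat_real B)"
    using B by (intro integrable_real_indicator) (auto simp: less_top[symmetric])
  have "\<bar>(\<integral>x. exp (- (s * R x)) \<partial>M) - (\<integral>x. exp (- (s * R' x)) \<partial>M)\<bar> =
    \<bar>\<integral>x. exp (- (s * R x)) - exp (- (s * R' x)) \<partial>M\<bar>" using I by simp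
  also have "\<dots> \<le> (\<integral>x. \<bar>exp (- (s * R x)) - exp (- (s * R' x))\<bar> \<partial>M)" by (rule integral_abs_bound)
  also have "\<dots> \<le> (\<integral>x. s * e + indicator B x \<partial>M)"
  proof (rule integral_mono)
    fix x assume x: "x \<in> space M"
    have lip: "\<bar>exp (- (s * R x)) - exp (- (s * R' x))\<bar> \<le> s * \<bar>R x - R' x\<bar>"
      using exp_neg_lipschitz[of "s * R x" "s * R' x"] R s by (simp add: right_diff_distrib[symmetric] abs_mult)
    have one: "\<bar>exp (- (s * R x)) - exp (- (s * R' x))\<bar> \<le> 1"
    proof -
      have "0 < exp (- (s * R x))" "exp (- (s * R x)) \<le> 1" "0 < exp (- (s * R' x))" "exp (- (s * R' x)) \<le> 1"
        using R s by simp_all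
      then show ?thesis by linarith
    qed
    show "\<bar>exp (- (s * R x)) - exp (- (s * R' x))\<bar> \<le> s * e + indicator B x"
    proof (cases "x \<in> B")
      case True
      moreover have "0 \<le> s * e" using s e by simp
      ultimately show ?thesis using one by simp
    next
      case False
      then have "s * \<bar>R x - R' x\<bar> \<le> s * e" using close[OF x] s by (intro mult_left_mono) auto
      then show ?thesis using lip False by simp
    qed
  qed (use I J in auto)
  also have "\<dots> = s * e + prob B" using J B by (simp add: prob_space)
  finally show ?thesis .
qed

text \<open>
Uniform continuity of \<open>4 t\<^sup>2 / (a b)\<close> on a compact set around the values \<open>a = 2 A\<close>, \<open>b = 2 B\<close>, where
it equals \<open>t\<^sup>2 / (A B)\<close>.
\<close>

lemma ratio_uniformly_close:
  fixes A B K e :: real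
  assumes A: "0 < A" and B: "0 < B" and e: "0 < e"
  shows "\<exists>d>0. \<forall>t t' a b. 0 \<le> t \<longrightarrow> t \<le> K \<longrightarrow> \<bar>t' - t\<bar> \<le> d \<longrightarrow> \<bar>a - 2 * A\<bar> \<le> d \<longrightarrow> \<bar>b - 2 * B\<bar> \<le> d \<longrightarrow>
    \<bar>4 * t'\<^sup>2 / (a * b) - t\<^sup>2 / (A * B)\<bar> \<le> e"
proof -
  define C where "C = {-1..K + 1} \<times> {A..3 * A} \<times> {B..3 * B}"
  define h where "h p = 4 * (fst p)\<^sup>2 / (fst (snd p) * snd (snd p))" for p :: "real \<times> real \<times> real"
  have "compact C" unfolding C_def by (intro compact_Times compact_Icc)
  moreover have "continuous_on C h"
    unfolding h_def C_def using A B by (intro continuous_intros) auto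
  ultimately have "uniformly_continuous_on C h" by (rule compact_uniformly_continuous[rotated])
  then obtain c where c: "0 < c" "\<And>p p'. p \<in> C \<Longrightarrow> p' \<in> C \<Longrightarrow> dist p' p < c \<Longrightarrow> dist (h p') (h p) < e"
    unfolding uniformly_continuous_on_def using e by metis
  define d where "d = min (min 1 (c / 4)) (min A B)"
  have d: "0 < d" "d \<le> 1" "3 * d < c" "d \<le> A" "d \<le> B" using c(1) A B by (auto simp: d_def)
  have "\<bar>4 * t'\<^sup>2 / (a * b) - t\<^sup>2 / (A * B)\<bar> \<le> e"
    if t: "0 \<le> t" "t \<le> K" "\<bar>t' - t\<bar> \<le> d" "\<bar>a - 2 * A\<bar> \<le> d" "\<bar>b - 2 * B\<bar> \<le> d" for t t' a b
  proof -
    have "dist (t', a, b) (t, 2 * A, 2 * B) \<le> \<bar>t' - t\<bar> + (\<bar>a - 2 * A\<bar> + \<bar>b - 2 * B\<bar>)"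
      unfolding dist_Pair_Pair dist_real_def
      by (rule order_trans[OF sqrt_sum_squares_le_sum_abs]) (simp add: sqrt_sum_squares_le_sum_abs)
    then have "dist (t', a, b) (t, 2 * A, 2 * B) < c" using t d by linarith
    moreover have "(t', a, b) \<in> C" "(t, 2 * A, 2 * B) \<in> C"
      using t d A B by (auto simp: C_def abs_le_iff)
    ultimately have "dist (h (t', a, b)) (h (t, 2 * A, 2 * B)) < e" using c(2) by blast
    then show ?thesis using A B by (simp add: h_def dist_real_def)
  qed
  then show ?thesis using d(1) by blast
qed

text \<open>
A vanishing variance makes the embedding almost surely constant; the embedding is injective.
\<close>

lemma dist_embed_variance_pos:
  fixes R :: "'z::euclidean_space measure"
  assumes R: "centered_l2 R (\<lambda>x. dist_embed x - m)" "\<nexists>c. AE x in R. x = c"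
  shows "0 < (\<integral>x. (norm (dist_embed x - m))\<^sup>2 \<partial>R)"
proof (rule ccontr)
  interpret R: centered_l2 R "\<lambda>x. dist_embed x - m" by (rule R)
  assume "\<not> ?thesis"
  moreover have "0 \<le> (\<integral>x. (norm (dist_embed x - m))\<^sup>2 \<partial>R)" by simp
  ultimately have "(\<integral>x. (norm (dist_embed x - m))\<^sup>2 \<partial>R) = 0" by linarith
  then have ae: "AE x in R. dist_embed x = m"
    using integral_nonneg_eq_0_iff_AE[OF R.int_H] by simp
  have "\<exists>x0 :: 'z. dist_embed x0 = m"
  proof (rule ccontr)
    assume none: "\<nexists>x0 :: 'z. dist_embed x0 = m"
    from ae have "AE x in R. False" by (rule eventually_mono) (use none in blast)
    then show False by (simp add: R.AE_False)
  qed
  then obtain x0 :: 'z where x0: "dist_embed x0 = m" ..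
  have "AE x in R. x = x0"
    using ae
  proof eventually_elim
    case (elim x)
    then show ?case using norm_dist_embed_diff[of x x0] x0 by simp
  qed
  then show False using R(2) by blast
qed

text \<open>
The statistic and \<open>\<bar>T\<^sub>n\<bar>\<^sup>2 / (A B)\<close> are close outside four events of small probability: \<open>T\<^sub>n\<close> is large,
the correction \<open>D\<^sub>n\<close> is not small, or one of the two mean distances is far from its limit \<open>2 A\<close> or \<open>2 B\<close>.
The norm of \<open>D\<^sub>n\<close> is \<open>n\<^sup>-\<^sup>1\<^sup>/\<^sup>2\<close> times the product of the norms of two scaled sums, which is
estimated by half the sum of their squares; these have the expectations \<open>A\<close> and \<open>B\<close>.
\<close>

lemma laplace_test_stat:
  fixes PX :: "(real ^ 'p) measure" and PY :: "(real ^ 'q) measure"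
  assumes PX: "prob_space PX" "sets PX = sets borel" "integrable PX norm" "\<nexists>c. AE x in PX. x = c"
    and PY: "prob_space PY" "sets PY = sets borel" "integrable PY norm" "\<nexists>c. AE y in PY. y = c"
  shows "\<exists>lam. (\<forall>j. 0 \<le> lam j) \<and> lam sums 1 \<and>
    (\<forall>s\<ge>0. (\<lambda>n. \<integral>\<omega>. exp (- (s * test_stat n (\<lambda>k. fst (\<omega> k)) (\<lambda>k. snd (\<omega> k)))) \<partial>PiM UNIV (\<lambda>_. PX \<Otimes>\<^sub>M PY))
      \<longlonglongrightarrow> (\<integral>w. exp (- (s * (\<Sum>j. lam j * (w j)\<^sup>2))) \<partial>std_normals UNIV))"
proof -
  interpret PX: prob_space PX by (rule PX)
  interpret PY: prob_space PY by (rule PY)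
  interpret PXY: pair_prob_space PX PY ..
  have [measurable]: "(\<lambda>x. x) \<in> borel_measurable PX" "(\<lambda>x. x) \<in> borel_measurable PY"
    using PX(2) PY(2) by (simp_all add: measurable_def)
  obtain mX where f: "centered_l2 PX (\<lambda>x. dist_embed x - mX)"
    using PX.ex_centered_dist_embed[of "\<lambda>x. x"] PX(3) by auto
  obtain mY where g: "centered_l2 PY (\<lambda>y. dist_embed y - mY)"
    using PY.ex_centered_dist_embed[of "\<lambda>x. x"] PY(3) by auto
  define A where "A = (\<integral>x. (norm (dist_embed x - mX))\<^sup>2 \<partial>PX)"
  define B where "B = (\<integral>y. (norm (dist_embed y - mY))\<^sup>2 \<partial>PY)"
  have A: "0 < A" unfolding A_def by (rule dist_embed_variance_pos[OF f PX(4)])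
  have B: "0 < B" unfolding B_def by (rule dist_embed_variance_pos[OF g PY(4)])
  let ?P = "PX \<Otimes>\<^sub>M PY"
  let ?H = "\<lambda>z. tensor (dist_embed (fst z) - mX) (dist_embed (snd z) - mY)"
  have d1: "distr ?P PX fst = PX" by (rule PY.distr_pair_fst)
  have d2: "distr ?P PY snd = PY"
  proof (rule measure_eqI)
    fix S assume "S \<in> sets (distr ?P PY snd)"
    then have S: "S \<in> sets PY" by simp
    then have "snd -` S \<inter> space ?P = space PX \<times> S"
      using sets.sets_into_space[OF S] by (auto simp: space_pair_measure)
    then show "emeasure (distr ?P PY snd) S = emeasure PY S"
      using S by (simp add: emeasure_distr PY.emeasure_pair_measure_Times PX.emeasure_space_1)
  qed simp
  interpret h: centered_l2 ?P ?H by (rule centered_l2_tensor[OF f g])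
  interpret fx: centered_l2 ?P "\<lambda>z. dist_embed (fst z) - mX"
    by (rule centered_l2_compose[OF PXY.prob_space_axioms measurable_fst d1 f])
  interpret gy: centered_l2 ?P "\<lambda>z. dist_embed (snd z) - mY"
    by (rule centered_l2_compose[OF PXY.prob_space_axioms measurable_snd d2 g])
  have AB: "(\<integral>z. (norm (?H z))\<^sup>2 \<partial>?P) = A * B"
    unfolding A_def B_def by (rule centered_l2_tensor[OF f g])
  have fA: "(\<integral>z. (norm (dist_embed (fst z) - mX))\<^sup>2 \<partial>?P) = A"
    unfolding A_def by (rule centered_l2_compose[OF PXY.prob_space_axioms measurable_fst d1 f])
  have gB: "(\<integral>z. (norm (dist_embed (snd z) - mY))\<^sup>2 \<partial>?P) = B"
    unfolding B_def by (rule centered_l2_compose[OF PXY.prob_space_axioms measurable_snd d2 g])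
  define lam where "lam j = h.eigval j / (A * B)" for j
  have lam0: "0 \<le> lam j" for j using A B h.eigval_nonneg by (simp add: lam_def)
  have lam1: "lam sums 1"
    using sums_divide[OF h.eigval_sums, of "A * B"] A B unfolding AB lam_def by simp
  let ?stat = "\<lambda>n \<omega>. test_stat n (\<lambda>k. fst (\<omega> k :: (real ^ 'p) \<times> (real ^ 'q))) (\<lambda>k. snd (\<omega> k))"
  let ?lim = "\<lambda>n \<omega>. (norm (h.scaled_sum n \<omega>))\<^sup>2 / (A * B)"
  let ?\<alpha> = "\<lambda>n \<omega>. fx.mean_sq_dist n \<omega>" and ?\<beta> = "\<lambda>n \<omega>. gy.mean_sq_dist n \<omega>"
  define D where "D n \<omega> = (1 / sqrt (real n)) *\<^sub>R tensor (fx.scaled_sum n \<omega>) (gy.scaled_sum n \<omega>)" for n \<omega>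
  have stat: "?stat n \<omega> = 4 * (norm (h.scaled_sum n \<omega> - D n \<omega>))\<^sup>2 / (?\<alpha> n \<omega> * ?\<beta> n \<omega>)" if n: "0 < n" for n \<omega>
  proof -
    have "D n \<omega> = sqrt n *\<^sub>R tensor ((1 / real n) *\<^sub>R (\<Sum>k=1..n. dist_embed (fst (\<omega> k)) - mX))
        ((1 / real n) *\<^sub>R (\<Sum>k=1..n. dist_embed (snd (\<omega> k)) - mY))"
      using n by (simp add: D_def fx.scaled_sum_def gy.scaled_sum_def tensor_linear field_simps)
    moreover have "S2 n (\<lambda>k. fst (\<omega> k)) (\<lambda>k. snd (\<omega> k)) = ?\<alpha> n \<omega> * ?\<beta> n \<omega>"
      by (simp add: S2_def fx.mean_sq_dist_def gy.mean_sq_dist_def norm_dist_embed_diff)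
    ultimately show ?thesis
      unfolding test_stat_def h.scaled_sum_def
      by (subst dcov_sq_tensor[OF n, of _ "\<lambda>k. dist_embed (fst (\<omega> k)) - mX" _ "\<lambda>k. dist_embed (snd (\<omega> k)) - mY"])
         (simp_all add: norm_dist_embed_diff)
  qed
  have nonneg: "0 \<le> ?\<alpha> n \<omega>" "0 \<le> ?\<beta> n \<omega>" for n \<omega>
    unfolding fx.mean_sq_dist_def gy.mean_sq_dist_def by (intro mult_nonneg_nonneg sum_nonneg; simp)+
  have meas_stat: "?stat n \<in> borel_measurable h.Om" if "0 < n" for n
  proof -
    have "l2_measurable h.Om (\<lambda>\<omega>. h.scaled_sum n \<omega> - D n \<omega>)"
      unfolding D_def by (intro l2_measurable_arith(2,3) l2_measurable_scaleR h.meas_scaled_sum fx.meas_scaled_sum gy.meas_scaled_sum)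
    from l2_measurable_norm[OF this]
    have m1: "(\<lambda>\<omega>. norm (h.scaled_sum n \<omega> - D n \<omega>)) \<in> borel_measurable h.Om" .
    have c: "(\<lambda>\<omega>. norm (h.scaled_sum n \<omega> - D n \<omega>)) \<in> borel_measurable h.Om \<Longrightarrow> ?thesis"
    proof -
      have "?\<alpha> n \<in> borel_measurable h.Om" "?\<beta> n \<in> borel_measurable h.Om"
        using Bochner_Integration.integrable_add[OF fx.mean_sq_dist_L1(1)[OF that] h.Om.integrable_const[of "2 * A"]]
          Bochner_Integration.integrable_add[OF gy.mean_sq_dist_L1(1)[OF that] h.Om.integrable_const[of "2 * B"]]
        by (simp_all add: fA gB)
      then show ?thesis using m1 unfolding stat[OF that] by measurable
    qed
    show ?thesis by (rule c[OF m1])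
  qed
  have close: "(\<lambda>n. (\<integral>\<omega>. exp (- (s * ?stat n \<omega>)) \<partial>h.Om) - (\<integral>\<omega>. exp (- (s * ?lim n \<omega>)) \<partial>h.Om)) \<longlonglongrightarrow> 0" if s: "0 \<le> s" for s
  proof (rule LIMSEQ_I)
    fix e :: real assume e: "0 < e"
    \<comment> \<open>by Markov, \<open>T\<^sub>n\<close> exceeds \<open>K\<close> with probability at most \<open>e / 8\<close>\<close>
    define K where "K = sqrt (8 * (A * B) / e)"
    have K: "0 < K" "A * B / K\<^sup>2 = e / 8" using A B e by (simp_all add: K_def)
    define r where "r = e / (4 * (s + 1))"
    have r: "0 < r" using e s by (simp add: r_def)
    have "s * r \<le> (s + 1) * r" using r by (simp add: mult_right_mono)
    also have "(s + 1) * r = e / 4" using s by (auto simp: r_def divide_simps)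
    finally have sr: "s * r \<le> e / 4" .
    obtain d where d: "0 < d" "\<And>t t' a b. 0 \<le> t \<Longrightarrow> t \<le> K \<Longrightarrow> \<bar>t' - t\<bar> \<le> d \<Longrightarrow> \<bar>a - 2 * A\<bar> \<le> d \<Longrightarrow> \<bar>b - 2 * B\<bar> \<le> d \<Longrightarrow>
        \<bar>4 * t'\<^sup>2 / (a * b) - t\<^sup>2 / (A * B)\<bar> \<le> r"
      using ratio_uniformly_close[OF A B r, of K] by blast
    let ?B1 = "\<lambda>n. {\<omega> \<in> space h.Om. K\<^sup>2 < \<bar>(norm (h.scaled_sum n \<omega>))\<^sup>2\<bar>}"
    let ?B2 = "\<lambda>n. {\<omega> \<in> space h.Om. 2 * sqrt n * d < \<bar>(norm (fx.scaled_sum n \<omega>))\<^sup>2 + (norm (gy.scaled_sum n \<omega>))\<^sup>2\<bar>}"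
    let ?B3 = "\<lambda>n. {\<omega> \<in> space h.Om. d < \<bar>?\<alpha> n \<omega> - 2 * A\<bar>}"
    let ?B4 = "\<lambda>n. {\<omega> \<in> space h.Om. d < \<bar>?\<beta> n \<omega> - 2 * B\<bar>}"
    let ?b = "\<lambda>n. (A + B) / (2 * sqrt n * d) + ((\<integral>\<omega>. \<bar>?\<alpha> n \<omega> - 2 * A\<bar> \<partial>h.Om) / d + (\<integral>\<omega>. \<bar>?\<beta> n \<omega> - 2 * B\<bar> \<partial>h.Om) / d)"
    have bound: "\<bar>(\<integral>\<omega>. exp (- (s * ?stat n \<omega>)) \<partial>h.Om) - (\<integral>\<omega>. exp (- (s * ?lim n \<omega>)) \<partial>h.Om)\<bar> \<le> e / 4 + (e / 8 + ?b n)"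
      if n: "0 < n" for n
    proof -
      have I2: "integrable h.Om (\<lambda>\<omega>. (norm (fx.scaled_sum n \<omega>))\<^sup>2 + (norm (gy.scaled_sum n \<omega>))\<^sup>2)"
        by (intro Bochner_Integration.integrable_add fx.int_norm_scaled_sum gy.int_norm_scaled_sum n)
      have I3: "integrable h.Om (\<lambda>\<omega>. ?\<alpha> n \<omega> - 2 * A)" "integrable h.Om (\<lambda>\<omega>. ?\<beta> n \<omega> - 2 * B)"
        using fx.mean_sq_dist_L1(1)[OF n] gy.mean_sq_dist_L1(1)[OF n] by (simp_all only: fA gB)
      note [measurable] = borel_measurable_integrable[OF h.int_norm_scaled_sum[OF n]] borel_measurable_integrable[OF I2]
        borel_measurable_integrable[OF I3(1)] borel_measurable_integrable[OF I3(2)]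
      have ev: "?B1 n \<in> h.Om.events" "?B2 n \<in> h.Om.events" "?B3 n \<in> h.Om.events" "?B4 n \<in> h.Om.events"
        by measurable
      have p1: "h.Om.prob (?B1 n) \<le> e / 8"
        using h.Om.markov_abs[OF h.int_norm_scaled_sum[OF n], of "K\<^sup>2"] K by (simp add: h.norm_scaled_sum[OF n] AB)
      have p2: "h.Om.prob (?B2 n) \<le> (A + B) / (2 * sqrt n * d)"
        using h.Om.markov_abs[OF I2, of "2 * sqrt n * d"] d(1) n fx.norm_scaled_sum[OF n] gy.norm_scaled_sum[OF n]
          fx.int_norm_scaled_sum[OF n] gy.int_norm_scaled_sum[OF n] by (simp add: fA gB)
      have p3: "h.Om.prob (?B3 n) \<le> (\<integral>\<omega>. \<bar>?\<alpha> n \<omega> - 2 * A\<bar> \<partial>h.Om) / d" by (rule h.Om.markov_abs[OF I3(1) d(1)])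
      have p4: "h.Om.prob (?B4 n) \<le> (\<integral>\<omega>. \<bar>?\<beta> n \<omega> - 2 * B\<bar> \<partial>h.Om) / d" by (rule h.Om.markov_abs[OF I3(2) d(1)])
      let ?bad = "?B1 n \<union> (?B2 n \<union> (?B3 n \<union> ?B4 n))"
      have "h.Om.prob ?bad \<le> h.Om.prob (?B1 n) + (h.Om.prob (?B2 n) + (h.Om.prob (?B3 n) + h.Om.prob (?B4 n)))"
        by (intro order_trans[OF measure_Un_le] add_left_mono ev sets.Un order_refl)
      also have "\<dots> \<le> e / 8 + ?b n" using p1 p2 p3 p4 by linarith
      finally have pb: "h.Om.prob ?bad \<le> e / 8 + ?b n" .
      have "\<bar>(\<integral>\<omega>. exp (- (s * ?stat n \<omega>)) \<partial>h.Om) - (\<integral>\<omega>. exp (- (s * ?lim n \<omega>)) \<partial>h.Om)\<bar> \<le> s * r + h.Om.prob ?bad"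
      proof (rule h.Om.laplace_close[OF meas_stat[OF n]])
        show "?lim n \<in> borel_measurable h.Om" by measurable
        show "?bad \<in> h.Om.events" by (intro sets.Un ev)
        show "0 \<le> ?stat n \<omega>" for \<omega> unfolding stat[OF n] using nonneg by simp
        show "0 \<le> ?lim n \<omega>" for \<omega> using A B by simp
        fix \<omega> assume w: "\<omega> \<in> space h.Om" "\<omega> \<notin> ?bad"
        have t: "norm (h.scaled_sum n \<omega>) \<le> K"
        proof (rule power2_le_imp_le)
          show "(norm (h.scaled_sum n \<omega>))\<^sup>2 \<le> K\<^sup>2" using w by (simp add: not_less)
        qed (use K(1) in simp)
        have "2 * (norm (fx.scaled_sum n \<omega>) * norm (gy.scaled_sum n \<omega>)) \<le> (norm (fx.scaled_sum n \<omega>))\<^sup>2 + (norm (gy.scaled_sum n \<omega>))\<^sup>2"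
          using zero_le_power2[of "norm (fx.scaled_sum n \<omega>) - norm (gy.scaled_sum n \<omega>)"] by (simp add: power2_diff)
        also have "\<dots> \<le> 2 * sqrt n * d" using w by (auto simp: not_less)
        finally have "norm (fx.scaled_sum n \<omega>) * norm (gy.scaled_sum n \<omega>) \<le> sqrt n * d" by simp
        then have "norm (D n \<omega>) \<le> d" using n by (simp add: D_def norm_tensor field_simps)
        then have dt: "\<bar>norm (h.scaled_sum n \<omega> - D n \<omega>) - norm (h.scaled_sum n \<omega>)\<bar> \<le> d"
          using norm_triangle_ineq3[of "h.scaled_sum n \<omega> - D n \<omega>" "h.scaled_sum n \<omega>"] by simp
        show "\<bar>?stat n \<omega> - ?lim n \<omega>\<bar> \<le> r"
          unfolding stat[OF n] using w by (intro d(2) t dt) (auto simp: not_less)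
      qed (use s r in auto)
      then show ?thesis using pb sr by linarith
    qed
    have "(\<lambda>n. (A + B) / (2 * sqrt (real n) * d)) \<longlonglongrightarrow> 0"
    proof -
      have "(\<lambda>n. ((A + B) / (2 * d)) / sqrt (real n)) \<longlonglongrightarrow> 0"
        by (intro tendsto_divide_0[OF tendsto_const] filterlim_at_top_imp_at_infinity
            filterlim_compose[OF sqrt_at_top filterlim_real_sequentially])
      then show ?thesis by (simp add: field_simps)
    qed
    then have "?b \<longlonglongrightarrow> 0 + (0 / d + 0 / d)"
      using fx.mean_sq_dist_L1(2) gy.mean_sq_dist_L1(2) d(1) unfolding fA gB
      by (intro tendsto_add tendsto_divide tendsto_const) auto
    then have "eventually (\<lambda>n. ?b n < e / 8) sequentially"
      using e by (intro order_tendstoD(2)[where y = 0]) auto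
    then obtain n0 where n0: "\<And>n. n \<ge> n0 \<Longrightarrow> ?b n < e / 8" unfolding eventually_sequentially by blast
    show "\<exists>no. \<forall>n\<ge>no. norm ((\<integral>\<omega>. exp (- (s * ?stat n \<omega>)) \<partial>h.Om) - (\<integral>\<omega>. exp (- (s * ?lim n \<omega>)) \<partial>h.Om) - 0) < e"
    proof (intro exI[of _ "Suc n0"] allI impI)
      fix n assume "Suc n0 \<le> n"
      then show "norm ((\<integral>\<omega>. exp (- (s * ?stat n \<omega>)) \<partial>h.Om) - (\<integral>\<omega>. exp (- (s * ?lim n \<omega>)) \<partial>h.Om) - 0) < e"
        using bound[of n] n0[of n] e unfolding real_norm_def diff_0_right by linarith
    qed
  qed
  have main: "(\<lambda>n. \<integral>\<omega>. exp (- (s * ?stat n \<omega>)) \<partial>h.Om) \<longlonglongrightarrow> (\<integral>w. exp (- (s * (\<Sum>j. lam j * (w j)\<^sup>2))) \<partial>std_normals UNIV)"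
    if s: "0 \<le> s" for s
  proof -
    have "(\<integral>w. exp (- (s * (\<Sum>j. lam j * (w j)\<^sup>2))) \<partial>std_normals UNIV) =
      (\<integral>w. exp (- (s / (A * B) * (\<Sum>j. h.eigval j * (w j)\<^sup>2))) \<partial>std_normals UNIV)"
    proof (rule integral_cong_AE)
      show "AE w in std_normals UNIV. exp (- (s * (\<Sum>j. lam j * (w j)\<^sup>2))) = exp (- (s / (A * B) * (\<Sum>j. h.eigval j * (w j)\<^sup>2)))"
        using chi_square_mixture(1)[OF h.eigval_nonneg sums_summable[OF h.eigval_sums]]
      proof eventually_elim
        case (elim w)
        show ?case using suminf_divide[OF elim, of "A * B"] by (simp add: lam_def)
      qed
    qed measurable
    moreover have "(\<lambda>n. \<integral>\<omega>. exp (- (s / (A * B) * (norm (h.scaled_sum n \<omega>))\<^sup>2)) \<partial>h.Om) \<longlonglongrightarrow>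
      (\<integral>w. exp (- (s / (A * B) * (\<Sum>j. h.eigval j * (w j)\<^sup>2))) \<partial>std_normals UNIV)"
      using s A B by (intro h.laplace_norm_scaled_sum) simp
    ultimately show ?thesis
      using tendsto_add[OF close[OF s]] by (fastforce simp: field_simps)
  qed
  show ?thesis
    using lam0 lam1 main unfolding h.Om_def by blast
qed

section \<open>Half-space probabilities determine a measure\<close>

lemma nn_integral_gauss_lborel_finite:
  "(\<integral>\<^sup>+u. ennreal (exp (- (norm (u::'a::euclidean_space))\<^sup>2)) \<partial>lborel) < \<infinity>"
proof -
  have one: "(\<integral>\<^sup>+t. ennreal (exp (- t\<^sup>2)) \<partial>lborel) < \<infinity>"
  proof -
    have "exp (- t\<^sup>2) \<le> sqrt (2 * pi) * std_normal_density t" for t :: real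
      by (simp add: std_normal_density_def)
    then have "(\<integral>\<^sup>+t. ennreal (exp (- t\<^sup>2)) \<partial>lborel) \<le> (\<integral>\<^sup>+t. ennreal (sqrt (2 * pi) * std_normal_density t) \<partial>lborel)"
      by (intro nn_integral_mono ennreal_leI)
    also have "\<dots> < \<infinity>"
      by (subst nn_integral_eq_integral) (auto intro!: integrable_mult_right)
    finally show ?thesis .
  qed
  interpret product_sigma_finite "\<lambda>_. lborel :: real measure" ..
  have eq: "exp (- (norm (\<Sum>b\<in>Basis. f b *\<^sub>R b :: 'a))\<^sup>2) = (\<Prod>b\<in>(Basis::'a set). exp (- (f b)\<^sup>2))" for f
  proof -
    have "(norm (\<Sum>b\<in>Basis. f b *\<^sub>R b :: 'a))\<^sup>2 = (\<Sum>b\<in>(Basis::'a set). (f b)\<^sup>2)"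
      unfolding power2_norm_eq_inner by (subst euclidean_inner) (simp add: power2_eq_square)
    then show ?thesis by (simp add: exp_sum[symmetric] sum_negf)
  qed
  have "(\<integral>\<^sup>+u. ennreal (exp (- (norm (u::'a))\<^sup>2)) \<partial>lborel) =
     (\<integral>\<^sup>+f. ennreal (\<Prod>b\<in>Basis. exp (- (f b)\<^sup>2)) \<partial>(\<Pi>\<^sub>M b\<in>(Basis::'a set). lborel))"
    by (subst lborel_eq, subst nn_integral_distr) (simp_all add: eq)
  also have "\<dots> = (\<integral>\<^sup>+f. (\<Prod>b\<in>Basis. ennreal (exp (- (f b)\<^sup>2))) \<partial>(\<Pi>\<^sub>M b\<in>(Basis::'a set). lborel))"
    by (simp add: prod_ennreal)
  also have "\<dots> = (\<Prod>b\<in>(Basis::'a set). \<integral>\<^sup>+t. ennreal (exp (- t\<^sup>2)) \<partial>lborel)"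
    by (rule product_nn_integral_prod) auto
  also have "\<dots> < \<infinity>" using one by (simp add: less_top[symmetric] ennreal_prod_eq_top power_eq_top_ennreal)
  finally show ?thesis .
qed

lemma gauss_kernel_lborel_shift:
  fixes z :: "'a::euclidean_space"
  assumes r: "0 < r" and [measurable]: "f \<in> borel_measurable borel"
  shows "(\<integral>\<^sup>+a. f a * ennreal (exp (- r\<^sup>2 * (norm (z - a))\<^sup>2)) \<partial>lborel) =
    ennreal ((1 / r) ^ DIM('a)) * (\<integral>\<^sup>+u. f (z + (1 / r) *\<^sub>R u) * ennreal (exp (- (norm u)\<^sup>2)) \<partial>lborel)"
proof -
  have L: "lborel = density (distr lborel borel (\<lambda>x. z + (1 / r) *\<^sub>R x)) (\<lambda>_. ennreal ((1 / r) ^ DIM('a)))"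
    using lborel_affine[of "1 / r" z] r by simp
  have "(\<integral>\<^sup>+a. f a * ennreal (exp (- r\<^sup>2 * (norm (z - a))\<^sup>2)) \<partial>lborel) =
    (\<integral>\<^sup>+u. ennreal ((1 / r) ^ DIM('a)) * (f (z + (1 / r) *\<^sub>R u) * ennreal (exp (- (norm u)\<^sup>2))) \<partial>lborel)"
    using r by (subst L, subst nn_integral_density, simp, simp, subst nn_integral_distr)
       (simp_all add: power_divide)
  then show ?thesis by (simp add: nn_integral_cmult)
qed

text \<open>
Integrating the Gaussian kernels \<open>exp (- r\<^sup>2 \<bar>z - a\<bar>\<^sup>2)\<close> against \<open>f a\<close> over all centers \<open>a\<close> gives, after
rescaling, an average of \<open>f\<close> near \<open>z\<close>, which tends to a constant multiple of \<open>f z\<close> as \<open>r\<close> grows.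
Hence the integrals of bounded continuous functions agree, and indicators of open sets are limits of
such functions.
\<close>

lemma finite_measure_eqI_gauss_kernel:
  fixes \<mu> \<nu> :: "'a::euclidean_space measure"
  assumes fm: "finite_measure \<mu>" "finite_measure \<nu>" and sets: "sets \<mu> = sets borel" "sets \<nu> = sets borel"
    and eq: "\<And>r a. 0 < r \<Longrightarrow> (\<integral>\<^sup>+z. ennreal (exp (- r\<^sup>2 * (norm (z - a))\<^sup>2)) \<partial>\<mu>) = (\<integral>\<^sup>+z. ennreal (exp (- r\<^sup>2 * (norm (z - a))\<^sup>2)) \<partial>\<nu>)"
  shows "\<mu> = \<nu>"
proof -
  interpret \<mu>: finite_measure \<mu> by (rule fm)
  interpret \<nu>: finite_measure \<nu> by (rule fm)
  note [measurable_cong] = sets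
  define K where "K = (\<integral>\<^sup>+u. ennreal (exp (- (norm (u::'a))\<^sup>2)) \<partial>lborel)"
  have K: "K < \<infinity>" unfolding K_def by (rule nn_integral_gauss_lborel_finite)
  have K0: "K \<noteq> 0"
  proof
    assume "K = 0"
    then have "AE u in lborel. ennreal (exp (- (norm (u::'a))\<^sup>2)) = 0"
      unfolding K_def by (subst (asm) nn_integral_0_iff_AE) auto
    then have "AE u::'a in lborel. False" by (rule eventually_mono) (auto simp: ennreal_eq_0_iff not_le)
    then show False by (simp add: AE_iff_measurable[OF _ refl])
  qed
  define G where "G f n z = (\<integral>\<^sup>+u. ennreal (f (z + (1 / real (Suc n)) *\<^sub>R u)) * ennreal (exp (- (norm u)\<^sup>2)) \<partial>lborel)"
    for f :: "'a \<Rightarrow> real" and n z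
  have int_eq: "(\<integral>\<^sup>+z. ennreal (f z) \<partial>\<mu>) = (\<integral>\<^sup>+z. ennreal (f z) \<partial>\<nu>)"
    if f: "continuous_on UNIV f" "\<And>z. 0 \<le> f z" "\<And>z. f z \<le> 1" for f :: "'a \<Rightarrow> real"
  proof -
    have f_meas [measurable]: "f \<in> borel_measurable borel" by (rule borel_measurable_continuous_onI[OF f(1)])
    have lim: "(\<lambda>n. \<integral>\<^sup>+z. G f n z \<partial>M) \<longlonglongrightarrow> K * (\<integral>\<^sup>+z. ennreal (f z) \<partial>M)"
      if M: "finite_measure M" "sets M = sets borel" for M
    proof -
      interpret M: finite_measure M by (rule M)
      note [measurable_cong] = M(2)
      have pt: "(\<lambda>n. G f n z) \<longlonglongrightarrow> ennreal (f z) * K" for z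
      proof -
        have "(\<lambda>n. G f n z) \<longlonglongrightarrow> (\<integral>\<^sup>+u. ennreal (f z) * ennreal (exp (- (norm (u::'a))\<^sup>2)) \<partial>lborel)"
          unfolding G_def
        proof (rule nn_integral_dominated_convergence[where w = "\<lambda>u. ennreal (exp (- (norm u)\<^sup>2))"])
          show "AE u in lborel. ennreal (f (z + (1 / real (Suc n)) *\<^sub>R u)) * ennreal (exp (- (norm u)\<^sup>2)) \<le> ennreal (exp (- (norm u)\<^sup>2))" for n
            using f(2,3) by (auto simp: ennreal_mult'[symmetric] mult_left_le_one_le intro!: ennreal_leI)
          show "AE u in lborel. (\<lambda>n. ennreal (f (z + (1 / real (Suc n)) *\<^sub>R u)) * ennreal (exp (- (norm u)\<^sup>2))) \<longlonglongrightarrow>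
             ennreal (f z) * ennreal (exp (- (norm u)\<^sup>2))"
          proof (rule AE_I2)
            fix u :: 'a
            have "(\<lambda>n. z + (1 / real (Suc n)) *\<^sub>R u) \<longlonglongrightarrow> z + 0 *\<^sub>R u"
              using LIMSEQ_inverse_real_of_nat by (intro tendsto_intros) (simp add: inverse_eq_divide)
            then have "(\<lambda>n. z + (1 / real (Suc n)) *\<^sub>R u) \<longlonglongrightarrow> z" by simp
            then have fl: "(\<lambda>n. f (z + (1 / real (Suc n)) *\<^sub>R u)) \<longlonglongrightarrow> f z"
              using continuous_on_tendsto_compose[OF f(1), of "\<lambda>n. z + (1 / real (Suc n)) *\<^sub>R u" z sequentially] by simp
            have "(\<lambda>n. ennreal (f (z + (1 / real (Suc n)) *\<^sub>R u) * exp (- (norm u)\<^sup>2))) \<longlonglongrightarrow> ennreal (f z * exp (- (norm u)\<^sup>2))"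
              by (intro tendsto_ennrealI tendsto_mult fl tendsto_const)
            then show "(\<lambda>n. ennreal (f (z + (1 / real (Suc n)) *\<^sub>R u)) * ennreal (exp (- (norm u)\<^sup>2))) \<longlonglongrightarrow>
               ennreal (f z) * ennreal (exp (- (norm u)\<^sup>2))"
              using f(2) by (simp add: ennreal_mult)
          qed
        qed (use nn_integral_gauss_lborel_finite in auto)
        then show ?thesis by (simp add: nn_integral_cmult K_def)
      qed
      have [measurable]: "G f n \<in> borel_measurable borel" for n unfolding G_def by measurable
      have "(\<lambda>n. \<integral>\<^sup>+z. G f n z \<partial>M) \<longlonglongrightarrow> (\<integral>\<^sup>+z. ennreal (f z) * K \<partial>M)"
      proof (rule nn_integral_dominated_convergence[where w = "\<lambda>_. K"])
        show "AE z in M. G f n z \<le> K" for n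
          unfolding G_def K_def using f(2,3)
          by (intro AE_I2 nn_integral_mono) (auto simp: ennreal_mult'[symmetric] mult_left_le_one_le intro!: ennreal_leI)
        show "(\<integral>\<^sup>+z. K \<partial>M) < \<infinity>"
          using K M.emeasure_finite by (simp add: ennreal_mult_eq_top_iff less_top[symmetric])
      qed (use pt in auto)
      moreover have "(\<lambda>z. ennreal (f z)) \<in> borel_measurable M" by measurable
      ultimately show ?thesis by (simp add: nn_integral_multc mult.commute[of K])
    qed
    have "(\<integral>\<^sup>+z. G f n z \<partial>\<mu>) = (\<integral>\<^sup>+z. G f n z \<partial>\<nu>)" for n
    proof -
      define r where "r = real (Suc n)"
      have r: "0 < r" by (simp add: r_def)
      let ?c = "ennreal ((1 / r) ^ DIM('a))"
      have swap: "?c * (\<integral>\<^sup>+z. G f n z \<partial>M) = (\<integral>\<^sup>+a. ennreal (f a) * (\<integral>\<^sup>+z. ennreal (exp (- r\<^sup>2 * (norm (z - a))\<^sup>2)) \<partial>M) \<partial>lborel)"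
        if M: "finite_measure M" "sets M = sets borel" for M
      proof -
        interpret M: finite_measure M by (rule M)
        note [measurable_cong] = M(2)
        interpret pair_sigma_finite M "lborel :: 'a measure" ..
        have [measurable]: "G f n \<in> borel_measurable borel" unfolding G_def by measurable
        have "?c * (\<integral>\<^sup>+z. G f n z \<partial>M) = (\<integral>\<^sup>+z. ?c * G f n z \<partial>M)" by (rule nn_integral_cmult[symmetric]) measurable
        also have "\<dots> = (\<integral>\<^sup>+z. (\<integral>\<^sup>+a. ennreal (f a) * ennreal (exp (- r\<^sup>2 * (norm (z - a))\<^sup>2)) \<partial>lborel) \<partial>M)"
        proof (rule nn_integral_cong)
          fix z
          have "(\<integral>\<^sup>+a. ennreal (f a) * ennreal (exp (- r\<^sup>2 * (norm (z - a))\<^sup>2)) \<partial>lborel) = ?c * G f n z"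
            unfolding G_def r_def by (rule gauss_kernel_lborel_shift) (simp, measurable)
          then show "?c * G f n z = (\<integral>\<^sup>+a. ennreal (f a) * ennreal (exp (- r\<^sup>2 * (norm (z - a))\<^sup>2)) \<partial>lborel)" ..
        qed
        also have "\<dots> = (\<integral>\<^sup>+a. (\<integral>\<^sup>+z. ennreal (f a) * ennreal (exp (- r\<^sup>2 * (norm (z - a))\<^sup>2)) \<partial>M) \<partial>lborel)"
          by (rule Fubini'[symmetric]) measurable
        also have "\<dots> = (\<integral>\<^sup>+a. ennreal (f a) * (\<integral>\<^sup>+z. ennreal (exp (- r\<^sup>2 * (norm (z - a))\<^sup>2)) \<partial>M) \<partial>lborel)"
          by (intro nn_integral_cong nn_integral_cmult) measurable
        finally show ?thesis .
      qed
      have "?c * (\<integral>\<^sup>+z. G f n z \<partial>\<mu>) = ?c * (\<integral>\<^sup>+z. G f n z \<partial>\<nu>)"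
        unfolding swap[OF fm(1) sets(1)] swap[OF fm(2) sets(2)] eq[OF r] ..
      then show ?thesis using r by (simp add: ennreal_mult_cancel_left)
    qed
    then have "K * (\<integral>\<^sup>+z. ennreal (f z) \<partial>\<mu>) = K * (\<integral>\<^sup>+z. ennreal (f z) \<partial>\<nu>)"
      using lim[OF fm(1) sets(1)] lim[OF fm(2) sets(2)] LIMSEQ_unique by simp
    then show ?thesis using K K0 by (auto simp: ennreal_mult_cancel_left)
  qed
  have opn: "emeasure \<mu> U = emeasure \<nu> U" if U: "open U" for U
  proof (cases "U = UNIV")
    case True
    then show ?thesis
      using int_eq[of "\<lambda>_. 1"] sets_eq_imp_space_eq[OF sets(1)] sets_eq_imp_space_eq[OF sets(2)] by simp
  next
    case False
    define f where "f k x = min 1 (real k * infdist x (- U))" for k :: nat and x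
    have fk: "continuous_on UNIV (f k)" "0 \<le> f k x" "f k x \<le> 1" for k x
      unfolding f_def by (auto intro!: continuous_intros mult_nonneg_nonneg infdist_nonneg)
    have fl: "(\<lambda>k. f k x) \<longlonglongrightarrow> indicator U x" for x
    proof (cases "x \<in> U")
      case True
      have "infdist x (- U) \<noteq> 0"
        using True False U in_closed_iff_infdist_zero[of "- U" x] by auto
      then have p: "0 < infdist x (- U)" using infdist_nonneg[of x "- U"] by simp
      obtain k0 :: nat where "1 / infdist x (- U) \<le> real k0" using real_arch_simple by blast
      then have k0: "1 \<le> real k0 * infdist x (- U)" using p by (simp add: field_simps)
      have "\<forall>\<^sub>F k in sequentially. f k x = 1"
      proof (rule eventually_sequentiallyI[of k0])
        fix k assume "k0 \<le> k"
        then have "real k0 * infdist x (- U) \<le> real k * infdist x (- U)" using p by (intro mult_right_mono) auto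
        then show "f k x = 1" using k0 by (simp add: f_def)
      qed
      then show ?thesis using True by (simp add: tendsto_eventually)
    next
      case x: False
      then have "f k x = 0" for k by (simp add: f_def)
      then show ?thesis using x by simp
    qed
    have lim: "(\<lambda>k. \<integral>\<^sup>+x. ennreal (f k x) \<partial>M) \<longlonglongrightarrow> emeasure M U" if M: "finite_measure M" "sets M = sets borel" for M
    proof -
      interpret M: finite_measure M by (rule M)
      note [measurable_cong] = M(2)
      have [measurable]: "f k \<in> borel_measurable borel" for k by (rule borel_measurable_continuous_onI[OF fk(1)])
      have "(\<lambda>k. \<integral>\<^sup>+x. ennreal (f k x) \<partial>M) \<longlonglongrightarrow> (\<integral>\<^sup>+x. ennreal (indicator U x) \<partial>M)"
      proof (rule nn_integral_dominated_convergence[where w = "\<lambda>_. 1"])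
        show "AE x in M. (\<lambda>k. ennreal (f k x)) \<longlonglongrightarrow> ennreal (indicator U x)"
          by (intro AE_I2 tendsto_ennrealI fl)
        show "(\<lambda>x. ennreal (indicat_real U x)) \<in> borel_measurable M"
          using borel_open[OF U] by (intro measurable_compose[OF _ measurable_ennreal] borel_measurable_indicator) (simp add: M(2))
      qed (use fk M.emeasure_finite in \<open>auto simp: less_top[symmetric] intro!: ennreal_leI[of _ 1, simplified]\<close>)
      then show ?thesis using U M(2) by (simp add: ennreal_indicator)
    qed
    show ?thesis
      using lim[OF fm(1) sets(1)] lim[OF fm(2) sets(2)] int_eq[OF fk] LIMSEQ_unique by simp
  qed
  show ?thesis
  proof (rule measure_eqI_generator_eq[where E = "{U. open U}" and \<Omega> = UNIV and A = "\<lambda>_. UNIV"])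
    show "Int_stable {U :: 'a set. open U}" by (auto simp: Int_stable_def)
    show "sets \<mu> = sigma_sets UNIV {U. open U}" "sets \<nu> = sigma_sets UNIV {U. open U}"
      unfolding sets borel_def by simp_all
    show "emeasure \<mu> UNIV \<noteq> \<infinity>" using \<mu>.emeasure_finite by simp
  qed (auto intro: opn)
qed

text \<open>
Every \<open>t\<close> is a limit from the right of points where the tails agree, and tails are continuous from
the right.
\<close>

lemma real_finite_measure_eqI_AE:
  fixes \<mu> \<nu> :: "real measure"
  assumes fm: "finite_measure \<mu>" "finite_measure \<nu>" and sets: "sets \<mu> = sets borel" "sets \<nu> = sets borel"
    and ae: "AE t in lborel. emeasure \<mu> {t<..} = emeasure \<nu> {t<..}"
  shows "\<mu> = \<nu>"
proof -
  interpret \<mu>: finite_measure \<mu> by (rule fm)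
  interpret \<nu>: finite_measure \<nu> by (rule fm)
  have dense: "\<exists>t'. t < t' \<and> t' < t + e \<and> emeasure \<mu> {t'<..} = emeasure \<nu> {t'<..}" if "0 < e" for t e :: real
  proof (rule ccontr)
    assume "\<not> ?thesis"
    then have "AE x in lborel. x \<notin> {t<..<t + e}" using ae by (auto elim!: eventually_mono)
    moreover have "{x \<in> space lborel. \<not> x \<notin> {t<..<t + e}} = {t<..<t + e}" by auto
    ultimately have "emeasure lborel {t<..<t + e} = 0"
      using AE_iff_measurable[of "{t<..<t + e}" lborel "\<lambda>x. x \<notin> {t<..<t + e}"] by simp
    then show False using that by simp
  qed
  have all: "emeasure \<mu> {t<..} = emeasure \<nu> {t<..}" for t
  proof -
    have "\<exists>t'. t < t' \<and> t' < t + 1 / real (Suc n) \<and> emeasure \<mu> {t'<..} = emeasure \<nu> {t'<..}" for n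
      using dense[of "1 / real (Suc n)" t] by simp
    then obtain s where s: "\<And>n. t < s n" "\<And>n. s n < t + 1 / real (Suc n)" "\<And>n. emeasure \<mu> {s n<..} = emeasure \<nu> {s n<..}"
      by metis
    have "(\<lambda>n. t + 1 / real (Suc n)) \<longlonglongrightarrow> t + 0"
      using LIMSEQ_inverse_real_of_nat by (intro tendsto_intros) (simp add: inverse_eq_divide)
    then have sl: "s \<longlonglongrightarrow> t"
      using s(1,2) by (intro tendsto_sandwich[OF _ _ tendsto_const, of t s]) (auto intro: less_imp_le always_eventually)
    have ptw: "(\<lambda>n. ennreal (indicator {s n<..} x)) \<longlonglongrightarrow> ennreal (indicator {t<..} x)" for x
    proof (cases "t < x")
      case True
      then have "\<forall>\<^sub>F n in sequentially. s n < x" using sl by (rule order_tendstoD(2)[rotated])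
      then have "\<forall>\<^sub>F n in sequentially. ennreal (indicator {s n<..} x) = ennreal (indicator {t<..} x)"
        using True by (auto elim!: eventually_mono)
      then show ?thesis by (rule tendsto_eventually)
    next
      case False
      then have "\<not> s n < x" for n using s(1)[of n] by simp
      then show ?thesis using False by simp
    qed
    have lim: "(\<lambda>n. emeasure M {s n<..}) \<longlonglongrightarrow> emeasure M {t<..}" if M: "finite_measure M" "sets M = sets borel" for M
    proof -
      interpret M: finite_measure M by (rule M)
      note [measurable_cong] = M(2)
      have "(\<lambda>n. \<integral>\<^sup>+x. ennreal (indicator {s n<..} x) \<partial>M) \<longlonglongrightarrow> (\<integral>\<^sup>+x. ennreal (indicator {t<..} x) \<partial>M)"
        by (rule nn_integral_dominated_convergence[where w = "\<lambda>_. 1"])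
           (use ptw M.emeasure_finite in \<open>auto simp: less_top[symmetric] indicator_def\<close>)
      then show ?thesis using M(2) by (simp add: ennreal_indicator)
    qed
    show ?thesis using lim[OF fm(1) sets(1)] lim[OF fm(2) sets(2)] s(3) LIMSEQ_unique by simp
  qed
  show ?thesis
  proof (rule measure_eqI_generator_eq[where E = "range greaterThan" and \<Omega> = UNIV and A = "\<lambda>n. {- real n<..}"])
    show "Int_stable (range greaterThan :: real set set)"
    proof -
      have "{a<..} \<inter> {b<..} = {max a b<..}" for a b :: real by auto
      then show ?thesis by (auto simp: Int_stable_def)
    qed
    have "sets (borel :: real measure) = sigma_sets UNIV (range greaterThan)"
      by (subst borel_Ioi) simp
    then show "sets \<mu> = sigma_sets UNIV (range greaterThan)" "sets \<nu> = sigma_sets UNIV (range greaterThan)"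
      by (simp_all add: sets)
    show "(\<Union>i. {- real i<..}) = UNIV"
    proof -
      have "\<exists>n. - x < real n" for x :: real using reals_Archimedean2 by blast
      then have "\<exists>n. - real n < x" for x :: real by (metis minus_less_iff)
      then show ?thesis by auto
    qed
    show "emeasure \<mu> {- real i<..} \<noteq> \<infinity>" for i using \<mu>.emeasure_finite by simp
  qed (auto intro: all)
qed

text \<open>
A Cramer-Wold theorem with exceptional null sets. For almost every direction \<open>g\<close> the projections of
the two measures agree on almost all upper half-lines and hence coincide. Their characteristic
functions then agree for almost all \<open>g\<close>, and averaging them over the Gaussian vector \<open>g\<close> produces the
integrals of all Gaussian kernels. The exceptional directions form a null set for the law of
\<open>g\<close>, over which the average is taken.
\<close>

theorem halfspace_measure_eqI:
  fixes \<mu> \<nu> :: "'a::euclidean_space measure"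
  assumes fm: "finite_measure \<mu>" "finite_measure \<nu>" and sets: "sets \<mu> = sets borel" "sets \<nu> = sets borel"
    and ae: "AE u in halfspaces. (\<integral>x. hs x u \<partial>\<mu>) = (\<integral>x. hs x u \<partial>\<nu>)"
  shows "\<mu> = \<nu>"
proof (rule finite_measure_eqI_gauss_kernel[OF fm sets])
  interpret \<mu>: finite_measure \<mu> by (rule fm)
  interpret \<nu>: finite_measure \<nu> by (rule fm)
  interpret G: prob_space "std_gauss :: 'a measure" by (rule prob_space_std_gauss)
  note [measurable_cong] = sets
  have sp: "space \<mu> = UNIV" "space \<nu> = UNIV" using sets_eq_imp_space_eq[OF sets(1)] sets_eq_imp_space_eq[OF sets(2)] by simp_all
  have int_hs: "(\<integral>x. hs x (g, t) \<partial>M) = measure (distr M borel (\<lambda>x. g \<bullet> x)) {t<..}"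
    if M: "finite_measure M" "sets M = sets borel" for M :: "'a measure" and g t
  proof -
    note [measurable_cong] = M(2)
    have sM: "space M = UNIV" using sets_eq_imp_space_eq[OF M(2)] by simp
    have "(\<integral>x. hs x (g, t) \<partial>M) = (\<integral>x. indicator {x. t < g \<bullet> x} x \<partial>M)"
      by (intro Bochner_Integration.integral_cong) (auto simp: hs_def indicator_def)
    also have "\<dots> = measure M ({x. t < g \<bullet> x} \<inter> space M)" by simp
    also have "\<dots> = measure (distr M borel (\<lambda>x. g \<bullet> x)) {t<..}"
      by (subst measure_distr) (auto simp: sM vimage_def)
    finally show ?thesis .
  qed
  have "AE g in std_gauss. AE t in lborel. (\<integral>x. hs x (g, t) \<partial>\<mu>) = (\<integral>x. hs x (g, t) \<partial>\<nu>)"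
  proof -
    interpret pair_sigma_finite "std_gauss :: 'a measure" lborel ..
    show ?thesis using ae unfolding halfspaces_def by (rule AE_pair)
  qed
  then have aeg: "AE g in std_gauss. distr \<mu> borel (\<lambda>x. g \<bullet> x) = distr \<nu> borel (\<lambda>x. g \<bullet> x)"
  proof eventually_elim
    case (elim g)
    have f: "finite_measure (distr \<mu> borel (\<lambda>x. g \<bullet> x))" "finite_measure (distr \<nu> borel (\<lambda>x. g \<bullet> x))"
      by (intro \<mu>.finite_measure_distr \<nu>.finite_measure_distr; measurable)+
    show ?case
    proof (rule real_finite_measure_eqI_AE[OF f])
      show "AE t in lborel. emeasure (distr \<mu> borel (\<lambda>x. g \<bullet> x)) {t<..} = emeasure (distr \<nu> borel (\<lambda>x. g \<bullet> x)) {t<..}"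
        using elim unfolding int_hs[OF fm(1) sets(1)] int_hs[OF fm(2) sets(2)]
        by eventually_elim (simp add: finite_measure.emeasure_eq_measure[OF f(1)] finite_measure.emeasure_eq_measure[OF f(2)])
    qed simp_all
  qed
  fix r :: real and a :: 'a assume r: "0 < r"
  \<comment> \<open>scaling by \<open>q\<close> turns the Gaussian factor \<open>1/2\<close> into the width \<open>r\<close>\<close>
  define q where "q = sqrt 2 * r"
  have q: "q\<^sup>2 / 2 = r\<^sup>2" by (simp add: q_def power_mult_distrib)
  define J where "J M g = (\<integral>z. iexp (g \<bullet> (q *\<^sub>R (z - a))) \<partial>M)" for M :: "'a measure" and g
  have rep: "complex_of_real (\<integral>z. exp (- r\<^sup>2 * (norm (z - a))\<^sup>2) \<partial>M) = (\<integral>g. J M g \<partial>std_gauss)"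
    and J_meas: "J M \<in> borel_measurable std_gauss"
    and J_distr: "J M g = (\<integral>s. iexp (q * (s - g \<bullet> a)) \<partial>distr M borel (\<lambda>x. g \<bullet> x))"
    if M: "finite_measure M" "sets M = sets borel" for M :: "'a measure" and g
  proof -
    interpret M: finite_measure M by (rule M)
    note [measurable_cong] = M(2)
    interpret P: pair_sigma_finite "std_gauss :: 'a measure" M ..
    show "J M \<in> borel_measurable std_gauss" unfolding J_def by measurable
    show "J M g = (\<integral>s. iexp (q * (s - g \<bullet> a)) \<partial>distr M borel (\<lambda>x. g \<bullet> x))"
      unfolding J_def by (subst integral_distr) (simp_all add: inner_diff_right)
    have "complex_of_real (\<integral>z. exp (- r\<^sup>2 * (norm (z - a))\<^sup>2) \<partial>M) = (\<integral>z. of_real (exp (- (norm (q *\<^sub>R (z - a)))\<^sup>2 / 2)) \<partial>M)"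
      unfolding integral_complex_of_real by (simp add: power_mult_distrib q flip: q times_divide_eq_left)
    also have "\<dots> = (\<integral>z. (\<integral>g. iexp (g \<bullet> (q *\<^sub>R (z - a))) \<partial>std_gauss) \<partial>M)" by (simp only: iexp_std_gauss)
    also have "\<dots> = (\<integral>g. (\<integral>z. iexp (g \<bullet> (q *\<^sub>R (z - a))) \<partial>M) \<partial>std_gauss)"
    proof (rule P.Fubini_integral)
      interpret F: finite_measure "(std_gauss :: 'a measure) \<Otimes>\<^sub>M M"
        by (rule finite_measure_pair_measure[OF M.finite_measure_axioms G.finite_measure_axioms])
      show "integrable (std_gauss \<Otimes>\<^sub>M M) (\<lambda>(g, z). iexp (g \<bullet> (q *\<^sub>R (z - a))))"
        by (rule F.integrable_const_bound[of _ 1]) (auto simp: case_prod_unfold)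
    qed
    finally show "complex_of_real (\<integral>z. exp (- r\<^sup>2 * (norm (z - a))\<^sup>2) \<partial>M) = (\<integral>g. J M g \<partial>std_gauss)" unfolding J_def .
  qed
  have "(\<integral>g. J \<mu> g \<partial>std_gauss) = (\<integral>g. J \<nu> g \<partial>std_gauss)"
  proof (rule integral_cong_AE[OF J_meas[OF fm(1) sets(1)] J_meas[OF fm(2) sets(2)]])
    show "AE g in std_gauss. J \<mu> g = J \<nu> g"
      using aeg by eventually_elim (simp only: J_distr[OF fm(1) sets(1)] J_distr[OF fm(2) sets(2)])
  qed
  then have "complex_of_real (\<integral>z. exp (- r\<^sup>2 * (norm (z - a))\<^sup>2) \<partial>\<mu>) = complex_of_real (\<integral>z. exp (- r\<^sup>2 * (norm (z - a))\<^sup>2) \<partial>\<nu>)"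
    unfolding rep[OF fm(1) sets(1)] rep[OF fm(2) sets(2)] .
  then have "(\<integral>z. exp (- r\<^sup>2 * (norm (z - a))\<^sup>2) \<partial>\<mu>) = (\<integral>z. exp (- r\<^sup>2 * (norm (z - a))\<^sup>2) \<partial>\<nu>)" by simp
  moreover have "integrable \<mu> (\<lambda>z. exp (- r\<^sup>2 * (norm (z - a))\<^sup>2))" "integrable \<nu> (\<lambda>z. exp (- r\<^sup>2 * (norm (z - a))\<^sup>2))"
    by (rule \<mu>.integrable_const_bound[of _ 1], auto) (rule \<nu>.integrable_const_bound[of _ 1], auto)
  ultimately show "(\<integral>\<^sup>+z. ennreal (exp (- r\<^sup>2 * (norm (z - a))\<^sup>2)) \<partial>\<mu>) = (\<integral>\<^sup>+z. ennreal (exp (- r\<^sup>2 * (norm (z - a))\<^sup>2)) \<partial>\<nu>)"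
    by (simp add: nn_integral_eq_integral)
qed

section \<open>Distance covariance as an integral over half-spaces\<close>

lemma (in finite_measure)
  fixes w :: "'a \<Rightarrow> real" and \<pi> :: "'a \<Rightarrow> 'b::euclidean_space"
  assumes [measurable]: "w \<in> borel_measurable M" "\<pi> \<in> borel_measurable M" and w: "\<And>x. 0 \<le> w x" "\<And>x. w x \<le> 1"
  shows finite_weighted_distr: "finite_measure (distr (density M (\<lambda>x. ennreal (w x))) borel \<pi>)"
    and integral_weighted_distr: "f \<in> borel_measurable borel \<Longrightarrow>
      (\<integral>y. f y \<partial>distr (density M (\<lambda>x. ennreal (w x))) borel \<pi>) = (\<integral>x. w x * f (\<pi> x) \<partial>M)"
proof -
  have "emeasure (density M (\<lambda>x. ennreal (w x))) (space M) \<le> (\<integral>\<^sup>+x. 1 \<partial>M)"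
    using w by (subst emeasure_density, simp, simp, intro nn_integral_mono) (simp add: indicator_def)
  also have "\<dots> < \<infinity>" using emeasure_finite by (simp add: less_top[symmetric])
  finally have "finite_measure (density M (\<lambda>x. ennreal (w x)))" by (intro finite_measureI) (simp add: less_top[symmetric])
  then show "finite_measure (distr (density M (\<lambda>x. ennreal (w x))) borel \<pi>)"
    by (rule finite_measure.finite_measure_distr) measurable
  show "(\<integral>y. f y \<partial>distr (density M (\<lambda>x. ennreal (w x))) borel \<pi>) = (\<integral>x. w x * f (\<pi> x) \<partial>M)"
    if [measurable]: "f \<in> borel_measurable borel" for f :: "'b \<Rightarrow> real"
    by (subst integral_distr, simp, simp, subst integral_density) (use w in auto)
qed

text \<open>
Two applications of uniqueness. For almost every half-space \<open>u\<close> of the first factor, the measures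
\<open>C \<mapsto> P(X \<in> u, Y \<in> C)\<close> and \<open>C \<mapsto> P(X \<in> u) P(Y \<in> C)\<close> agree on almost all half-spaces and hence on
all Borel sets. Then, for a fixed \<open>C\<close>, the same argument applies in the first factor.
\<close>

lemma product_of_halfspace_product:
  fixes P :: "('a::euclidean_space \<times> 'b::euclidean_space) measure"
  assumes P: "prob_space P" "sets P = sets (borel \<Otimes>\<^sub>M borel)"
    and ae: "AE z in halfspaces \<Otimes>\<^sub>M halfspaces. (\<integral>p. hs (fst p) (fst z) * hs (snd p) (snd z) \<partial>P) =
      (\<integral>p. hs (fst p) (fst z) \<partial>P) * (\<integral>p. hs (snd p) (snd z) \<partial>P)"
    and A: "A \<in> sets borel" and C: "C \<in> sets borel"
  shows "(\<integral>p. indicat_real A (fst p) * indicat_real C (snd p) \<partial>P) = (\<integral>p. indicat_real A (fst p) \<partial>P) * (\<integral>p. indicat_real C (snd p) \<partial>P)"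
proof -
  interpret P: prob_space P by (rule P)
  note [measurable_cong] = P(2)
  note [measurable] = A C
  interpret h1: sigma_finite_measure "halfspaces :: ('a \<times> real) measure" by (rule sigma_finite_halfspaces)
  interpret h2: sigma_finite_measure "halfspaces :: ('b \<times> real) measure" by (rule sigma_finite_halfspaces)
  interpret hh: pair_sigma_finite "halfspaces :: ('a \<times> real) measure" "halfspaces :: ('b \<times> real) measure" ..
  have f [measurable]: "fst \<in> borel_measurable P" "snd \<in> borel_measurable P" by measurable
  have hb [measurable]: "(\<lambda>x::'z::euclidean_space. hs x u) \<in> borel_measurable borel" for u unfolding hs_def by measurable
  have hb1 [measurable]: "(\<lambda>p. hs (fst p) u) \<in> borel_measurable P" "(\<lambda>p. hs (snd p) v) \<in> borel_measurable P" for u v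
    unfolding hs_def by measurable
  have prob_le: "0 \<le> (\<integral>p. w p \<partial>P)" "(\<integral>p. w p \<partial>P) \<le> 1" if "\<And>p. 0 \<le> w p" "\<And>p. w p \<le> 1" "w \<in> borel_measurable P" for w :: "_ \<Rightarrow> real"
  proof -
    show "0 \<le> (\<integral>p. w p \<partial>P)" using that by simp
    have "(\<integral>p. w p \<partial>P) \<le> (\<integral>p. 1 \<partial>P)"
      using that by (intro integral_mono P.integrable_const_bound[of _ 1]) auto
    then show "(\<integral>p. w p \<partial>P) \<le> 1" by (simp add: P.prob_space)
  qed
  have step: "AE u in halfspaces. (\<integral>p. hs (fst p) u * indicat_real C (snd p) \<partial>P) = (\<integral>p. hs (fst p) u \<partial>P) * (\<integral>p. indicat_real C (snd p) \<partial>P)"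
    using hh.AE_pair[OF ae]
  proof eventually_elim
    case (elim u)
    let ?pu = "\<integral>p. hs (fst p) u \<partial>P"
    have pu: "0 \<le> ?pu" "?pu \<le> 1" by (rule prob_le; simp add: hs_bounds)+
    let ?\<mu> = "distr (density P (\<lambda>p. ennreal (hs (fst p) u))) borel snd" and ?\<nu> = "distr (density P (\<lambda>p. ennreal ?pu)) borel snd"
    have W: "(\<integral>y. f y \<partial>?\<mu>) = (\<integral>p. hs (fst p) u * f (snd p) \<partial>P)" "(\<integral>y. f y \<partial>?\<nu>) = ?pu * (\<integral>p. f (snd p) \<partial>P)"
      if "f \<in> borel_measurable borel" for f :: "'b \<Rightarrow> real"
      using P.integral_weighted_distr[OF hb1(1) f(2) hs_bounds that, of u] P.integral_weighted_distr[OF _ f(2) pu that] by simp_all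
    have "?\<mu> = ?\<nu>"
    proof (rule halfspace_measure_eqI)
      show "finite_measure ?\<mu>" by (rule P.finite_weighted_distr[OF hb1(1) f(2) hs_bounds])
      show "finite_measure ?\<nu>" by (rule P.finite_weighted_distr[OF _ f(2) pu]) simp
      show "AE v in halfspaces. (\<integral>y. hs y v \<partial>?\<mu>) = (\<integral>y. hs y v \<partial>?\<nu>)"
        using elim by eventually_elim (simp only: W[OF hb] fst_conv snd_conv)
    qed simp_all
    then have "(\<integral>y. indicat_real C y \<partial>?\<mu>) = (\<integral>y. indicat_real C y \<partial>?\<nu>)" by (rule arg_cong)
    then show ?case unfolding W[OF borel_measurable_indicator[OF C]] .
  qed
  let ?qC = "\<integral>p. indicat_real C (snd p) \<partial>P"
  have cm [measurable]: "(\<lambda>p. indicat_real C (snd p)) \<in> borel_measurable P" by measurable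
  have qC: "0 \<le> ?qC" "?qC \<le> 1" by (rule prob_le; simp add: indicator_def)+
  let ?\<mu> = "distr (density P (\<lambda>p. ennreal (indicat_real C (snd p)))) borel fst" and ?\<nu> = "distr (density P (\<lambda>p. ennreal ?qC)) borel fst"
  have ind: "0 \<le> indicat_real C (snd p)" "indicat_real C (snd p) \<le> 1" for p :: "'a \<times> 'b" by (simp_all add: indicator_def)
  have W: "(\<integral>y. f y \<partial>?\<mu>) = (\<integral>p. f (fst p) * indicat_real C (snd p) \<partial>P)" "(\<integral>y. f y \<partial>?\<nu>) = (\<integral>p. f (fst p) \<partial>P) * ?qC"
    if "f \<in> borel_measurable borel" for f :: "'a \<Rightarrow> real"
    using P.integral_weighted_distr[OF cm f(1) ind that] P.integral_weighted_distr[OF _ f(1) qC that] by (simp_all add: mult.commute)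
  have "?\<mu> = ?\<nu>"
  proof (rule halfspace_measure_eqI)
    show "finite_measure ?\<mu>" by (rule P.finite_weighted_distr[OF cm f(1) ind])
    show "finite_measure ?\<nu>" by (rule P.finite_weighted_distr[OF _ f(1) qC]) simp
    show "AE u in halfspaces. (\<integral>y. hs y u \<partial>?\<mu>) = (\<integral>y. hs y u \<partial>?\<nu>)"
      using step by eventually_elim (simp only: W[OF hb])
  qed simp_all
  then have "(\<integral>y. indicat_real A y \<partial>?\<mu>) = (\<integral>y. indicat_real A y \<partial>?\<nu>)" by (rule arg_cong)
  then show ?thesis unfolding W[OF borel_measurable_indicator[OF A]] .
qed

abbreviation hs_pairs :: "(('a::euclidean_space \<times> real) \<times> ('b::euclidean_space \<times> real)) measure" where
  "hs_pairs \<equiv> halfspaces \<Otimes>\<^sub>M halfspaces"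

definition hs_mean :: "nat \<Rightarrow> (nat \<Rightarrow> 'a::euclidean_space) \<Rightarrow> 'a \<times> real \<Rightarrow> real" where
  "hs_mean n x u = (\<Sum>k=1..n. hs (x k) u) / real n"

text \<open>
The empirical covariance of the indicators of two half-spaces, one in each factor.
\<close>

definition hs_emp_cov :: "nat \<Rightarrow> (nat \<Rightarrow> 'a::euclidean_space) \<Rightarrow> (nat \<Rightarrow> 'b::euclidean_space) \<Rightarrow>
    ('a \<times> real) \<times> ('b \<times> real) \<Rightarrow> real" where
  "hs_emp_cov n x y z = (\<Sum>k=1..n. hs (x k) (fst z) * hs (y k) (snd z)) / real n - hs_mean n x (fst z) * hs_mean n y (snd z)"

lemma pair_sigma_finite_halfspaces:
  "pair_sigma_finite (halfspaces :: ('a::euclidean_space \<times> real) measure) (halfspaces :: ('b::euclidean_space \<times> real) measure)"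
  by (intro pair_sigma_finite.intro sigma_finite_halfspaces)

text \<open>
Both the distance matrix and its double centering are linear in the array, so the centering may be
carried out under the integral over half-spaces, where the array consists of squared differences of
real numbers.
\<close>

lemma
  fixes x :: "nat \<Rightarrow> real ^ 'd"
  assumes n: "0 < n"
  shows integrable_hs_centered: "integrable halfspaces (\<lambda>u. (hs (x k) u - hs_mean n x u) * (hs (x l) u - hs_mean n x u))"
    and integral_hs_centered: "(\<integral>u. (hs (x k) u - hs_mean n x u) * (hs (x l) u - hs_mean n x u) \<partial>halfspaces) =
      - (mean_abs_normal / 2) * centered n (dist_entry x) k l"
proof -
  have eq: "(hs (x k) u - hs_mean n x u) * (hs (x l) u - hs_mean n x u) = - (1 / 2) * centered n (\<lambda>k l. (hs (x k) u - hs (x l) u)\<^sup>2) k l" for u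
    using centered_sq_dist[OF n, of "\<lambda>k l. (hs (x k) u - hs (x l) u)\<^sup>2" "\<lambda>k. hs (x k) u" k l]
    by (simp add: hs_mean_def)
  note I = integrable_hs_diff
  have Is: "integrable halfspaces (\<lambda>u. \<Sum>j=1..n. (hs (x i) u - hs (x j) u)\<^sup>2)"
    "integrable halfspaces (\<lambda>u. \<Sum>i=1..n. (hs (x i) u - hs (x j) u)\<^sup>2)"
    "integrable halfspaces (\<lambda>u. \<Sum>i=1..n. \<Sum>j=1..n. (hs (x i) u - hs (x j) u)\<^sup>2)" for i j
    by (intro Bochner_Integration.integrable_sum I)+
  have Ic: "integrable halfspaces (\<lambda>u. centered n (\<lambda>k l. (hs (x k) u - hs (x l) u)\<^sup>2) k l)"
    unfolding centered_def row_mean_def col_mean_def grand_mean_def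
    by (intro Bochner_Integration.integrable_add Bochner_Integration.integrable_diff integrable_mult_right I Is)
  have "(\<integral>u. centered n (\<lambda>k l. (hs (x k) u - hs (x l) u)\<^sup>2) k l \<partial>halfspaces) = mean_abs_normal * centered n (dist_entry x) k l"
    unfolding centered_def row_mean_def col_mean_def grand_mean_def dist_entry_def
    by (simp add: I Is integral_hs_diff Bochner_Integration.integral_sum sum_distrib_left[symmetric] algebra_simps)
  then show "(\<integral>u. (hs (x k) u - hs_mean n x u) * (hs (x l) u - hs_mean n x u) \<partial>halfspaces) =
      - (mean_abs_normal / 2) * centered n (dist_entry x) k l" unfolding eq by simp
  show "integrable halfspaces (\<lambda>u. (hs (x k) u - hs_mean n x u) * (hs (x l) u - hs_mean n x u))"
    unfolding eq using Ic by simp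
qed

lemma
  fixes x :: "nat \<Rightarrow> real ^ 'p" and y :: "nat \<Rightarrow> real ^ 'q"
  assumes n: "0 < n"
  shows integrable_hs_emp_cov: "integrable hs_pairs (\<lambda>z. (hs_emp_cov n x y z)\<^sup>2)"
    and dcov_sq_halfspace: "mean_abs_normal\<^sup>2 * dcov_sq n x y = 4 * (\<integral>z. (hs_emp_cov n x y z)\<^sup>2 \<partial>hs_pairs)"
proof -
  interpret hh: pair_sigma_finite "halfspaces :: ((real ^ 'p) \<times> real) measure" "halfspaces :: ((real ^ 'q) \<times> real) measure"
    by (rule pair_sigma_finite_halfspaces)
  let ?c = "\<lambda>k u. hs (x k) u - hs_mean n x u" and ?d = "\<lambda>k v. hs (y k) v - hs_mean n y v"
  have cov: "hs_emp_cov n x y z = (\<Sum>k=1..n. ?c k (fst z) * ?d k (snd z)) / real n" for z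
  proof -
    have s: "(\<Sum>k=1..n. hs (x k) (fst z)) = real n * hs_mean n x (fst z)" "(\<Sum>k=1..n. hs (y k) (snd z)) = real n * hs_mean n y (snd z)"
      using n by (simp_all add: hs_mean_def)
    have "(\<Sum>k=1..n. ?c k (fst z) * ?d k (snd z)) = (\<Sum>k=1..n. hs (x k) (fst z) * hs (y k) (snd z))
        - (\<Sum>k=1..n. hs (x k) (fst z)) * hs_mean n y (snd z) - hs_mean n x (fst z) * (\<Sum>k=1..n. hs (y k) (snd z))
        + real n * (hs_mean n x (fst z) * hs_mean n y (snd z))"
      by (simp add: left_diff_distrib right_diff_distrib sum_subtractf sum_distrib_left sum_distrib_right)
    then show ?thesis unfolding s using n by (simp add: hs_emp_cov_def diff_divide_distrib)
  qed
  have sq: "(hs_emp_cov n x y z)\<^sup>2 = (1 / (real n)\<^sup>2) * (\<Sum>k=1..n. \<Sum>l=1..n. (?c k (fst z) * ?c l (fst z)) * (?d k (snd z) * ?d l (snd z)))" for z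
    unfolding cov power_divide by (simp add: power2_eq_square[of "sum _ _"] sum_product mult_ac)
  have I: "integrable hs_pairs (\<lambda>z. (?c k (fst z) * ?c l (fst z)) * (?d k (snd z) * ?d l (snd z)))" for k l
    by (rule hh.integrable_fst_times_snd[OF integrable_hs_centered[OF n] integrable_hs_centered[OF n]])
  have V: "(\<integral>z. (?c k (fst z) * ?c l (fst z)) * (?d k (snd z) * ?d l (snd z)) \<partial>hs_pairs) =
     (mean_abs_normal\<^sup>2 / 4) * (centered n (dist_entry x) k l * centered n (dist_entry y) k l)" for k l
    unfolding hh.integral_fst_times_snd[OF integrable_hs_centered[OF n] integrable_hs_centered[OF n]]
      integral_hs_centered[OF n] by (simp add: power2_eq_square)
  show "integrable hs_pairs (\<lambda>z. (hs_emp_cov n x y z)\<^sup>2)"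
    unfolding sq by (intro integrable_mult_right Bochner_Integration.integrable_sum I)
  have "(\<integral>z. (hs_emp_cov n x y z)\<^sup>2 \<partial>hs_pairs) = (1 / (real n)\<^sup>2) * (\<Sum>k=1..n. \<Sum>l=1..n.
      (mean_abs_normal\<^sup>2 / 4) * (centered n (dist_entry x) k l * centered n (dist_entry y) k l))"
    unfolding sq by (simp only: integral_mult_right_zero Bochner_Integration.integral_sum Bochner_Integration.integrable_sum I V)
  also have "\<dots> = (mean_abs_normal\<^sup>2 / 4) * dcov_sq n x y"
    unfolding sum_distrib_left[symmetric] dcov_sq_def by simp
  finally show "mean_abs_normal\<^sup>2 * dcov_sq n x y = 4 * (\<integral>z. (hs_emp_cov n x y z)\<^sup>2 \<partial>hs_pairs)" by simp
qed

lemma hs_mean_bounds: "0 \<le> hs_mean n x u" "hs_mean n x u \<le> 1"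
proof -
  show "0 \<le> hs_mean n x u" by (simp add: hs_mean_def sum_nonneg hs_bounds)
  have "(\<Sum>k=1..n. hs (x k) u) \<le> (\<Sum>k=1..n. 1)" by (intro sum_mono hs_bounds)
  then show "hs_mean n x u \<le> 1" by (cases "n = 0") (simp_all add: hs_mean_def)
qed

lemma abs_diff_in_unit: "0 \<le> a \<Longrightarrow> a \<le> 1 \<Longrightarrow> 0 \<le> b \<Longrightarrow> b \<le> 1 \<Longrightarrow> \<bar>a - b\<bar> \<le> (1::real)"
  by (simp add: abs_le_iff)

lemma abs_hs_emp_cov_le: "\<bar>hs_emp_cov n x y z\<bar> \<le> 1"
proof -
  let ?m = "(\<Sum>k=1..n. hs (x k) (fst z) * hs (y k) (snd z)) / real n"
  have "(\<Sum>k=1..n. hs (x k) (fst z) * hs (y k) (snd z)) \<le> (\<Sum>k=1..n. 1)"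
    by (intro sum_mono mult_le_one hs_bounds)
  then have "?m \<le> 1" by (cases "n = 0") simp_all
  moreover have "0 \<le> ?m" by (simp add: sum_nonneg hs_bounds)
  ultimately show ?thesis
    unfolding hs_emp_cov_def by (intro abs_diff_in_unit mult_nonneg_nonneg mult_le_one hs_mean_bounds)
qed

definition hs_cov :: "('a::euclidean_space \<times> 'b::euclidean_space) measure \<Rightarrow> ('a \<times> real) \<times> ('b \<times> real) \<Rightarrow> real" where
  "hs_cov P z = (\<integral>p. hs (fst p) (fst z) * hs (snd p) (snd z) \<partial>P) - (\<integral>p. hs (fst p) (fst z) \<partial>P) * (\<integral>p. hs (snd p) (snd z) \<partial>P)"

locale iid_pairs = iid_sequence P for P :: "('a::euclidean_space \<times> 'b::euclidean_space) measure" +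
  assumes sets_P [measurable_cong]: "sets P = sets (borel \<Otimes>\<^sub>M borel)"
begin

lemma meas_hs_fst [measurable]: "(\<lambda>p. hs (fst p) u) \<in> borel_measurable P"
  unfolding hs_def by measurable

lemma meas_hs_snd [measurable]: "(\<lambda>p. hs (snd p) v) \<in> borel_measurable P"
  unfolding hs_def by measurable

lemma unit_mean:
  fixes f :: "_ \<Rightarrow> real"
  assumes "f \<in> borel_measurable P" "\<And>p. 0 \<le> f p" "\<And>p. f p \<le> 1"
  shows "0 \<le> (\<integral>p. f p \<partial>P)" "(\<integral>p. f p \<partial>P) \<le> 1"
proof -
  show "0 \<le> (\<integral>p. f p \<partial>P)" using assms by simp
  have "(\<integral>p. f p \<partial>P) \<le> (\<integral>p. 1 \<partial>P)"
    using assms by (intro integral_mono integrable_const_bound[of _ 1]) auto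
  then show "(\<integral>p. f p \<partial>P) \<le> 1" by (simp add: prob_space)
qed

lemma abs_hs_cov_le: "\<bar>hs_cov P z\<bar> \<le> 1"
  unfolding hs_cov_def
  by (intro abs_diff_in_unit mult_nonneg_nonneg mult_le_one unit_mean borel_measurable_times meas_hs_fst meas_hs_snd hs_bounds)

lemma abs_hs_cov_diff_le: "\<bar>hs_emp_cov n x y z - hs_cov P z\<bar> \<le> 2"
  using abs_hs_emp_cov_le[of n x y z] abs_hs_cov_le[of z] by linarith

text \<open>
Each of the three sample means involved deviates from its expectation by at most \<open>2 n\<^sup>-\<^sup>1\<^sup>/\<^sup>2\<close> in mean,
because indicators are bounded.
\<close>

lemma expected_hs_emp_cov_dist:
  assumes n: "0 < n"
  shows "(\<integral>\<omega>. \<bar>hs_emp_cov n (\<lambda>k. fst (\<omega> k)) (\<lambda>k. snd (\<omega> k)) z - hs_cov P z\<bar> \<partial>Om) \<le> 6 / sqrt n"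
proof -
  let ?f = "\<lambda>p. hs (fst p) (fst z) * hs (snd p) (snd z)" and ?g = "\<lambda>p. hs (fst p) (fst z)" and ?h = "\<lambda>p. hs (snd p) (snd z)"
  let ?M = "\<lambda>f \<omega>. \<bar>(\<Sum>k=1..n. f (\<omega> k)) / real n - (\<integral>p. f p \<partial>P)\<bar>"
  have b: "\<bar>?f p\<bar> \<le> 1" "\<bar>?g p\<bar> \<le> 1" "\<bar>?h p\<bar> \<le> 1" for p
    by (simp_all add: abs_mult hs_bounds mult_le_one)
  have m: "?f \<in> borel_measurable P" "?g \<in> borel_measurable P" "?h \<in> borel_measurable P" by measurable
  have I: "integrable Om (?M f)" if "f \<in> borel_measurable P" "\<And>p. \<bar>f p\<bar> \<le> 1" for f
    using that by (intro integrable_abs Bochner_Integration.integrable_diff integrable_divide Bochner_Integration.integrable_sum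
      integrable_coord Om.integrable_const integrable_const_bound[of _ 1]) auto
  note II = I[OF m(1) b(1)] I[OF m(2) b(2)] I[OF m(3) b(3)]
  have le: "\<bar>hs_emp_cov n (\<lambda>k. fst (\<omega> k)) (\<lambda>k. snd (\<omega> k)) z - hs_cov P z\<bar> \<le> ?M ?f \<omega> + ?M ?g \<omega> + ?M ?h \<omega>" for \<omega>
  proof -
    let ?a = "hs_mean n (\<lambda>k. fst (\<omega> k)) (fst z)" and ?b = "hs_mean n (\<lambda>k. snd (\<omega> k)) (snd z)"
    let ?p = "\<integral>p. ?g p \<partial>P" and ?q = "\<integral>p. ?h p \<partial>P"
    have p: "0 \<le> ?p" "?p \<le> 1" by (rule unit_mean[OF m(2)]; simp add: hs_bounds)+
    have "?a * ?b - ?p * ?q = (?a - ?p) * ?b + ?p * (?b - ?q)" by (simp add: algebra_simps)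
    then have "\<bar>?a * ?b - ?p * ?q\<bar> \<le> \<bar>?a - ?p\<bar> * ?b + ?p * \<bar>?b - ?q\<bar>"
      using abs_triangle_ineq[of "(?a - ?p) * ?b" "?p * (?b - ?q)"] p hs_mean_bounds(1)[of n "\<lambda>k. snd (\<omega> k)" "snd z"]
      by (simp add: abs_mult)
    also have "\<dots> \<le> \<bar>?a - ?p\<bar> * 1 + 1 * \<bar>?b - ?q\<bar>"
      by (intro add_mono mult_left_mono mult_right_mono hs_mean_bounds p abs_ge_zero)
    finally have "\<bar>?a * ?b - ?p * ?q\<bar> \<le> \<bar>?a - ?p\<bar> + \<bar>?b - ?q\<bar>" by simp
    then show ?thesis unfolding hs_emp_cov_def hs_cov_def hs_mean_def by linarith
  qed
  have em [measurable]: "(\<lambda>\<omega>. hs_emp_cov n (\<lambda>k. fst (\<omega> k)) (\<lambda>k. snd (\<omega> k)) z) \<in> borel_measurable Om"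
    unfolding hs_emp_cov_def hs_mean_def
    using measurable_compose[OF measurable_coord m(1)] measurable_compose[OF measurable_coord m(2)] measurable_compose[OF measurable_coord m(3)]
    by (intro borel_measurable_diff borel_measurable_times borel_measurable_divide borel_measurable_sum) auto
  have "(\<integral>\<omega>. \<bar>hs_emp_cov n (\<lambda>k. fst (\<omega> k)) (\<lambda>k. snd (\<omega> k)) z - hs_cov P z\<bar> \<partial>Om) \<le> (\<integral>\<omega>. ?M ?f \<omega> + ?M ?g \<omega> + ?M ?h \<omega> \<partial>Om)"
  proof (rule integral_mono)
    show "integrable Om (\<lambda>\<omega>. \<bar>hs_emp_cov n (\<lambda>k. fst (\<omega> k)) (\<lambda>k. snd (\<omega> k)) z - hs_cov P z\<bar>)"
      by (rule Om.integrable_const_bound[of _ 2]) (auto simp: abs_hs_cov_diff_le)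
  qed (use II le in auto)
  also have "\<dots> = (\<integral>\<omega>. ?M ?f \<omega> \<partial>Om) + (\<integral>\<omega>. ?M ?g \<omega> \<partial>Om) + (\<integral>\<omega>. ?M ?h \<omega> \<partial>Om)" using II by simp
  also have "\<dots> \<le> 2 * 1 / sqrt n + 2 * 1 / sqrt n + 2 * 1 / sqrt n"
    by (intro add_mono mean_deviation_bounded m b n)
  finally show ?thesis by simp
qed

lemma meas_emp_cov_pair:
  assumes \<nu>: "sets \<nu> = sets hs_pairs"
  shows "(\<lambda>(\<omega>, z). hs_emp_cov n (\<lambda>k. fst (\<omega> k)) (\<lambda>k. snd (\<omega> k)) z) \<in> borel_measurable (Om \<Otimes>\<^sub>M \<nu>)"
proof -
  have fs: "fst \<in> borel_measurable P" "snd \<in> borel_measurable P" by measurable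
  have fn: "fst \<in> measurable \<nu> halfspaces" "snd \<in> measurable \<nu> halfspaces"
    using measurable_fst measurable_snd measurable_cong_sets[OF \<nu> refl] by blast+
  have a: "(\<lambda>q. hs (fst (fst q k)) (fst (snd q))) \<in> borel_measurable (Om \<Otimes>\<^sub>M \<nu>)" for k
    using measurable_compose[OF measurable_Pair[OF
        measurable_compose[OF measurable_compose[OF measurable_fst measurable_coord] fs(1)]
        measurable_compose[OF measurable_snd fn(1)]] measurable_hs] by simp
  have b: "(\<lambda>q. hs (snd (fst q k)) (snd (snd q))) \<in> borel_measurable (Om \<Otimes>\<^sub>M \<nu>)" for k
    using measurable_compose[OF measurable_Pair[OF
        measurable_compose[OF measurable_compose[OF measurable_fst measurable_coord] fs(2)]
        measurable_compose[OF measurable_snd fn(2)]] measurable_hs] by simp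
  show ?thesis
    unfolding hs_emp_cov_def hs_mean_def case_prod_unfold
    by (intro borel_measurable_diff borel_measurable_times borel_measurable_divide borel_measurable_sum borel_measurable_const a b)
qed

text \<open>
By Fubini the expectation of the integrated error is the integral of the pointwise bound, and that
bound does not depend on the pair of half-spaces.
\<close>

lemma hs_emp_cov_L1:
  assumes \<nu>: "sets \<nu> = sets hs_pairs" "finite_measure \<nu>" and n: "0 < n"
  defines "L \<equiv> \<lambda>\<omega>. \<integral>z. (hs_emp_cov n (\<lambda>k. fst (\<omega> k)) (\<lambda>k. snd (\<omega> k)) z)\<^sup>2 \<partial>\<nu>"
  assumes mc: "hs_cov P \<in> borel_measurable \<nu>"
  shows "integrable Om (\<lambda>\<omega>. L \<omega> - (\<integral>z. (hs_cov P z)\<^sup>2 \<partial>\<nu>))"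
    and "(\<integral>\<omega>. \<bar>L \<omega> - (\<integral>z. (hs_cov P z)\<^sup>2 \<partial>\<nu>)\<bar> \<partial>Om) \<le> 12 * measure \<nu> (space \<nu>) / sqrt n"
proof -
  interpret \<nu>: finite_measure \<nu> by (rule \<nu>)
  interpret O\<nu>: pair_sigma_finite Om \<nu> ..
  interpret F: finite_measure "Om \<Otimes>\<^sub>M \<nu>"
    by (rule finite_measure_pair_measure[OF \<nu>.finite_measure_axioms Om.finite_measure_axioms])
  let ?e = "\<lambda>\<omega> z. hs_emp_cov n (\<lambda>k. fst (\<omega> k)) (\<lambda>k. snd (\<omega> k)) z" and ?c = "hs_cov P"
  have me [measurable]: "(\<lambda>q. ?e (fst q) (snd q)) \<in> borel_measurable (Om \<Otimes>\<^sub>M \<nu>)"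
    using meas_emp_cov_pair[OF \<nu>(1), of n] by (simp add: case_prod_unfold)
  note [measurable] = mc
  have be: "(?e \<omega> z)\<^sup>2 \<le> 1" "(?c z)\<^sup>2 \<le> 1" for \<omega> z
    using abs_hs_emp_cov_le abs_hs_cov_le by (simp_all add: abs_square_le_1)
  have bd: "\<bar>(?e \<omega> z)\<^sup>2 - (?c z)\<^sup>2\<bar> \<le> 2 * \<bar>?e \<omega> z - ?c z\<bar>" for \<omega> z
  proof -
    have "(?e \<omega> z)\<^sup>2 - (?c z)\<^sup>2 = (?e \<omega> z + ?c z) * (?e \<omega> z - ?c z)" by (simp add: power2_eq_square algebra_simps)
    moreover have "\<bar>?e \<omega> z + ?c z\<bar> \<le> 2"
      using abs_hs_emp_cov_le[of n "\<lambda>k. fst (\<omega> k)" "\<lambda>k. snd (\<omega> k)" z] abs_hs_cov_le[of z] by linarith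
    ultimately show ?thesis by (simp add: abs_mult mult_right_mono)
  qed
  have I1: "integrable (Om \<Otimes>\<^sub>M \<nu>) (\<lambda>q. (?e (fst q) (snd q))\<^sup>2 - (?c (snd q))\<^sup>2)"
    by (rule F.integrable_const_bound[of _ 1]) (use be in \<open>auto intro!: abs_diff_in_unit\<close>)
  have two: "\<bar>?e \<omega> z - ?c z\<bar> \<le> 2" for \<omega> z by (rule abs_hs_cov_diff_le)
  have I2: "integrable (Om \<Otimes>\<^sub>M \<nu>) (\<lambda>q. \<bar>?e (fst q) (snd q) - ?c (snd q)\<bar>)"
    by (rule F.integrable_const_bound[of _ 2]) (auto simp: two)
  have mew: "?e \<omega> \<in> borel_measurable \<nu>" if "\<omega> \<in> space Om" for \<omega>
    using measurable_compose[OF measurable_Pair1'[OF that] me] by simp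
  have Ie: "integrable \<nu> (\<lambda>z. (?e \<omega> z)\<^sup>2)" if "\<omega> \<in> space Om" for \<omega>
    by (rule \<nu>.integrable_const_bound[of _ 1]) (use be mew[OF that] in auto)
  have Ic: "integrable \<nu> (\<lambda>z. (?c z)\<^sup>2)"
    by (rule \<nu>.integrable_const_bound[of _ 1]) (use be in auto)
  have L: "L \<omega> - (\<integral>z. (?c z)\<^sup>2 \<partial>\<nu>) = (\<integral>z. (?e \<omega> z)\<^sup>2 - (?c z)\<^sup>2 \<partial>\<nu>)" if "\<omega> \<in> space Om" for \<omega>
    unfolding L_def using Ie[OF that] Ic by simp
  have IL: "integrable Om (\<lambda>\<omega>. \<integral>z. (?e \<omega> z)\<^sup>2 - (?c z)\<^sup>2 \<partial>\<nu>)"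
    using O\<nu>.integrable_fst'[OF I1] by simp
  then show IL': "integrable Om (\<lambda>\<omega>. L \<omega> - (\<integral>z. (?c z)\<^sup>2 \<partial>\<nu>))"
    by (subst Bochner_Integration.integrable_cong[OF refl L]) auto
  have "(\<integral>\<omega>. \<bar>L \<omega> - (\<integral>z. (?c z)\<^sup>2 \<partial>\<nu>)\<bar> \<partial>Om) \<le> (\<integral>\<omega>. (\<integral>z. 2 * \<bar>?e \<omega> z - ?c z\<bar> \<partial>\<nu>) \<partial>Om)"
  proof (rule integral_mono)
    show "integrable Om (\<lambda>\<omega>. \<bar>L \<omega> - (\<integral>z. (?c z)\<^sup>2 \<partial>\<nu>)\<bar>)" using IL' by simp
    show "integrable Om (\<lambda>\<omega>. \<integral>z. 2 * \<bar>?e \<omega> z - ?c z\<bar> \<partial>\<nu>)"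
      using O\<nu>.integrable_fst'[OF integrable_mult_right[OF I2, of 2]] by simp
    fix \<omega> assume w: "\<omega> \<in> space Om"
    have J: "integrable \<nu> (\<lambda>z. 2 * \<bar>?e \<omega> z - ?c z\<bar>)"
      by (rule integrable_mult_right, rule \<nu>.integrable_const_bound[of _ 2]) (use mew[OF w] two in auto)
    show "\<bar>L \<omega> - (\<integral>z. (?c z)\<^sup>2 \<partial>\<nu>)\<bar> \<le> (\<integral>z. 2 * \<bar>?e \<omega> z - ?c z\<bar> \<partial>\<nu>)"
      unfolding L[OF w]
      by (rule order_trans[OF integral_abs_bound integral_mono[OF _ J]]) (use bd Ie[OF w] Ic in auto)
  qed
  also have "\<dots> = (\<integral>z. (\<integral>\<omega>. 2 * \<bar>?e \<omega> z - ?c z\<bar> \<partial>Om) \<partial>\<nu>)"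
    using integrable_mult_right[OF I2, of 2] by (intro O\<nu>.Fubini_integral[symmetric]) (simp add: case_prod_unfold)
  also have "\<dots> \<le> (\<integral>z. 2 * (6 / sqrt n) \<partial>\<nu>)"
  proof (rule integral_mono)
    show "integrable \<nu> (\<lambda>z. \<integral>\<omega>. 2 * \<bar>?e \<omega> z - ?c z\<bar> \<partial>Om)"
      using O\<nu>.integrable_snd[of "\<lambda>\<omega> z. 2 * \<bar>?e \<omega> z - ?c z\<bar>"] integrable_mult_right[OF I2, of 2]
      by (simp add: case_prod_unfold)
    show "(\<integral>\<omega>. 2 * \<bar>?e \<omega> z - ?c z\<bar> \<partial>Om) \<le> 2 * (6 / sqrt n)" for z
      using expected_hs_emp_cov_dist[OF n, of z] by simp
  qed simp
  also have "\<dots> = 12 * measure \<nu> (space \<nu>) / sqrt n" by simp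
  finally show "(\<integral>\<omega>. \<bar>L \<omega> - (\<integral>z. (?c z)\<^sup>2 \<partial>\<nu>)\<bar> \<partial>Om) \<le> 12 * measure \<nu> (space \<nu>) / sqrt n" .
qed

end

section \<open>Divergence under dependence\<close>

lemma test_stat_cong:
  assumes "\<And>k. k \<in> {1..n} \<Longrightarrow> x k = x' k" "\<And>k. k \<in> {1..n} \<Longrightarrow> y k = y' k"
  shows "test_stat n x y = test_stat n x' y'"
  using assms
  by (simp add: test_stat_def dcov_sq_def S2_def centered_def row_mean_def col_mean_def grand_mean_def dist_entry_def
      cong: sum.cong_simp)

lemma measurable_test_stat:
  fixes x :: "'a \<Rightarrow> nat \<Rightarrow> real ^ 'p" and y :: "'a \<Rightarrow> nat \<Rightarrow> real ^ 'q"
  assumes "\<And>k. k \<in> {1..n} \<Longrightarrow> (\<lambda>\<omega>. x \<omega> k) \<in> borel_measurable M" "\<And>k. k \<in> {1..n} \<Longrightarrow> (\<lambda>\<omega>. y \<omega> k) \<in> borel_measurable M"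
  shows "(\<lambda>\<omega>. test_stat n (x \<omega>) (y \<omega>)) \<in> borel_measurable M"
proof -
  have d: "(\<lambda>\<omega>. norm (x \<omega> k - x \<omega> l)) \<in> borel_measurable M" "(\<lambda>\<omega>. norm (y \<omega> k - y \<omega> l)) \<in> borel_measurable M"
    if "k \<in> {1..n}" "l \<in> {1..n}" for k l
    using measurable_compose[OF borel_measurable_diff[OF assms(1) assms(1)] borel_measurable_norm]
      measurable_compose[OF borel_measurable_diff[OF assms(2) assms(2)] borel_measurable_norm] that by blast+
  show ?thesis
    unfolding test_stat_def dcov_sq_def S2_def centered_def row_mean_def col_mean_def grand_mean_def dist_entry_def
    by (intro borel_measurable_divide borel_measurable_times borel_measurable_add borel_measurable_diff
        borel_measurable_sum borel_measurable_const d)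
qed

lemma dcov_sq_nonneg:
  assumes n: "0 < n" shows "0 \<le> dcov_sq n x y"
proof -
  have "0 \<le> mean_abs_normal\<^sup>2 * dcov_sq n x y" unfolding dcov_sq_halfspace[OF n] by simp
  then show ?thesis using mean_abs_normal_pos by (simp add: zero_le_mult_iff)
qed

lemma S2_nonneg: "0 \<le> S2 n x y"
  unfolding S2_def by (intro mult_nonneg_nonneg sum_nonneg) auto

lemma test_stat_nonneg: "0 \<le> test_stat n x y"
  using dcov_sq_nonneg[of n x y] S2_nonneg[of n x y] by (cases "n = 0") (simp_all add: test_stat_def)

lemma centered_eq_zero:
  fixes v :: "nat \<Rightarrow> real ^ 'z"
  assumes v: "(\<Sum>k=1..n. \<Sum>l=1..n. norm (v k - v l)) = 0" and kl: "k \<in> {1..n}" "l \<in> {1..n}"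
  shows "centered n (dist_entry v) k l = 0"
proof -
  have nz: "dist_entry v i j = 0" if "i \<in> {1..n}" "j \<in> {1..n}" for i j
  proof -
    have "(\<Sum>l=1..n. norm (v i - v l)) = 0"
      using v that(1) by (subst (asm) sum_nonneg_eq_0_iff) (auto intro: sum_nonneg)
    then have "norm (v i - v j) = 0" using that(2) by (subst (asm) sum_nonneg_eq_0_iff) auto
    then show ?thesis unfolding dist_entry_def .
  qed
  have "(\<Sum>j=1..n. dist_entry v i j) = 0" "(\<Sum>j=1..n. dist_entry v j i) = 0" if "i \<in> {1..n}" for i
    using nz that by (intro sum.neutral ballI; blast)+
  moreover have "(\<Sum>i=1..n. \<Sum>j=1..n. dist_entry v i j) = 0" by (intro sum.neutral ballI nz)
  ultimately show ?thesis
    using kl nz[OF kl] by (simp add: centered_def row_mean_def col_mean_def grand_mean_def)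
qed

text \<open>
If \<open>S\<^sub>2\<close> vanishes, all points of one of the two samples coincide. So where the distance covariance is
positive the quotient is a genuine one.
\<close>

lemma S2_eq_zero_imp_dcov_sq:
  assumes "0 < n" "S2 n x y = 0" shows "dcov_sq n x y = 0"
proof -
  have "(\<Sum>k=1..n. \<Sum>l=1..n. norm (x k - x l)) = 0 \<or> (\<Sum>k=1..n. \<Sum>l=1..n. norm (y k - y l)) = 0"
    using assms by (simp add: S2_def)
  then show ?thesis
  proof
    assume "(\<Sum>k=1..n. \<Sum>l=1..n. norm (x k - x l)) = 0"
    from centered_eq_zero[OF this] have "(\<Sum>k=1..n. \<Sum>l=1..n. centered n (dist_entry x) k l * centered n (dist_entry y) k l) = 0"
      by (intro sum.neutral ballI) simp
    then show ?thesis by (simp add: dcov_sq_def)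
  next
    assume "(\<Sum>k=1..n. \<Sum>l=1..n. norm (y k - y l)) = 0"
    from centered_eq_zero[OF this] have "(\<Sum>k=1..n. \<Sum>l=1..n. centered n (dist_entry x) k l * centered n (dist_entry y) k l) = 0"
      by (intro sum.neutral ballI) simp
    then show ?thesis by (simp add: dcov_sq_def)
  qed
qed

lemma (in iid_pairs) measurable_hs_cov: "hs_cov P \<in> borel_measurable hs_pairs"
proof -
  have fs: "fst \<in> borel_measurable P" "snd \<in> borel_measurable P" by measurable
  have a: "(\<lambda>q. hs (fst (snd q)) (fst (fst q))) \<in> borel_measurable (hs_pairs \<Otimes>\<^sub>M P)"
    using measurable_compose[OF measurable_Pair[OF measurable_compose[OF measurable_snd fs(1)]
        measurable_compose[OF measurable_fst measurable_fst]] measurable_hs] by simp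
  have b: "(\<lambda>q. hs (snd (snd q)) (snd (fst q))) \<in> borel_measurable (hs_pairs \<Otimes>\<^sub>M P)"
    using measurable_compose[OF measurable_Pair[OF measurable_compose[OF measurable_snd fs(2)]
        measurable_compose[OF measurable_fst measurable_snd]] measurable_hs] by simp
  have "(\<lambda>(z, p). hs (fst p) (fst z)) \<in> borel_measurable (hs_pairs \<Otimes>\<^sub>M P)"
    "(\<lambda>(z, p). hs (snd p) (snd z)) \<in> borel_measurable (hs_pairs \<Otimes>\<^sub>M P)"
    "(\<lambda>(z, p). hs (fst p) (fst z) * hs (snd p) (snd z)) \<in> borel_measurable (hs_pairs \<Otimes>\<^sub>M P)"
    unfolding case_prod_unfold by (intro a b borel_measurable_times)+
  from this[THEN borel_measurable_lebesgue_integral] show ?thesis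
    unfolding hs_cov_def by (intro borel_measurable_diff borel_measurable_times)
qed

lemma (in iid_sequence) mean_dist_le:
  fixes f :: "'s \<Rightarrow> real ^ 'z"
  assumes f: "integrable P (\<lambda>p. norm (f p))" "f \<in> borel_measurable P" and n: "0 < n"
  shows "integrable Om (\<lambda>\<omega>. (1 / (real n)\<^sup>2) * (\<Sum>k=1..n. \<Sum>l=1..n. norm (f (\<omega> k) - f (\<omega> l))))"
    and "(\<integral>\<omega>. \<bar>(1 / (real n)\<^sup>2) * (\<Sum>k=1..n. \<Sum>l=1..n. norm (f (\<omega> k) - f (\<omega> l)))\<bar> \<partial>Om) \<le> 2 * (\<integral>p. norm (f p) \<partial>P)"
proof -
  have c: "(\<lambda>\<omega>. f (\<omega> k)) \<in> borel_measurable Om" for k by (rule measurable_compose[OF measurable_coord f(2)])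
  have I: "integrable Om (\<lambda>\<omega>. norm (f (\<omega> k)))" "(\<integral>\<omega>. norm (f (\<omega> k)) \<partial>Om) = (\<integral>p. norm (f p) \<partial>P)" for k
    using integrable_coord[OF f(1)] integral_coord[OF borel_measurable_integrable[OF f(1)]] by auto
  have J: "integrable Om (\<lambda>\<omega>. norm (f (\<omega> k) - f (\<omega> l)))" for k l
  proof (rule Bochner_Integration.integrable_bound[OF Bochner_Integration.integrable_add[OF I(1)[of k] I(1)[of l]]])
    show "(\<lambda>\<omega>. norm (f (\<omega> k) - f (\<omega> l))) \<in> borel_measurable Om" using c by measurable
  qed (simp add: norm_triangle_ineq4)
  have le: "(\<integral>\<omega>. norm (f (\<omega> k) - f (\<omega> l)) \<partial>Om) \<le> 2 * (\<integral>p. norm (f p) \<partial>P)" for k l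
  proof -
    have "(\<integral>\<omega>. norm (f (\<omega> k) - f (\<omega> l)) \<partial>Om) \<le> (\<integral>\<omega>. norm (f (\<omega> k)) + norm (f (\<omega> l)) \<partial>Om)"
      by (intro integral_mono J Bochner_Integration.integrable_add I norm_triangle_ineq4)
    then show ?thesis by (simp add: I)
  qed
  show K: "integrable Om (\<lambda>\<omega>. (1 / (real n)\<^sup>2) * (\<Sum>k=1..n. \<Sum>l=1..n. norm (f (\<omega> k) - f (\<omega> l))))"
    by (intro integrable_mult_right Bochner_Integration.integrable_sum J)
  have "(\<integral>\<omega>. \<bar>(1 / (real n)\<^sup>2) * (\<Sum>k=1..n. \<Sum>l=1..n. norm (f (\<omega> k) - f (\<omega> l)))\<bar> \<partial>Om) =
    (1 / (real n)\<^sup>2) * (\<Sum>k=1..n. \<Sum>l=1..n. \<integral>\<omega>. norm (f (\<omega> k) - f (\<omega> l)) \<partial>Om)"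
    using J by (simp add: sum_nonneg Bochner_Integration.integral_sum)
  also have "\<dots> \<le> (1 / (real n)\<^sup>2) * (\<Sum>k=1..n. \<Sum>l=1..n. 2 * (\<integral>p. norm (f p) \<partial>P))"
    by (intro mult_left_mono sum_mono le) simp
  also have "\<dots> = 2 * (\<integral>p. norm (f p) \<partial>P)" using n by (simp add: power2_eq_square)
  finally show "(\<integral>\<omega>. \<bar>(1 / (real n)\<^sup>2) * (\<Sum>k=1..n. \<Sum>l=1..n. norm (f (\<omega> k) - f (\<omega> l)))\<bar> \<partial>Om) \<le> 2 * (\<integral>p. norm (f p) \<partial>P)" .
qed

text \<open>
The finite measure \<open>\<nu>\<close> has the same null sets as the measure on pairs of half-spaces and is dominated by
it. Hence \<open>V\<^sub>n\<^sup>2\<close> dominates a multiple of \<open>Ln\<close>, the integral of the squared empirical covariance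
against \<open>\<nu>\<close>. Its limit \<open>L\<close> is positive by dependence, and with probability near \<open>1\<close> both \<open>Ln \<ge> L / 2\<close>
and the two mean distances are at most \<open>k\<close>; then the statistic is at least \<open>n v / k\<^sup>2\<close>.
\<close>

theorem test_stat_diverges:
  fixes P :: "((real ^ 'p) \<times> (real ^ 'q)) measure"
  assumes P: "iid_pairs P" and X1: "integrable P (\<lambda>p. norm (fst p))" and Y1: "integrable P (\<lambda>p. norm (snd p))"
    and dep: "A \<in> sets borel" "C \<in> sets borel"
      "(\<integral>p. indicat_real A (fst p) * indicat_real C (snd p) \<partial>P) \<noteq> (\<integral>p. indicat_real A (fst p) \<partial>P) * (\<integral>p. indicat_real C (snd p) \<partial>P)"
  shows "(\<lambda>n. measure (PiM UNIV (\<lambda>_. P)) {\<omega> \<in> space (PiM UNIV (\<lambda>_. P)).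
    c < test_stat n (\<lambda>k. fst (\<omega> k)) (\<lambda>k. snd (\<omega> k))}) \<longlonglongrightarrow> 1"
proof -
  interpret iid_pairs P by (rule P)
  interpret hh: pair_sigma_finite "halfspaces :: ((real ^ 'p) \<times> real) measure" "halfspaces :: ((real ^ 'q) \<times> real) measure"
    by (rule pair_sigma_finite_halfspaces)
  let ?\<Lambda> = "hs_pairs :: (((real ^ 'p) \<times> real) \<times> (real ^ 'q) \<times> real) measure"
  let ?x = "\<lambda>\<omega> k. fst (\<omega> k :: (real ^ 'p) \<times> (real ^ 'q))" and ?y = "\<lambda>\<omega> k. snd (\<omega> k :: (real ^ 'p) \<times> (real ^ 'q))"
  obtain h where h [measurable]: "h \<in> borel_measurable ?\<Lambda>" and hfin: "integral\<^sup>N ?\<Lambda> h \<noteq> \<infinity>"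
    and hpos: "\<And>z. z \<in> space ?\<Lambda> \<Longrightarrow> 0 < h z"
    using hh.Ex_finite_integrable_function by blast
  define \<nu> where "\<nu> = density ?\<Lambda> (\<lambda>z. min 1 (h z))"
  have sets_\<nu>: "sets \<nu> = sets ?\<Lambda>" by (simp add: \<nu>_def)
  have fin_\<nu>: "finite_measure \<nu>"
  proof (rule finite_measureI)
    have "emeasure \<nu> (space \<nu>) = (\<integral>\<^sup>+z. 1 \<partial>\<nu>)" by simp
    also have "\<dots> = (\<integral>\<^sup>+z. min 1 (h z) * 1 \<partial>?\<Lambda>)" unfolding \<nu>_def by (rule nn_integral_density) simp_all
    also have "\<dots> \<le> integral\<^sup>N ?\<Lambda> h" by (intro nn_integral_mono) simp
    finally show "emeasure \<nu> (space \<nu>) \<noteq> \<infinity>" using hfin by (auto simp: top_unique)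
  qed
  have mc: "hs_cov P \<in> borel_measurable \<nu>"
    using measurable_hs_cov measurable_cong_sets[OF sets_\<nu> refl] by blast
  define L where "L = (\<integral>z. (hs_cov P z)\<^sup>2 \<partial>\<nu>)"
  have L: "0 < L"
  proof (rule ccontr)
    interpret \<nu>: finite_measure \<nu> by (rule fin_\<nu>)
    assume "\<not> 0 < L"
    moreover have "0 \<le> L" by (simp add: L_def)
    ultimately have L0: "L = 0" by simp
    have "integrable \<nu> (\<lambda>z. (hs_cov P z)\<^sup>2)"
      by (rule \<nu>.integrable_const_bound[of _ 1]) (use abs_hs_cov_le mc in \<open>auto simp: abs_square_le_1\<close>)
    from integral_nonneg_eq_0_iff_AE[OF this] L0 have "AE z in \<nu>. (hs_cov P z)\<^sup>2 = 0"
      unfolding L_def by simp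
    then have "AE z in ?\<Lambda>. 0 < min 1 (h z) \<longrightarrow> (hs_cov P z)\<^sup>2 = 0"
      unfolding \<nu>_def by (subst (asm) AE_density) auto
    then have "AE z in ?\<Lambda>. hs_cov P z = 0"
      using AE_space by eventually_elim (use hpos in auto)
    then have "AE z in ?\<Lambda>. (\<integral>p. hs (fst p) (fst z) * hs (snd p) (snd z) \<partial>P) =
      (\<integral>p. hs (fst p) (fst z) \<partial>P) * (\<integral>p. hs (snd p) (snd z) \<partial>P)"
      by eventually_elim (simp add: hs_cov_def)
    from product_of_halfspace_product[OF prob_space_axioms sets_P this dep(1,2)] show False using dep(3) by blast
  qed
  define Ln where "Ln n \<omega> = (\<integral>z. (hs_emp_cov n (?x \<omega>) (?y \<omega>) z)\<^sup>2 \<partial>\<nu>)" for n \<omega>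
  have Ln_le: "4 * Ln n \<omega> \<le> mean_abs_normal\<^sup>2 * dcov_sq n (?x \<omega>) (?y \<omega>)" if n: "0 < n" for n \<omega>
  proof -
    have I: "integrable ?\<Lambda> (\<lambda>z. (hs_emp_cov n (?x \<omega>) (?y \<omega>) z)\<^sup>2)" by (rule integrable_hs_emp_cov[OF n])
    have m [measurable]: "(\<lambda>z. (hs_emp_cov n (?x \<omega>) (?y \<omega>) z)\<^sup>2) \<in> borel_measurable ?\<Lambda>" using I by simp
    have "(\<integral>\<^sup>+z. ennreal ((hs_emp_cov n (?x \<omega>) (?y \<omega>) z)\<^sup>2) \<partial>\<nu>) \<le> (\<integral>\<^sup>+z. ennreal ((hs_emp_cov n (?x \<omega>) (?y \<omega>) z)\<^sup>2) \<partial>?\<Lambda>)"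
      unfolding \<nu>_def
      by (subst nn_integral_density, simp, simp, intro nn_integral_mono)
         (metis min.cobounded1 mult.commute mult.right_neutral mult_left_mono zero_le)
    also have "\<dots> = ennreal (\<integral>z. (hs_emp_cov n (?x \<omega>) (?y \<omega>) z)\<^sup>2 \<partial>?\<Lambda>)"
      using I by (intro nn_integral_eq_integral) auto
    finally have "Ln n \<omega> \<le> (\<integral>z. (hs_emp_cov n (?x \<omega>) (?y \<omega>) z)\<^sup>2 \<partial>?\<Lambda>)"
      unfolding Ln_def using m unfolding measurable_cong_sets[OF sets_\<nu> refl, symmetric]
      by (subst integral_eq_nn_integral) (auto intro!: enn2real_leI)
    then show ?thesis using dcov_sq_halfspace[OF n, of "?x \<omega>" "?y \<omega>"] by simp
  qed
  define a where "a = (\<integral>p. norm (fst p) \<partial>P)"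
  define b where "b = (\<integral>p. norm (snd p) \<partial>P)"
  have a0: "0 \<le> a" "0 \<le> b" by (simp_all add: a_def b_def)
  define m1 where "m1 n \<omega> = (1 / (real n)\<^sup>2) * (\<Sum>k=1..n. \<Sum>l=1..n. norm (?x \<omega> k - ?x \<omega> l))" for n \<omega>
  define m2 where "m2 n \<omega> = (1 / (real n)\<^sup>2) * (\<Sum>k=1..n. \<Sum>l=1..n. norm (?y \<omega> k - ?y \<omega> l))" for n \<omega>
  have I1: "integrable Om (m1 n)" "(\<integral>\<omega>. \<bar>m1 n \<omega>\<bar> \<partial>Om) \<le> 2 * a" and I2: "integrable Om (m2 n)" "(\<integral>\<omega>. \<bar>m2 n \<omega>\<bar> \<partial>Om) \<le> 2 * b"
    if "0 < n" for n
    unfolding m1_def m2_def a_def b_def by (intro mean_dist_le X1 Y1 that; measurable)+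
  have S2m: "S2 n (?x \<omega>) (?y \<omega>) = m1 n \<omega> * m2 n \<omega>" for n \<omega> by (simp add: S2_def m1_def m2_def)
  have m0: "0 \<le> m1 n \<omega>" "0 \<le> m2 n \<omega>" for n \<omega>
    unfolding m1_def m2_def by (intro mult_nonneg_nonneg sum_nonneg; simp)+
  have IL: "integrable Om (\<lambda>\<omega>. Ln n \<omega> - L)" "(\<integral>\<omega>. \<bar>Ln n \<omega> - L\<bar> \<partial>Om) \<le> 12 * measure \<nu> (space \<nu>) / sqrt n" if "0 < n" for n
    using hs_emp_cov_L1[OF sets_\<nu> fin_\<nu> that mc] unfolding Ln_def L_def by simp_all
  let ?stat = "\<lambda>n \<omega>. test_stat n (?x \<omega>) (?y \<omega>)"
  have meas [measurable]: "?stat n \<in> borel_measurable Om" for n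
  proof -
    have "fst \<in> borel_measurable P" "snd \<in> borel_measurable P" by measurable
    then show ?thesis by (intro measurable_test_stat measurable_compose[OF measurable_coord])
  qed
  have "(\<lambda>n. Om.prob {\<omega> \<in> space Om. c < ?stat n \<omega>}) \<longlonglongrightarrow> 1"
  proof (rule LIMSEQ_I)
    fix e :: real assume e: "0 < e"
    define k where "k = (2 * a + 2 * b + 1) * 2 / e"
    have k: "0 < k" "(2 * a + 2 * b) / k < e / 2"
    proof -
      show k0: "0 < k" using a0 e by (simp add: k_def)
      have "e / 2 * k = 2 * a + 2 * b + 1" using e by (simp add: k_def)
      then have "2 * a + 2 * b < e / 2 * k" by simp
      then show "(2 * a + 2 * b) / k < e / 2" using k0 by (simp add: pos_divide_less_eq)
    qed
    define v where "v = 2 * L / mean_abs_normal\<^sup>2"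
    have v: "0 < v" using L mean_abs_normal_pos by (simp add: v_def)
    have bound: "1 - Om.prob {\<omega> \<in> space Om. c < ?stat n \<omega>} \<le> 24 * measure \<nu> (space \<nu>) / L / sqrt n + (2 * a + 2 * b) / k"
      if n: "0 < n" and nc: "c < real n * v / k\<^sup>2" for n
    proof -
      let ?B1 = "{\<omega> \<in> space Om. L / 2 < \<bar>Ln n \<omega> - L\<bar>}"
      let ?B2 = "{\<omega> \<in> space Om. k < \<bar>m1 n \<omega>\<bar>}" and ?B3 = "{\<omega> \<in> space Om. k < \<bar>m2 n \<omega>\<bar>}"
      note [measurable] = borel_measurable_integrable[OF IL(1)[OF n]] borel_measurable_integrable[OF I1(1)[OF n]]
        borel_measurable_integrable[OF I2(1)[OF n]]
      have ev: "?B1 \<in> Om.events" "?B2 \<in> Om.events" "?B3 \<in> Om.events" by measurable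
      have evG: "{\<omega> \<in> space Om. c < ?stat n \<omega>} \<in> Om.events" by measurable
      have "space Om - {\<omega> \<in> space Om. c < ?stat n \<omega>} \<subseteq> ?B1 \<union> (?B2 \<union> ?B3)"
      proof (rule ccontr)
        assume "\<not> ?thesis"
        then obtain \<omega> where w0: "\<omega> \<in> space Om" "\<not> c < ?stat n \<omega>" "\<omega> \<notin> ?B1" "\<omega> \<notin> ?B2" "\<omega> \<notin> ?B3"
          by blast
        have w: "\<omega> \<in> space Om" "\<not> c < ?stat n \<omega>" "\<not> L / 2 < \<bar>Ln n \<omega> - L\<bar>" "m1 n \<omega> \<le> k" "m2 n \<omega> \<le> k"
          using w0 m0[of n \<omega>] by (simp_all add: not_less)
        have "L / 2 \<le> Ln n \<omega>" using w(3) by (simp add: abs_if split: if_splits)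
        then have "2 * L \<le> mean_abs_normal\<^sup>2 * dcov_sq n (?x \<omega>) (?y \<omega>)" using Ln_le[OF n, of \<omega>] by linarith
        then have dv: "v \<le> dcov_sq n (?x \<omega>) (?y \<omega>)"
          using mean_abs_normal_pos by (simp add: v_def pos_divide_le_eq mult.commute)
        then have "S2 n (?x \<omega>) (?y \<omega>) \<noteq> 0" using S2_eq_zero_imp_dcov_sq[OF n] v by force
        then have S2p: "0 < S2 n (?x \<omega>) (?y \<omega>)" using S2_nonneg[of n "?x \<omega>" "?y \<omega>"] by simp
        have S2k: "S2 n (?x \<omega>) (?y \<omega>) \<le> k\<^sup>2"
          unfolding S2m power2_eq_square using w m0 k by (intro mult_mono) auto
        have "real n * v / k\<^sup>2 \<le> real n * dcov_sq n (?x \<omega>) (?y \<omega>) / S2 n (?x \<omega>) (?y \<omega>)"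
          using dv v S2p S2k by (intro frac_le mult_left_mono mult_nonneg_nonneg) auto
        then show False using nc w(2) by (simp add: test_stat_def)
      qed
      then have "Om.prob (space Om - {\<omega> \<in> space Om. c < ?stat n \<omega>}) \<le> Om.prob (?B1 \<union> (?B2 \<union> ?B3))"
        by (intro Om.finite_measure_mono sets.Un ev)
      also have "\<dots> \<le> Om.prob ?B1 + (Om.prob ?B2 + Om.prob ?B3)"
        by (intro order_trans[OF measure_Un_le] add_left_mono ev sets.Un order_refl)
      also have "\<dots> \<le> (12 * measure \<nu> (space \<nu>) / sqrt n) / (L / 2) + (2 * a / k + 2 * b / k)"
        using L k(1) I1(2)[OF n] I2(2)[OF n] IL(2)[OF n]
        by (intro add_mono order_trans[OF Om.markov_abs] divide_right_mono IL(1) I1(1) I2(1) n) auto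
      finally show ?thesis using Om.prob_compl[OF evG] by (simp add: add_divide_distrib mult.commute[of L])
    qed
    have "(\<lambda>n. 24 * measure \<nu> (space \<nu>) / L / sqrt (real n)) \<longlonglongrightarrow> 0"
      by (intro tendsto_divide_0[OF tendsto_const] filterlim_at_top_imp_at_infinity
          filterlim_compose[OF sqrt_at_top filterlim_real_sequentially])
    then have "eventually (\<lambda>n. 24 * measure \<nu> (space \<nu>) / L / sqrt (real n) < e / 2) sequentially"
      using e by (intro order_tendstoD) auto
    then obtain n0 where n0: "\<And>n. n \<ge> n0 \<Longrightarrow> 24 * measure \<nu> (space \<nu>) / L / sqrt (real n) < e / 2"
      unfolding eventually_sequentially by blast
    obtain n1 :: nat where n1: "c * k\<^sup>2 / v < real n1" using reals_Archimedean2 by blast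
    show "\<exists>no. \<forall>n\<ge>no. norm (Om.prob {\<omega> \<in> space Om. c < ?stat n \<omega>} - 1) < e"
    proof (intro exI[of _ "Suc (max n0 n1)"] allI impI)
      fix n assume n: "Suc (max n0 n1) \<le> n"
      have "c * k\<^sup>2 / v < real n" using n n1 by (meson le_max_iff_disj Suc_leD less_le_trans of_nat_le_iff order_refl order_trans)
      then have "c < real n * v / k\<^sup>2" using v k(1) by (simp add: field_simps)
      then have "1 - Om.prob {\<omega> \<in> space Om. c < ?stat n \<omega>} \<le> 24 * measure \<nu> (space \<nu>) / L / sqrt n + (2 * a + 2 * b) / k"
        using n by (intro bound) auto
      moreover have "24 * measure \<nu> (space \<nu>) / L / sqrt n < e / 2" using n by (intro n0) auto
      ultimately have "1 - Om.prob {\<omega> \<in> space Om. c < ?stat n \<omega>} < e" using k(2) by linarith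
      moreover have "Om.prob {\<omega> \<in> space Om. c < ?stat n \<omega>} \<le> 1" by simp
      ultimately show "norm (Om.prob {\<omega> \<in> space Om. c < ?stat n \<omega>} - 1) < e" by simp
    qed
  qed
  then show ?thesis unfolding Om_def .
qed

lemma Int_stable_vimage: "Int_stable {Z -` A \<inter> \<Omega> | A. A \<in> sets M}"
proof (rule Int_stableI)
  fix S T assume "S \<in> {Z -` A \<inter> \<Omega> | A. A \<in> sets M}" "T \<in> {Z -` A \<inter> \<Omega> | A. A \<in> sets M}"
  then obtain A B where AB: "A \<in> sets M" "B \<in> sets M" "S = Z -` A \<inter> \<Omega>" "T = Z -` B \<inter> \<Omega>" by blast
  then have "S \<inter> T = Z -` (A \<inter> B) \<inter> \<Omega>" "A \<inter> B \<in> sets M" by auto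
  then show "S \<inter> T \<in> {Z -` A \<inter> \<Omega> | A. A \<in> sets M}" by blast
qed

lemma indep_vectors_iff:
  fixes X :: "'a \<Rightarrow> real ^ 'p" and Y :: "'a \<Rightarrow> real ^ 'q"
  assumes M: "prob_space M" and X [measurable]: "X \<in> borel_measurable M" and Y [measurable]: "Y \<in> borel_measurable M"
  shows "indep_vectors M X Y \<longleftrightarrow> (\<forall>A\<in>sets borel. \<forall>C\<in>sets borel.
    measure M {\<omega> \<in> space M. X \<omega> \<in> A \<and> Y \<omega> \<in> C} = measure M {\<omega> \<in> space M. X \<omega> \<in> A} * measure M {\<omega> \<in> space M. Y \<omega> \<in> C})"
proof -
  interpret prob_space M by (rule M)
  let ?GX = "{X -` A \<inter> space M | A. A \<in> sets borel}" and ?GY = "{Y -` B \<inter> space M | B. B \<in> sets borel}"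
  have eq: "X -` A \<inter> space M = {\<omega> \<in> space M. X \<omega> \<in> A}" "Y -` C \<inter> space M = {\<omega> \<in> space M. Y \<omega> \<in> C}" for A C by auto
  have int: "(X -` A \<inter> space M) \<inter> (Y -` C \<inter> space M) = {\<omega> \<in> space M. X \<omega> \<in> A \<and> Y \<omega> \<in> C}" for A C by auto
  show ?thesis
  proof
    assume ind: "indep_vectors M X Y"
    show "\<forall>A\<in>sets borel. \<forall>C\<in>sets borel.
      prob {\<omega> \<in> space M. X \<omega> \<in> A \<and> Y \<omega> \<in> C} = prob {\<omega> \<in> space M. X \<omega> \<in> A} * prob {\<omega> \<in> space M. Y \<omega> \<in> C}"
    proof (intro ballI)
      fix A :: "(real ^ 'p) set" and C :: "(real ^ 'q) set" assume "A \<in> sets borel" "C \<in> sets borel"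
      then have "X -` A \<inter> space M \<in> sigma_sets (space M) ?GX" "Y -` C \<inter> space M \<in> sigma_sets (space M) ?GY" by blast+
      from indep_setD[OF ind[unfolded indep_vectors_def] this]
      show "prob {\<omega> \<in> space M. X \<omega> \<in> A \<and> Y \<omega> \<in> C} = prob {\<omega> \<in> space M. X \<omega> \<in> A} * prob {\<omega> \<in> space M. Y \<omega> \<in> C}"
        unfolding int unfolding eq .
    qed
  next
    assume pr: "\<forall>A\<in>sets borel. \<forall>C\<in>sets borel.
      prob {\<omega> \<in> space M. X \<omega> \<in> A \<and> Y \<omega> \<in> C} = prob {\<omega> \<in> space M. X \<omega> \<in> A} * prob {\<omega> \<in> space M. Y \<omega> \<in> C}"
    have "indep_set ?GX ?GY"
    proof (rule indep_setI)
      show "?GX \<subseteq> events" "?GY \<subseteq> events" using measurable_sets[OF X] measurable_sets[OF Y] by auto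
      fix S T assume "S \<in> ?GX" "T \<in> ?GY"
      then obtain A C where AC: "A \<in> sets borel" "C \<in> sets borel" "S = X -` A \<inter> space M" "T = Y -` C \<inter> space M" by blast
      show "prob (S \<inter> T) = prob S * prob T"
        unfolding AC(3,4) int unfolding eq using pr AC(1,2) by blast
    qed
    then show "indep_vectors M X Y" unfolding indep_vectors_def by (intro indep_set_sigma_sets Int_stable_vimage)
  qed
qed

text \<open>
For \<open>n \<ge> 1\<close> the sample vector and the first \<open>n\<close> coordinates of the infinite product have the same
law, and the statistic is a measurable function of them. For \<open>n = 0\<close> the index set is empty and the
statistic is the constant \<open>0\<close> on both sides.
\<close>

lemma distr_test_stat:
  fixes X :: "'a \<Rightarrow> real ^ 'p" and Y :: "'a \<Rightarrow> real ^ 'q"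
  assumes M: "prob_space M" and X: "X \<in> borel_measurable M" and Y: "Y \<in> borel_measurable M"
    and S: "random_sample M X Y n N xs ys"
  defines "P \<equiv> distr M borel (\<lambda>\<omega>. (X \<omega>, Y \<omega>))"
  shows "distr N borel (\<lambda>\<omega>. test_stat n (\<lambda>k. xs k \<omega>) (\<lambda>k. ys k \<omega>)) =
    distr (PiM UNIV (\<lambda>_. P)) borel (\<lambda>\<omega>. test_stat n (\<lambda>k. fst (\<omega> k)) (\<lambda>k. snd (\<omega> k)))"
    and "(\<lambda>\<omega>. test_stat n (\<lambda>k. xs k \<omega>) (\<lambda>k. ys k \<omega>)) \<in> borel_measurable N"
proof -
  interpret N: prob_space N using S by (simp add: random_sample_def)
  interpret M: prob_space M by (rule M)
  have XY: "(\<lambda>\<omega>. (X \<omega>, Y \<omega>)) \<in> borel_measurable M" using X Y by (rule borel_measurable_Pair)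
  interpret P: prob_space P unfolding P_def by (rule M.prob_space_distr[OF XY])
  have sP: "sets P = sets borel" by (simp add: P_def)
  interpret Om: prob_space "PiM (UNIV :: nat set) (\<lambda>_. P)" by (rule prob_space_PiM) (rule P.prob_space_axioms)
  let ?z = "\<lambda>k \<omega>. (xs k \<omega>, ys k \<omega>)"
  have ind: "N.indep_vars (\<lambda>_. borel) ?z {1..n}" and law: "\<And>k. k \<in> {1..n} \<Longrightarrow> distr N borel (?z k) = P"
    using S unfolding random_sample_def P_def by blast+
  have rv: "?z k \<in> borel_measurable N" if "k \<in> {1..n}" for k
    using ind that unfolding N.indep_vars_def by blast
  have fs: "fst \<in> borel_measurable (borel :: ((real ^ 'p) \<times> (real ^ 'q)) measure)"
    "snd \<in> borel_measurable (borel :: ((real ^ 'p) \<times> (real ^ 'q)) measure)"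
    by (intro borel_measurable_continuous_onI continuous_intros)+
  show "(\<lambda>\<omega>. test_stat n (\<lambda>k. xs k \<omega>) (\<lambda>k. ys k \<omega>)) \<in> borel_measurable N"
    using measurable_compose[OF rv fs(1)] measurable_compose[OF rv fs(2)] by (intro measurable_test_stat) auto
  let ?f = "\<lambda>v. test_stat n (\<lambda>k. fst (v k :: (real ^ 'p) \<times> (real ^ 'q))) (\<lambda>k. snd (v k))"
  show "distr N borel (\<lambda>\<omega>. test_stat n (\<lambda>k. xs k \<omega>) (\<lambda>k. ys k \<omega>)) = distr (PiM UNIV (\<lambda>_. P)) borel ?f"
  proof (cases "n = 0")
    case True
    then show ?thesis by (simp add: test_stat_def N.distr_const Om.distr_const)
  next
    case False
    then have ne: "{1..n} \<noteq> {}" by simp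
    have fm: "?f \<in> borel_measurable (PiM {1..n} (\<lambda>_. borel))"
      by (intro measurable_test_stat measurable_compose[OF _ fs(1)] measurable_compose[OF _ fs(2)] measurable_component_singleton) auto
    have sPi: "sets (PiM I (\<lambda>_. P)) = sets (PiM I (\<lambda>_. borel))" for I :: "nat set" by (intro sets_PiM_cong) (simp_all add: sP)
    have fmP: "?f \<in> borel_measurable (PiM {1..n} (\<lambda>_. P))" using fm measurable_cong_sets[OF sPi refl] by blast
    have rs: "(\<lambda>\<omega>. \<lambda>k\<in>{1..n}. ?z k \<omega>) \<in> measurable N (PiM {1..n} (\<lambda>_. borel))"
      by (rule measurable_restrict) (rule rv)
    have "PiM {1..n} (\<lambda>k. distr N borel (?z k)) = PiM {1..n} (\<lambda>_. P)" by (intro PiM_cong refl law)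
    then have joint: "distr N (PiM {1..n} (\<lambda>_. borel)) (\<lambda>\<omega>. \<lambda>k\<in>{1..n}. ?z k \<omega>) = PiM {1..n} (\<lambda>_. P)"
      using N.indep_vars_iff_distr_eq_PiM'[OF ne, where M' = "\<lambda>_. borel" and X = ?z] rv ind by simp
    have "distr N borel (\<lambda>\<omega>. test_stat n (\<lambda>k. xs k \<omega>) (\<lambda>k. ys k \<omega>)) = distr N borel (?f \<circ> (\<lambda>\<omega>. \<lambda>k\<in>{1..n}. ?z k \<omega>))"
      by (intro arg_cong[where f = "distr N borel"] ext) (auto intro!: test_stat_cong)
    also have "\<dots> = distr (PiM {1..n} (\<lambda>_. P)) borel ?f"
      unfolding joint[symmetric] by (rule distr_distr[symmetric, OF fm rs])
    also have "PiM {1..n} (\<lambda>_. P) = distr (PiM UNIV (\<lambda>_. P)) (PiM {1..n} (\<lambda>_. P)) (\<lambda>v. restrict v {1..n})"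
      by (rule product_prob_space.distr_PiM_restrict_finite[OF product_prob_spaceI[OF P.prob_space_axioms], symmetric]) auto
    also have "distr \<dots> borel ?f = distr (PiM UNIV (\<lambda>_. P)) borel (?f \<circ> (\<lambda>v. restrict v {1..n}))"
      by (rule distr_distr[OF fmP measurable_restrict_subset]) simp
    also have "\<dots> = distr (PiM UNIV (\<lambda>_. P)) borel ?f"
      by (intro arg_cong[where f = "distr (PiM UNIV (\<lambda>_. P)) borel"] ext) (auto intro!: test_stat_cong)
    finally show ?thesis .
  qed
qed

section \<open>The limit theorem\<close>

lemma indep_vectors_distr_pair:
  fixes X :: "'a \<Rightarrow> real ^ 'p" and Y :: "'a \<Rightarrow> real ^ 'q"
  assumes M: "prob_space M" and X [measurable]: "X \<in> borel_measurable M" and Y [measurable]: "Y \<in> borel_measurable M"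
    and ind: "indep_vectors M X Y"
  shows "distr M borel (\<lambda>\<omega>. (X \<omega>, Y \<omega>)) = distr M borel X \<Otimes>\<^sub>M distr M borel Y"
proof -
  interpret M: prob_space M by (rule M)
  interpret PX: prob_space "distr M borel X" by (rule M.prob_space_distr) measurable
  interpret PY: prob_space "distr M borel Y" by (rule M.prob_space_distr) measurable
  have XY: "(\<lambda>\<omega>. (X \<omega>, Y \<omega>)) \<in> borel_measurable M" using X Y by (rule borel_measurable_Pair)
  show ?thesis
  proof (rule pair_measure_eqI[symmetric])
    show "sigma_finite_measure (distr M borel X)" "sigma_finite_measure (distr M borel Y)" by unfold_locales
    show "sets (distr M borel X \<Otimes>\<^sub>M distr M borel Y) = sets (distr M borel (\<lambda>\<omega>. (X \<omega>, Y \<omega>)))"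
      by (simp add: borel_prod[symmetric] cong: sets_pair_measure_cong)
    fix A C assume "A \<in> sets (distr M borel X)" "C \<in> sets (distr M borel Y)"
    then have A [measurable]: "A \<in> sets borel" and C [measurable]: "C \<in> sets borel" by simp_all
    have AC: "A \<times> C \<in> sets (borel :: ((real ^ 'p) \<times> (real ^ 'q)) measure)"
      unfolding borel_prod[symmetric] by (intro pair_measureI A C)
    have "M.prob {\<omega> \<in> space M. X \<omega> \<in> A \<and> Y \<omega> \<in> C} = M.prob {\<omega> \<in> space M. X \<omega> \<in> A} * M.prob {\<omega> \<in> space M. Y \<omega> \<in> C}"
      using ind A C unfolding indep_vectors_iff[OF M X Y] by blast
    moreover have "(\<lambda>\<omega>. (X \<omega>, Y \<omega>)) -` (A \<times> C) \<inter> space M = {\<omega> \<in> space M. X \<omega> \<in> A \<and> Y \<omega> \<in> C}"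
      "X -` A \<inter> space M = {\<omega> \<in> space M. X \<omega> \<in> A}" "Y -` C \<inter> space M = {\<omega> \<in> space M. Y \<omega> \<in> C}" by auto
    ultimately show "emeasure (distr M borel X) A * emeasure (distr M borel Y) C = emeasure (distr M borel (\<lambda>\<omega>. (X \<omega>, Y \<omega>))) (A \<times> C)"
      by (simp add: emeasure_distr[OF X A] emeasure_distr[OF Y C] emeasure_distr[OF XY AC] M.emeasure_eq_measure flip: ennreal_mult)
  qed
qed

lemma iid_std_normal_coordinates: "iid_std_normal (std_normals UNIV) (\<lambda>j w. w j)"
proof -
  have N: "prob_space std_normal_distribution" by (rule prob_space_normal_density) simp
  interpret W: prob_space "std_normals (UNIV :: nat set)" by (rule prob_space_std_normals)
  have "W.indep_vars (\<lambda>_. borel) (\<lambda>j w. w j) UNIV"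
    using W.indep_vars_compose2[OF indep_vars_PiM_coordinates[of "\<lambda>_. std_normal_distribution"], of "\<lambda>_ z. z" "\<lambda>_. borel"] N
    by simp
  moreover have "distributed (std_normals UNIV) lborel (\<lambda>w. w j) std_normal_density" for j :: nat
  proof -
    have "distr (std_normals UNIV) lborel (\<lambda>w. w j) = distr (std_normals UNIV) std_normal_distribution (\<lambda>w. w j)"
      by (rule distr_cong) simp_all
    also have "\<dots> = std_normal_distribution" by (rule distr_PiM_component) (use N in auto)
    finally show ?thesis unfolding distributed_def by simp
  qed
  ultimately show ?thesis unfolding iid_std_normal_def by blast
qed

theorem corollary2:
  fixes M :: "'a measure"
    and X :: "'a \<Rightarrow> real ^ 'p"
    and Y :: "'a \<Rightarrow> real ^ 'q"
  assumes "prob_space M"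
    and "X \<in> borel_measurable M"
    and "Y \<in> borel_measurable M"
    and "integrable M (\<lambda>\<omega>. norm (X \<omega>) + norm (Y \<omega>))"
  shows
    "(indep_vectors M X Y \<and> \<not> ae_constant M X \<and> \<not> ae_constant M Y \<longrightarrow>
       (\<exists>(lam :: nat \<Rightarrow> real) (W :: (nat \<Rightarrow> real) measure) Z Q.
          (\<forall>j. 0 \<le> lam j) \<and>
          prob_space W \<and> iid_std_normal W Z \<and>
          (AE w in W. summable (\<lambda>j. lam j * (Z j w)\<^sup>2)) \<and>
          Q \<in> borel_measurable W \<and> (AE w in W. 0 \<le> Q w) \<and>
          distr W borel Q = distr W borel (\<lambda>w. \<Sum>j. lam j * (Z j w)\<^sup>2) \<and>
          integrable W Q \<and> prob_space.expectation W Q = 1 \<and>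
          (\<forall>(N :: nat \<Rightarrow> 'b measure) xs ys.
             (\<forall>n. random_sample M X Y n (N n) (xs n) (ys n)) \<longrightarrow>
             weak_conv_m
               (\<lambda>n. distr (N n) borel (\<lambda>\<omega>. test_stat n (\<lambda>k. xs n k \<omega>) (\<lambda>k. ys n k \<omega>)))
               (distr W borel Q)))) \<and>
     (\<not> indep_vectors M X Y \<longrightarrow>
       (\<forall>(N :: nat \<Rightarrow> 'b measure) xs ys.
          (\<forall>n. random_sample M X Y n (N n) (xs n) (ys n)) \<longrightarrow>
          to_infinity_in_prob N
            (\<lambda>n \<omega>. test_stat n (\<lambda>k. xs n k \<omega>) (\<lambda>k. ys n k \<omega>))))"
proof -
  note M = assms(1) and X = assms(2) and Y = assms(3)
  interpret M: prob_space M by (rule M)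
  have XY: "(\<lambda>\<omega>. (X \<omega>, Y \<omega>)) \<in> borel_measurable M" using X Y by (rule borel_measurable_Pair)
  have nX: "(\<lambda>\<omega>. norm (X \<omega>)) \<in> borel_measurable M" and nY: "(\<lambda>\<omega>. norm (Y \<omega>)) \<in> borel_measurable M"
    using X Y by measurable
  have IX: "integrable M (\<lambda>\<omega>. norm (X \<omega>))"
    by (rule Bochner_Integration.integrable_bound[OF assms(4) nX]) simp
  have IY: "integrable M (\<lambda>\<omega>. norm (Y \<omega>))"
    by (rule Bochner_Integration.integrable_bound[OF assms(4) nY]) simp
  define P where "P = distr M borel (\<lambda>\<omega>. (X \<omega>, Y \<omega>))"
  let ?\<Omega> = "PiM (UNIV :: nat set) (\<lambda>_. P)"
  let ?stat = "\<lambda>n \<omega>. test_stat n (\<lambda>k. fst (\<omega> k :: (real ^ 'p) \<times> (real ^ 'q))) (\<lambda>k. snd (\<omega> k))"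
  have PP: "prob_space P" unfolding P_def by (rule M.prob_space_distr[OF XY])
  have P\<Omega>: "prob_space ?\<Omega>" by (rule prob_space_PiM) (rule PP)
  interpret \<Omega>: prob_space ?\<Omega> by (rule P\<Omega>)
  have sP: "sets P = sets borel" by (simp add: P_def)
  have fs: "fst \<in> borel_measurable P" "snd \<in> borel_measurable P"
    unfolding measurable_cong_sets[OF sP refl] by (intro borel_measurable_continuous_onI continuous_intros)+
  have meas: "?stat n \<in> borel_measurable ?\<Omega>" for n
    by (intro measurable_test_stat measurable_compose[OF measurable_component_singleton] fs) simp_all
  show ?thesis
  proof (intro conjI impI)
    assume i: "indep_vectors M X Y \<and> \<not> ae_constant M X \<and> \<not> ae_constant M Y"
    let ?PX = "distr M borel X" and ?PY = "distr M borel Y"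
    have P: "P = ?PX \<Otimes>\<^sub>M ?PY" unfolding P_def using i by (intro indep_vectors_distr_pair M X Y) simp
    have nc: "\<nexists>c. AE x in ?PX. x = c" "\<nexists>c. AE y in ?PY. y = c"
      using i X Y by (simp_all add: ae_constant_def AE_distr_iff)
    have "\<exists>lam. (\<forall>j. 0 \<le> lam j) \<and> lam sums 1 \<and>
      (\<forall>s\<ge>0. (\<lambda>n. \<integral>\<omega>. exp (- (s * ?stat n \<omega>)) \<partial>?\<Omega>) \<longlonglongrightarrow> (\<integral>w. exp (- (s * (\<Sum>j. lam j * (w j)\<^sup>2))) \<partial>std_normals UNIV))"
      unfolding P
    proof (rule laplace_test_stat)
      show "prob_space ?PX" "prob_space ?PY" by (intro M.prob_space_distr X Y)+
      show "integrable ?PX norm" "integrable ?PY norm"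
        using IX IY by (simp_all add: integrable_distr_eq[OF X] integrable_distr_eq[OF Y])
    qed (use nc in simp_all)
    then obtain lam :: "nat \<Rightarrow> real" where lam: "\<And>j. 0 \<le> lam j" "lam sums 1"
      "\<And>s. 0 \<le> s \<Longrightarrow> (\<lambda>n. \<integral>\<omega>. exp (- (s * ?stat n \<omega>)) \<partial>?\<Omega>) \<longlonglongrightarrow> (\<integral>w. exp (- (s * (\<Sum>j. lam j * (w j)\<^sup>2))) \<partial>std_normals UNIV)"
      by blast
    let ?W = "std_normals (UNIV :: nat set)" and ?Q = "\<lambda>w. \<Sum>j. lam j * (w j)\<^sup>2"
    note mix = chi_square_mixture[OF lam(1) sums_summable[OF lam(2)]]
    have Q: "?Q \<in> borel_measurable ?W" using mix(2) by simp
    have Q0: "AE w in ?W. 0 \<le> ?Q w" using mix(1) by eventually_elim (intro suminf_nonneg, simp_all add: lam(1))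
    have conv: "weak_conv_m (\<lambda>n. distr ?\<Omega> borel (?stat n)) (distr ?W borel ?Q)"
      by (rule weak_conv_of_laplace[OF P\<Omega> prob_space_std_normals meas Q _ Q0]) (auto simp: test_stat_nonneg intro!: lam(3))
    have "\<forall>(N :: nat \<Rightarrow> 'b measure) xs ys. (\<forall>n. random_sample M X Y n (N n) (xs n) (ys n)) \<longrightarrow>
       weak_conv_m (\<lambda>n. distr (N n) borel (\<lambda>\<omega>. test_stat n (\<lambda>k. xs n k \<omega>) (\<lambda>k. ys n k \<omega>))) (distr ?W borel ?Q)"
    proof (intro allI impI)
      fix N :: "nat \<Rightarrow> 'b measure" and xs ys
      assume S: "\<forall>n. random_sample M X Y n (N n) (xs n) (ys n)"
      have "distr (N n) borel (\<lambda>\<omega>. test_stat n (\<lambda>k. xs n k \<omega>) (\<lambda>k. ys n k \<omega>)) = distr ?\<Omega> borel (?stat n)" for n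
        unfolding P_def by (rule distr_test_stat(1)[OF M X Y]) (use S in blast)
      then show "weak_conv_m (\<lambda>n. distr (N n) borel (\<lambda>\<omega>. test_stat n (\<lambda>k. xs n k \<omega>) (\<lambda>k. ys n k \<omega>))) (distr ?W borel ?Q)"
        using conv by simp
    qed
    moreover have "(\<integral>w. ?Q w \<partial>?W) = 1" using mix(3) lam(2) by (simp add: sums_iff)
    ultimately show "\<exists>(lam :: nat \<Rightarrow> real) (W :: (nat \<Rightarrow> real) measure) Z Q.
          (\<forall>j. 0 \<le> lam j) \<and>
          prob_space W \<and> iid_std_normal W Z \<and>
          (AE w in W. summable (\<lambda>j. lam j * (Z j w)\<^sup>2)) \<and>
          Q \<in> borel_measurable W \<and> (AE w in W. 0 \<le> Q w) \<and>
          distr W borel Q = distr W borel (\<lambda>w. \<Sum>j. lam j * (Z j w)\<^sup>2) \<and>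
          integrable W Q \<and> prob_space.expectation W Q = 1 \<and>
          (\<forall>(N :: nat \<Rightarrow> 'b measure) xs ys.
             (\<forall>n. random_sample M X Y n (N n) (xs n) (ys n)) \<longrightarrow>
             weak_conv_m
               (\<lambda>n. distr (N n) borel (\<lambda>\<omega>. test_stat n (\<lambda>k. xs n k \<omega>) (\<lambda>k. ys n k \<omega>)))
               (distr W borel Q))"
      using lam(1) mix(1,2) Q Q0 iid_std_normal_coordinates prob_space_std_normals
      by (intro exI[of _ lam] exI[of _ ?W] exI[of _ "\<lambda>j w. w j"] exI[of _ ?Q] conjI) simp_all
  next
    assume dep: "\<not> indep_vectors M X Y"
    then obtain A C where A: "A \<in> sets borel" and C: "C \<in> sets borel"
      and ne: "M.prob {\<omega> \<in> space M. X \<omega> \<in> A \<and> Y \<omega> \<in> C} \<noteq> M.prob {\<omega> \<in> space M. X \<omega> \<in> A} * M.prob {\<omega> \<in> space M. Y \<omega> \<in> C}"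
      unfolding indep_vectors_iff[OF M X Y] by blast
    have ip: "iid_pairs P"
      unfolding iid_pairs_def iid_sequence_def iid_pairs_axioms_def by (intro conjI PP) (simp only: sP borel_prod)
    have int: "(\<integral>p. f p \<partial>P) = (\<integral>\<omega>. f (X \<omega>, Y \<omega>) \<partial>M)" if "f \<in> borel_measurable P" for f :: "_ \<Rightarrow> real"
      using that unfolding P_def by (intro integral_distr[OF XY]) simp
    have I1: "integrable P (\<lambda>p. norm (fst p))" and I2: "integrable P (\<lambda>p. norm (snd p))"
      using IX IY fs unfolding P_def by (simp_all add: integrable_distr_eq[OF XY])
    have iA: "(\<lambda>p. indicat_real A (fst p)) \<in> borel_measurable P" and iC: "(\<lambda>p. indicat_real C (snd p)) \<in> borel_measurable P"
      by (intro measurable_compose[OF fs(1)] measurable_compose[OF fs(2)] borel_measurable_indicator A C)+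
    have ind: "(\<integral>\<omega>. indicat_real {\<omega> \<in> space M. R \<omega>} \<omega> \<partial>M) = M.prob {\<omega> \<in> space M. R \<omega>}" for R
      by (simp add: Int_absorb2 Collect_conj_eq)
    have ne': "(\<integral>p. indicat_real A (fst p) * indicat_real C (snd p) \<partial>P) \<noteq> (\<integral>p. indicat_real A (fst p) \<partial>P) * (\<integral>p. indicat_real C (snd p) \<partial>P)"
    proof -
      have "(\<integral>p. indicat_real A (fst p) * indicat_real C (snd p) \<partial>P) = (\<integral>\<omega>. indicat_real {\<omega> \<in> space M. X \<omega> \<in> A \<and> Y \<omega> \<in> C} \<omega> \<partial>M)"
        unfolding int[OF borel_measurable_times[OF iA iC]] by (intro Bochner_Integration.integral_cong) (auto simp: indicator_def)
      moreover have "(\<integral>p. indicat_real A (fst p) \<partial>P) = (\<integral>\<omega>. indicat_real {\<omega> \<in> space M. X \<omega> \<in> A} \<omega> \<partial>M)"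
        unfolding int[OF iA] by (intro Bochner_Integration.integral_cong) (auto simp: indicator_def)
      moreover have "(\<integral>p. indicat_real C (snd p) \<partial>P) = (\<integral>\<omega>. indicat_real {\<omega> \<in> space M. Y \<omega> \<in> C} \<omega> \<partial>M)"
        unfolding int[OF iC] by (intro Bochner_Integration.integral_cong) (auto simp: indicator_def)
      ultimately show ?thesis using ne by (simp only: ind not_False_eq_True)
    qed
    show "\<forall>(N :: nat \<Rightarrow> 'b measure) xs ys. (\<forall>n. random_sample M X Y n (N n) (xs n) (ys n)) \<longrightarrow>
          to_infinity_in_prob N (\<lambda>n \<omega>. test_stat n (\<lambda>k. xs n k \<omega>) (\<lambda>k. ys n k \<omega>))"
      unfolding to_infinity_in_prob_def
    proof (intro allI impI)
      fix N :: "nat \<Rightarrow> 'b measure" and xs ys c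
      assume S: "\<forall>n. random_sample M X Y n (N n) (xs n) (ys n)"
      have "measure (N n) {\<omega> \<in> space (N n). c < test_stat n (\<lambda>k. xs n k \<omega>) (\<lambda>k. ys n k \<omega>)} = measure ?\<Omega> {\<omega> \<in> space ?\<Omega>. c < ?stat n \<omega>}" for n
      proof -
        let ?T = "\<lambda>\<omega>. test_stat n (\<lambda>k. xs n k \<omega>) (\<lambda>k. ys n k \<omega>)"
        have S': "random_sample M X Y n (N n) (xs n) (ys n)" using S by blast
        have "measure (N n) {\<omega> \<in> space (N n). c < ?T \<omega>} = measure (distr (N n) borel ?T) {c<..}"
          using distr_test_stat(2)[OF M X Y S'] by (subst measure_distr) (auto intro!: arg_cong[where f = "measure (N n)"])
        also have "\<dots> = measure (distr ?\<Omega> borel (?stat n)) {c<..}"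
          unfolding distr_test_stat(1)[OF M X Y S'] P_def ..
        also have "\<dots> = measure ?\<Omega> {\<omega> \<in> space ?\<Omega>. c < ?stat n \<omega>}"
          using meas[of n] by (subst measure_distr) (auto intro!: arg_cong[where f = "measure ?\<Omega>"])
        finally show ?thesis .
      qed
      then show "(\<lambda>n. measure (N n) {\<omega> \<in> space (N n). c < test_stat n (\<lambda>k. xs n k \<omega>) (\<lambda>k. ys n k \<omega>)}) \<longlonglongrightarrow> 1"
        using test_stat_diverges[OF ip I1 I2 A C ne', of c] by simp
    qed
  qed
qed

end
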